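(* Let $(M_1,g_1)$ and $(M_2,g_2)$ be connected Riemannian manifolds of dimension at least two, $f:M_1\times M_2\to\mathbb{R}_+$ a smooth function and $g=g_1+fg_2$ a twisted product metric on $M=M_1\times M_2$. Then the following are equivalent: (i) the umbilic submanifolds $M_1\times\{p_2\}$ are distinguished for every $p_2\in M_2$; (ii) the umbilic submanifolds $\{p_1\}\times M_2$ are distinguished for every $p_1\in M_1$; (iii) the function $f$ can be written as a product $f=f_1f_2$ of functions $f_i:M_i\to\mathbb{R}_+$, $i=1,2$; (iv) $g$ is a warped product metric $g_1+f_1\tilde g_2$, with $f_1:M_1\to\mathbb{R}_+$, for some metric $\tilde g_2$ on $M_2$ conformal to $g_2$; (v) $g$ is conformal to a product metric $\tilde g_1+\tilde g_2$ on $M_1\times M_2$.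
   Context: The pullback of a metric $g_i$ on $M_i$ to $M_1\times M_2$ is also denoted $g_i$. For a Riemannian manifold $(M,g)$ of dimension $n\ge3$ the Schouten tensor is $P_{ab}=\frac1{n-2}\big(R_{ab}-\frac{\mathrm{Sc}}{2(n-1)}g_{ab}\big)$, with $R_{ab}$ the Ricci tensor and $\mathrm{Sc}$ the scalar curvature. For an embedded submanifold $\Sigma$ of dimension $m$, $I\!I_{ij}{}^c$ is the second fundamental form, $H^c=\frac1mg^{ij}I\!I_{ij}{}^c$ the mean curvature vector, $\mathring{I\!I}_{ij}{}^c=I\!I_{ij}{}^c-g_{ij}H^c$, $\mathrm{N}^c_a$ the orthogonal projection onto the normal bundle, $\nabla_i$ the pullback of the Levi-Civita connection to $\Sigma$, and $P_i{}^a$ is $P_b{}^a$ with first index restricted to $T\Sigma$. $\Sigma$ is umbilic if $\mathring{I\!I}=0$. $\Sigma$ is (conformally) distinguished if its conformal tractor second fundamental form vanishes; explicitly, this is the conformally invariant condition that, for one (equivalently every) metric in the conformal class of $g$, $\mathring{I\!I}_{ij}{}^c=0$ and $\mathrm{N}^c_a(P_i{}^a-\nabla_iH^a)=0$. *)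

theory Defs
  imports "HOL-Analysis.Analysis"
begin

section \<open>Smooth maps between open subsets of Euclidean spaces\<close>

text \<open>Only meant for open \<open>S\<close>. In finite dimension the iterated directional derivatives
  determine all partial derivatives, so this is the usual class \<open>C\<^sup>k\<close>.\<close>

primrec Ck_on :: "nat \<Rightarrow> 'a::euclidean_space set \<Rightarrow> ('a \<Rightarrow> 'b::real_normed_vector) \<Rightarrow> bool" where
  "Ck_on 0 S f \<longleftrightarrow> continuous_on S f"
| "Ck_on (Suc k) S f \<longleftrightarrow>
     (\<forall>x\<in>S. f differentiable (at x)) \<and> (\<forall>v. Ck_on k S (\<lambda>x. frechet_derivative f (at x) v))"

definition smooth_on :: "'a::euclidean_space set \<Rightarrow> ('a \<Rightarrow> 'b::real_normed_vector) \<Rightarrow> bool" where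
  "smooth_on S f \<longleftrightarrow> (\<forall>k. Ck_on k S f)"


section \<open>Smooth manifolds\<close>

text \<open>A chart is a pair of its domain and its coordinate map; only the values of the coordinate
  map on the domain matter. The dimension of a manifold is the dimension of the model space
  \<open>'e\<close>. The atlas need not be maximal.\<close>

type_synonym ('a, 'e) chart = "'a set \<times> ('a \<Rightarrow> 'e)"

record ('a, 'e) manifold =
  mtop :: "'a topology"
  atlas :: "('a, 'e) chart set"

abbreviation points :: "('a, 'e) manifold \<Rightarrow> 'a set" where
  "points M \<equiv> topspace (mtop M)"

definition chart_inv :: "('a, 'e) chart \<Rightarrow> 'e \<Rightarrow> 'a" where
  "chart_inv c = inv_into (fst c) (snd c)"

definition is_chart :: "'a topology \<Rightarrow> ('a, 'e::euclidean_space) chart \<Rightarrow> bool" where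
  "is_chart X c \<longleftrightarrow> openin X (fst c) \<and> open (snd c ` fst c) \<and>
     homeomorphic_map (subtopology X (fst c)) (top_of_set (snd c ` fst c)) (snd c)"

definition smooth_manifold :: "('a, 'e::euclidean_space) manifold \<Rightarrow> bool" where
  "smooth_manifold M \<longleftrightarrow>
     Hausdorff_space (mtop M) \<and> second_countable (mtop M) \<and>
     (\<forall>c\<in>atlas M. is_chart (mtop M) c) \<and> (\<Union>c\<in>atlas M. fst c) = points M \<and>
     (\<forall>c\<in>atlas M. \<forall>d\<in>atlas M. smooth_on (snd c ` (fst c \<inter> fst d)) (snd d \<circ> chart_inv c))"

definition smooth_fun :: "('a, 'e::euclidean_space) manifold \<Rightarrow> ('a \<Rightarrow> real) \<Rightarrow> bool" where
  "smooth_fun M h \<longleftrightarrow> (\<forall>c\<in>atlas M. smooth_on (snd c ` fst c) (h \<circ> chart_inv c))"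

definition local_rep :: "('a, 'd) chart \<Rightarrow> ('b, 'e) chart \<Rightarrow> ('a \<Rightarrow> 'b) \<Rightarrow> 'd \<Rightarrow> 'e" where
  "local_rep c d F = snd d \<circ> F \<circ> chart_inv c"

definition local_dom :: "('a, 'd) chart \<Rightarrow> ('b, 'e) chart \<Rightarrow> ('a \<Rightarrow> 'b) \<Rightarrow> 'd set" where
  "local_dom c d F = snd c ` {p \<in> fst c. F p \<in> fst d}"

definition smooth_map ::
  "('a, 'd::euclidean_space) manifold \<Rightarrow> ('b, 'e::euclidean_space) manifold \<Rightarrow> ('a \<Rightarrow> 'b) \<Rightarrow> bool" where
  "smooth_map M N F \<longleftrightarrow> continuous_map (mtop M) (mtop N) F \<and>
     (\<forall>c\<in>atlas M. \<forall>d\<in>atlas N. smooth_on (local_dom c d F) (local_rep c d F))"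

definition smooth_embedding ::
  "('a, 'd::euclidean_space) manifold \<Rightarrow> ('b, 'e::euclidean_space) manifold \<Rightarrow> ('a \<Rightarrow> 'b) \<Rightarrow> bool" where
  "smooth_embedding S M F \<longleftrightarrow> smooth_map S M F \<and> embedding_map (mtop S) (mtop M) F \<and>
     (\<forall>c\<in>atlas S. \<forall>d\<in>atlas M. \<forall>x\<in>local_dom c d F.
        inj (frechet_derivative (local_rep c d F) (at x)))"

definition prod_manifold :: "('a, 'd) manifold \<Rightarrow> ('b, 'e) manifold \<Rightarrow> ('a \<times> 'b, 'd \<times> 'e) manifold" where
  "prod_manifold M N = \<lparr> mtop = prod_topology (mtop M) (mtop N),
     atlas = {(fst c \<times> fst d, map_prod (snd c) (snd d)) | c d. c \<in> atlas M \<and> d \<in> atlas N} \<rparr>"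


section \<open>Riemannian metrics\<close>

text \<open>A covariant 2-tensor is given by its components: \<open>g c p v w\<close> is the value at the point \<open>p\<close>
  on the two tangent vectors whose coordinates in the chart \<open>c\<close> are \<open>v\<close> and \<open>w\<close>. Only charts
  of the atlas and points of their domains matter.\<close>

type_synonym ('a, 'e) tensor2 = "('a, 'e) chart \<Rightarrow> 'a \<Rightarrow> 'e \<Rightarrow> 'e \<Rightarrow> real"

text \<open>The last clause is the transformation law of a covariant 2-tensor under change of chart.\<close>

definition riemannian_metric ::
  "('a, 'e::euclidean_space) manifold \<Rightarrow> ('a, 'e) tensor2 \<Rightarrow> bool" where
  "riemannian_metric M g \<longleftrightarrow>
     (\<forall>c\<in>atlas M. \<forall>v w. smooth_on (snd c ` fst c) (\<lambda>x. g c (chart_inv c x) v w)) \<and>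
     (\<forall>c\<in>atlas M. \<forall>p\<in>fst c. bilinear (g c p) \<and> (\<forall>v w. g c p v w = g c p w v) \<and>
        (\<forall>v. v \<noteq> 0 \<longrightarrow> g c p v v > 0)) \<and>
     (\<forall>c\<in>atlas M. \<forall>d\<in>atlas M. \<forall>p\<in>fst c \<inter> fst d. \<forall>v w.
        g c p v w = g d p (frechet_derivative (snd d \<circ> chart_inv c) (at (snd c p)) v)
                          (frechet_derivative (snd d \<circ> chart_inv c) (at (snd c p)) w))"

definition tensor_eq :: "('a, 'e) manifold \<Rightarrow> ('a, 'e) tensor2 \<Rightarrow> ('a, 'e) tensor2 \<Rightarrow> bool" where
  "tensor_eq M g h \<longleftrightarrow> (\<forall>c\<in>atlas M. \<forall>p\<in>fst c. \<forall>v w. g c p v w = h c p v w)"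

definition conformal ::
  "('a, 'e::euclidean_space) manifold \<Rightarrow> ('a, 'e) tensor2 \<Rightarrow> ('a, 'e) tensor2 \<Rightarrow> bool" where
  "conformal M g h \<longleftrightarrow> (\<exists>\<Omega>. smooth_fun M \<Omega> \<and> (\<forall>p\<in>points M. \<Omega> p > 0) \<and>
     tensor_eq M g (\<lambda>c p v w. \<Omega> p * h c p v w))"

text \<open>By the transformation law the choice of the chart \<open>d\<close> around \<open>F p\<close> is immaterial.\<close>

definition pullback ::
  "('b, 'e::euclidean_space) manifold \<Rightarrow> ('a \<Rightarrow> 'b) \<Rightarrow> ('b, 'e) tensor2 \<Rightarrow> ('a, 'd::euclidean_space) tensor2" where
  "pullback N F g = (\<lambda>c p v w.
     let d = (SOME d. d \<in> atlas N \<and> F p \<in> fst d);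
         D = frechet_derivative (local_rep c d F) (at (snd c p))
     in g d (F p) (D v) (D w))"

definition twisted_product ::
  "('a, 'd::euclidean_space) manifold \<Rightarrow> ('b, 'e::euclidean_space) manifold \<Rightarrow>
   ('a, 'd) tensor2 \<Rightarrow> ('a \<times> 'b \<Rightarrow> real) \<Rightarrow> ('b, 'e) tensor2 \<Rightarrow> ('a \<times> 'b, 'd \<times> 'e) tensor2" where
  "twisted_product M\<^sub>1 M\<^sub>2 g\<^sub>1 f g\<^sub>2 =
     (\<lambda>c p v w. pullback M\<^sub>1 fst g\<^sub>1 c p v w + f p * pullback M\<^sub>2 snd g\<^sub>2 c p v w)"

definition warped_product ::
  "('a, 'd::euclidean_space) manifold \<Rightarrow> ('b, 'e::euclidean_space) manifold \<Rightarrow>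
   ('a, 'd) tensor2 \<Rightarrow> ('a \<Rightarrow> real) \<Rightarrow> ('b, 'e) tensor2 \<Rightarrow> ('a \<times> 'b, 'd \<times> 'e) tensor2" where
  "warped_product M\<^sub>1 M\<^sub>2 g\<^sub>1 f\<^sub>1 g\<^sub>2 = twisted_product M\<^sub>1 M\<^sub>2 g\<^sub>1 (f\<^sub>1 \<circ> fst) g\<^sub>2"

definition product_metric ::
  "('a, 'd::euclidean_space) manifold \<Rightarrow> ('b, 'e::euclidean_space) manifold \<Rightarrow>
   ('a, 'd) tensor2 \<Rightarrow> ('b, 'e) tensor2 \<Rightarrow> ('a \<times> 'b, 'd \<times> 'e) tensor2" where
  "product_metric M\<^sub>1 M\<^sub>2 g\<^sub>1 g\<^sub>2 = twisted_product M\<^sub>1 M\<^sub>2 g\<^sub>1 (\<lambda>_. 1) g\<^sub>2"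

definition local_metric :: "('a, 'e) tensor2 \<Rightarrow> ('a, 'e) chart \<Rightarrow> 'e \<Rightarrow> 'e \<Rightarrow> 'e \<Rightarrow> real" where
  "local_metric g c = (\<lambda>x. g c (chart_inv c x))"


section \<open>Curvature in coordinates\<close>

text \<open>In this section and the next, \<open>G x\<close> is the matrix of metric components at the coordinate
  point \<open>x\<close>, viewed as a bilinear form. First, for an inner product \<open>B\<close>: the vector obtained from the
  covector \<open>\<alpha>\<close> by raising its index, and the components \<open>B\<^sup>i\<^sup>j\<close> of the inverse (\<open>i\<close>, \<open>j\<close> are basis
  vectors).\<close>

definition raise :: "('e::euclidean_space \<Rightarrow> 'e \<Rightarrow> real) \<Rightarrow> ('e \<Rightarrow> real) \<Rightarrow> 'e" where
  "raise B \<alpha> = (THE u. \<forall>z. B u z = \<alpha> z)"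

definition inverse_comp :: "('e::euclidean_space \<Rightarrow> 'e \<Rightarrow> real) \<Rightarrow> 'e \<Rightarrow> 'e \<Rightarrow> real" where
  "inverse_comp B i j = raise B (\<lambda>z. z \<bullet> i) \<bullet> j"

text \<open>\<open>christoffel G x v w\<close> is \<open>\<Gamma>\<^sup>k\<^sub>i\<^sub>j v\<^sup>i w\<^sup>j\<close>, and \<open>riemann G x v w z\<close> is \<open>R(v,w)z\<close>, with
  \<open>R(v,w) = [\<nabla>\<^sub>v, \<nabla>\<^sub>w] - \<nabla>\<^sub>[\<^sub>v\<^sub>,\<^sub>w\<^sub>]\<close>. The Ricci tensor \<open>Ric(w,z)\<close> is the trace of \<open>v \<mapsto> R(v,w)z\<close>,
  so that it is positive on round spheres.\<close>

definition christoffel ::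
  "('e::euclidean_space \<Rightarrow> 'e \<Rightarrow> 'e \<Rightarrow> real) \<Rightarrow> 'e \<Rightarrow> 'e \<Rightarrow> 'e \<Rightarrow> 'e" where
  "christoffel G x v w = raise (G x) (\<lambda>z.
     (frechet_derivative (\<lambda>y. G y w z) (at x) v + frechet_derivative (\<lambda>y. G y v z) (at x) w
       - frechet_derivative (\<lambda>y. G y v w) (at x) z) / 2)"

definition riemann ::
  "('e::euclidean_space \<Rightarrow> 'e \<Rightarrow> 'e \<Rightarrow> real) \<Rightarrow> 'e \<Rightarrow> 'e \<Rightarrow> 'e \<Rightarrow> 'e \<Rightarrow> 'e" where
  "riemann G x v w z =
     frechet_derivative (\<lambda>y. christoffel G y w z) (at x) v
     - frechet_derivative (\<lambda>y. christoffel G y v z) (at x) w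
     + christoffel G x v (christoffel G x w z) - christoffel G x w (christoffel G x v z)"

definition ricci ::
  "('e::euclidean_space \<Rightarrow> 'e \<Rightarrow> 'e \<Rightarrow> real) \<Rightarrow> 'e \<Rightarrow> 'e \<Rightarrow> 'e \<Rightarrow> real" where
  "ricci G x w z = (\<Sum>b\<in>Basis. riemann G x b w z \<bullet> b)"

definition scalar_curvature :: "('e::euclidean_space \<Rightarrow> 'e \<Rightarrow> 'e \<Rightarrow> real) \<Rightarrow> 'e \<Rightarrow> real" where
  "scalar_curvature G x = (\<Sum>i\<in>Basis. \<Sum>j\<in>Basis. inverse_comp (G x) i j * ricci G x i j)"

definition schouten ::
  "('e::euclidean_space \<Rightarrow> 'e \<Rightarrow> 'e \<Rightarrow> real) \<Rightarrow> 'e \<Rightarrow> 'e \<Rightarrow> 'e \<Rightarrow> real" where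
  "schouten G x v w = 1 / (real DIM('e) - 2) *
     (ricci G x v w - scalar_curvature G x / (2 * (real DIM('e) - 1)) * G x v w)"


section \<open>Submanifolds in coordinates\<close>

text \<open>The map \<open>u\<close> is the coordinate expression of the inclusion of a submanifold, so that the tangent
  space at \<open>u x\<close> is the range of its derivative.\<close>

definition induced_metric ::
  "('e::euclidean_space \<Rightarrow> 'e \<Rightarrow> 'e \<Rightarrow> real) \<Rightarrow> ('d::euclidean_space \<Rightarrow> 'e) \<Rightarrow> 'd \<Rightarrow> 'd \<Rightarrow> 'd \<Rightarrow> real" where
  "induced_metric G u x v w =
     G (u x) (frechet_derivative u (at x) v) (frechet_derivative u (at x) w)"

definition normal_proj ::
  "('e::euclidean_space \<Rightarrow> 'e \<Rightarrow> 'e \<Rightarrow> real) \<Rightarrow> ('d::euclidean_space \<Rightarrow> 'e) \<Rightarrow> 'd \<Rightarrow> 'e \<Rightarrow> 'e" where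
  "normal_proj G u x w = (THE n. w - n \<in> range (frechet_derivative u (at x)) \<and>
     (\<forall>v. G (u x) n (frechet_derivative u (at x) v) = 0))"

text \<open>The pullback of the Levi-Civita connection, acting on an ambient vector field \<open>Y\<close> along \<open>u\<close>.\<close>

definition cov_along ::
  "('e::euclidean_space \<Rightarrow> 'e \<Rightarrow> 'e \<Rightarrow> real) \<Rightarrow> ('d::euclidean_space \<Rightarrow> 'e) \<Rightarrow> ('d \<Rightarrow> 'e) \<Rightarrow> 'd \<Rightarrow> 'd \<Rightarrow> 'e" where
  "cov_along G u Y x v = frechet_derivative Y (at x) v
     + christoffel G (u x) (frechet_derivative u (at x) v) (Y x)"

definition second_ff ::
  "('e::euclidean_space \<Rightarrow> 'e \<Rightarrow> 'e \<Rightarrow> real) \<Rightarrow> ('d::euclidean_space \<Rightarrow> 'e) \<Rightarrow> 'd \<Rightarrow> 'd \<Rightarrow> 'd \<Rightarrow> 'e" where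
  "second_ff G u x v w =
     normal_proj G u x (cov_along G u (\<lambda>y. frechet_derivative u (at y) w) x v)"

definition mean_curvature ::
  "('e::euclidean_space \<Rightarrow> 'e \<Rightarrow> 'e \<Rightarrow> real) \<Rightarrow> ('d::euclidean_space \<Rightarrow> 'e) \<Rightarrow> 'd \<Rightarrow> 'e" where
  "mean_curvature G u x = (1 / real DIM('d)) *\<^sub>R
     (\<Sum>i\<in>Basis. \<Sum>j\<in>Basis. inverse_comp (induced_metric G u x) i j *\<^sub>R second_ff G u x i j)"

definition tracefree_ff ::
  "('e::euclidean_space \<Rightarrow> 'e \<Rightarrow> 'e \<Rightarrow> real) \<Rightarrow> ('d::euclidean_space \<Rightarrow> 'e) \<Rightarrow> 'd \<Rightarrow> 'd \<Rightarrow> 'd \<Rightarrow> 'e" where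
  "tracefree_ff G u x v w =
     second_ff G u x v w - induced_metric G u x v w *\<^sub>R mean_curvature G u x"


section \<open>Umbilic and distinguished submanifolds\<close>

text \<open>An embedded submanifold of \<open>M\<close> is given as the image of a smooth embedding \<open>F\<close> of a
  manifold \<open>S\<close>; the conditions below do not depend on the choice of \<open>F\<close>.\<close>

definition umbilic ::
  "('b, 'e::euclidean_space) manifold \<Rightarrow> ('b, 'e) tensor2 \<Rightarrow>
   ('a, 'd::euclidean_space) manifold \<Rightarrow> ('a \<Rightarrow> 'b) \<Rightarrow> bool" where
  "umbilic M g S F \<longleftrightarrow> smooth_embedding S M F \<and>
     (\<forall>c\<in>atlas S. \<forall>d\<in>atlas M. \<forall>x\<in>local_dom c d F. \<forall>v w.
        tracefree_ff (local_metric g d) (local_rep c d F) x v w = 0)"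

text \<open>\<open>P\<^sub>i\<^sup>a\<close> is \<open>raise (G (u x)) (schouten G (u x) (Du v))\<close> with \<open>v\<close> in the slot \<open>i\<close>. The
  conditions are imposed on some metric \<open>h\<close> in the conformal class of \<open>g\<close>.\<close>

definition distinguished ::
  "('b, 'e::euclidean_space) manifold \<Rightarrow> ('b, 'e) tensor2 \<Rightarrow>
   ('a, 'd::euclidean_space) manifold \<Rightarrow> ('a \<Rightarrow> 'b) \<Rightarrow> bool" where
  "distinguished M g S F \<longleftrightarrow> (\<exists>h. riemannian_metric M h \<and> conformal M h g \<and> umbilic M h S F \<and>
     (\<forall>c\<in>atlas S. \<forall>d\<in>atlas M. \<forall>x\<in>local_dom c d F. \<forall>v.
        let G = local_metric h d; u = local_rep c d F in
          normal_proj G u x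
            (raise (G (u x)) (schouten G (u x) (frechet_derivative u (at x) v))
             - cov_along G u (mean_curvature G u) x v) = 0))"

end

theory Submission
  imports Defs
begin

text \<open>Any metric conformal to \<open>g\<close> has the form \<open>h = e\<^sup>a g\<^sub>1 + e\<^sup>b g\<^sub>2\<close> with \<open>e\<^sup>b\<^sup>-\<^sup>a = f\<close>. Let \<open>X\<close> be
  tangent to \<open>M\<^sub>1\<close>, \<open>V\<close> tangent to \<open>M\<^sub>2\<close>, and \<open>n = n\<^sub>1 + n\<^sub>2\<close>. The second fundamental form of
  \<open>M\<^sub>1 \<times> {p\<^sub>2}\<close> is the induced metric times the normal vector \<open>H\<close> with \<open>h(H,V) = -V(a)/2\<close>, so these
  submanifolds are umbilic. The mixed Ricci curvature is
  \<open>Ric(X,V) = -((n\<^sub>1 - 1) XV(a) + (n\<^sub>2 - 1) XV(b))/2 + (n - 2) V(a) X(b)/4\<close>, and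
  \<open>P(X,V) - h(\<nabla>\<^sub>X H,V) = (n\<^sub>2 - 1)/(2(n - 2)) XV(a - b)\<close>. Hence the condition for being distinguished
  is \<open>XV(ln f) = 0\<close>, whatever the conformal factor; exchanging the factors gives the same condition
  for the other family. On a product of convex coordinate domains it says that \<open>ln f\<close> is a sum of
  functions of the two variables, and connectedness makes this global.\<close>

section \<open>Calculus of smooth functions\<close>

text \<open>\<open>distinguished\<close> only asserts that some metric of the conformal class works,
  and that metric may change from leaf to leaf. No metric can therefore be fixed in advance: the
  computation is made with two independent exponents \<open>a\<close> and \<open>b\<close>, and in
  this form the exchange of the factors is a mere renaming. The Christoffel symbols are defined
  through a definite description (\<open>raise\<close>), so that differentiating them means
  differentiating the solution of a linear system; identities between them are verified after
  lowering the index. The dimension hypotheses enter through constants that must not vanish: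
  \<open>n - 2\<close> in the Schouten tensor, and \<open>n\<^sub>2 - 1\<close> (for the other
  family \<open>n\<^sub>1 - 1\<close>) in front of the mixed derivative. The factors in (iii) are
  arbitrary positive functions. Smooth ones are recovered as slices of \<open>f\<close> through a
  base point, and the way back from (iii) to the differential equation also differentiates only
  slices of \<open>ln f\<close>, never the given factors.\<close>

abbreviation dd :: "('a::real_normed_vector \<Rightarrow> 'b::real_normed_vector) \<Rightarrow> 'a \<Rightarrow> 'a \<Rightarrow> 'b" where
  "dd f x \<equiv> frechet_derivative f (at x)"

lemma dd_eq: "(f has_derivative f') (at x) \<Longrightarrow> dd f x = f'"
  by (rule frechet_derivative_at[symmetric])

lemma dd_works: "f differentiable (at x) \<Longrightarrow> (f has_derivative dd f x) (at x)"
  by (simp add: frechet_derivative_works)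

lemma has_derivative_cong_open:
  assumes "open S" "x \<in> S" and eq: "\<And>y. y \<in> S \<Longrightarrow> f y = g y"
  shows "(f has_derivative f') (at x) \<longleftrightarrow> (g has_derivative f') (at x)"
proof
  assume "(f has_derivative f') (at x)"
  from has_derivative_transform_within_open[OF this assms(1,2) eq]
  show "(g has_derivative f') (at x)" .
next
  assume "(g has_derivative f') (at x)"
  from has_derivative_transform_within_open[OF this assms(1,2) eq[symmetric]]
  show "(f has_derivative f') (at x)" .
qed

text \<open>\<open>frechet_derivative\<close> chooses among all derivatives of the function, and by
  the previous lemma both functions have the same ones. Hence this holds even at points where
  neither is differentiable.\<close>

lemma dd_cong_open:
  assumes "open S" "x \<in> S" "\<And>y. y \<in> S \<Longrightarrow> f y = g y"
  shows "dd f x = dd g x"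
  by (simp only: frechet_derivative_def has_derivative_cong_open[OF assms])

lemma differentiable_cong_open:
  assumes "open S" "x \<in> S" "\<And>y. y \<in> S \<Longrightarrow> f y = g y"
  shows "f differentiable (at x) \<longleftrightarrow> g differentiable (at x)"
  by (simp only: differentiable_def has_derivative_cong_open[OF assms])

lemma Ck_on_cong:
  assumes "open S" "\<And>y. y \<in> S \<Longrightarrow> f y = g y"
  shows "Ck_on k S f \<longleftrightarrow> Ck_on k S g"
  using assms(2)
proof (induction k arbitrary: f g)
  case 0
  show ?case using continuous_on_cong[OF refl 0] by simp
next
  case (Suc k)
  have "Ck_on k S (\<lambda>x. dd f x v) \<longleftrightarrow> Ck_on k S (\<lambda>x. dd g x v)" for v
    by (rule Suc.IH) (simp only: dd_cong_open[OF assms(1) _ Suc.prems])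
  moreover have "(\<forall>x\<in>S. f differentiable (at x)) \<longleftrightarrow> (\<forall>x\<in>S. g differentiable (at x))"
    by (rule ball_cong) (simp_all only: differentiable_cong_open[OF assms(1) _ Suc.prems])
  ultimately show ?case by simp
qed

lemma Ck_on_imp_continuous_on:
  assumes "Ck_on k S f"
  shows "continuous_on S f"
proof (cases k)
  case (Suc n)
  with assms have "\<forall>x\<in>S. isCont f x" by (simp add: differentiable_imp_continuous_within)
  then show ?thesis by (rule continuous_at_imp_continuous_on)
qed (use assms in simp)

lemma Ck_on_SucD: "Ck_on (Suc k) S f \<Longrightarrow> Ck_on k S f"
proof (induction k arbitrary: f)
  case 0
  then show ?case using Ck_on_imp_continuous_on[OF 0] by simp
next
  case (Suc k)
  have "Ck_on k S (\<lambda>x. dd f x v)" for v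
    \<comment> \<open>Only the outer \<open>Suc\<close> is unfolded, so that the directional
      derivatives are still known to be \<open>Ck_on (Suc k)\<close>, as the induction hypothesis
      asks.\<close>
    by (rule Suc.IH) (use Suc.prems[unfolded Ck_on.simps(2)[of "Suc k" S f]] in \<open>rule conjunct2[THEN spec]\<close>)
  moreover have "\<forall>x\<in>S. f differentiable (at x)"
    using Suc.prems unfolding Ck_on.simps(2)[of "Suc k" S f] by (rule conjunct1)
  ultimately show ?case by (simp only: Ck_on.simps(2)[of k S f] simp_thms)
qed

lemma Ck_on_const: "Ck_on k S (\<lambda>x. c)"
proof (induction k arbitrary: c)
  case (Suc k)
  show ?case using Suc.IH[of 0] by simp
qed simp

lemma Ck_on_bounded_linear:
  assumes "open S" "bounded_linear l"
  shows "Ck_on k S f \<Longrightarrow> Ck_on k S (\<lambda>x. l (f x))"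
proof (induction k arbitrary: f)
  case 0
  then show ?case using bounded_linear.continuous_on[OF assms(2)] by simp
next
  case (Suc k)
  have d: "((\<lambda>x. l (f x)) has_derivative (\<lambda>v. l (dd f x v))) (at x)" if "x \<in> S" for x
    using Suc.prems that
    by (intro bounded_linear.has_derivative[OF assms(2)] dd_works) auto
  have "Ck_on k S (\<lambda>x. dd (\<lambda>x. l (f x)) x v)" for v
  proof -
    have "Ck_on k S (\<lambda>x. l (dd f x v))" using Suc.prems by (intro Suc.IH) simp
    then show ?thesis
      by (subst Ck_on_cong[OF assms(1)]) (simp_all add: dd_eq[OF d])
  qed
  moreover have "(\<lambda>x. l (f x)) differentiable (at x)" if "x \<in> S" for x
    by (rule differentiableI[OF d[OF that]])
  ultimately show ?case by simp
qed

text \<open>For an affine inner map the derivative in direction \<open>v\<close> is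
  \<open>dd f\<close> in the constant direction \<open>l v\<close>, again composed with the same
  map, so the induction closes without products. This covers the projections of a product and the
  insertions of its slices.\<close>

lemma Ck_on_affine_compose:
  assumes "open S" "bounded_linear l" "open T" and TS: "\<And>x. x \<in> T \<Longrightarrow> l x + c \<in> S"
  shows "Ck_on k S f \<Longrightarrow> Ck_on k T (\<lambda>x. f (l x + c))"
proof (induction k arbitrary: f)
  case 0
  have "continuous_on T (\<lambda>x. l x + c)"
    by (rule continuous_on_add[OF linear_continuous_on[OF assms(2)] continuous_on_const])
  moreover have "(\<lambda>x. l x + c) ` T \<subseteq> S" using TS by blast
  ultimately have "continuous_on T (\<lambda>x. f (l x + c))"
    using 0 continuous_on_compose2[of S f T "\<lambda>x. l x + c"] by simp
  then show ?case by simp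
next
  case (Suc k)
  have d: "((\<lambda>x. f (l x + c)) has_derivative (\<lambda>v. dd f (l x + c) (l v))) (at x)" if "x \<in> T" for x
  proof -
    have l: "((\<lambda>x. l x + c) has_derivative l) (at x)"
      using has_derivative_add[OF bounded_linear_imp_has_derivative[OF assms(2)] has_derivative_const[of c]]
      by simp
    have "f differentiable (at (l x + c))" using Suc.prems TS[OF that] by simp
    then have f: "(f has_derivative dd f (l x + c)) (at (l x + c))" by (rule dd_works)
    show ?thesis by (rule has_derivative_compose[OF l f])
  qed
  have "Ck_on k T (\<lambda>x. dd (\<lambda>x. f (l x + c)) x v)" for v
  proof -
    have "Ck_on k T (\<lambda>x. dd f (l x + c) (l v))"
      by (rule Suc.IH[of "\<lambda>x. dd f x (l v)"]) (use Suc.prems in simp)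
    then show ?thesis
      by (subst Ck_on_cong[OF assms(3)]) (simp_all add: dd_eq[OF d])
  qed
  moreover have "(\<lambda>x. f (l x + c)) differentiable (at x)" if "x \<in> T" for x
    by (rule differentiableI[OF d[OF that]])
  ultimately show ?case by simp
qed

lemma Ck_on_add:
  assumes "open S"
  shows "Ck_on k S f \<Longrightarrow> Ck_on k S g \<Longrightarrow> Ck_on k S (\<lambda>x. f x + g x)"
proof (induction k arbitrary: f g)
  case 0
  then show ?case by (simp add: continuous_on_add)
next
  case (Suc k)
  have d: "((\<lambda>x. f x + g x) has_derivative (\<lambda>v. dd f x v + dd g x v)) (at x)" if "x \<in> S" for x
    using Suc.prems that by (intro has_derivative_add dd_works) auto
  have "Ck_on k S (\<lambda>x. dd (\<lambda>x. f x + g x) x v)" for v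
  proof -
    have "Ck_on k S (\<lambda>x. dd f x v + dd g x v)" using Suc.prems by (intro Suc.IH) auto
    then show ?thesis
      by (subst Ck_on_cong[OF assms(1)]) (simp_all add: dd_eq[OF d])
  qed
  moreover have "(\<lambda>x. f x + g x) differentiable (at x)" if "x \<in> S" for x
    by (rule differentiableI[OF d[OF that]])
  ultimately show ?case by simp
qed

lemma Ck_on_mult:
  fixes f g :: "'a::euclidean_space \<Rightarrow> real"
  assumes "open S"
  shows "Ck_on k S f \<Longrightarrow> Ck_on k S g \<Longrightarrow> Ck_on k S (\<lambda>x. f x * g x)"
proof (induction k arbitrary: f g)
  case 0
  then show ?case by (simp add: continuous_on_mult)
next
  case (Suc k)
  have d: "((\<lambda>x. f x * g x) has_derivative (\<lambda>v. f x * dd g x v + dd f x v * g x)) (at x)"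
    if "x \<in> S" for x
    using Suc.prems that by (intro has_derivative_mult dd_works) auto
  have "Ck_on k S (\<lambda>x. dd (\<lambda>x. f x * g x) x v)" for v
  proof -
    have "Ck_on k S (\<lambda>x. f x * dd g x v + dd f x v * g x)"
      using Suc.prems Ck_on_SucD[OF Suc.prems(1)] Ck_on_SucD[OF Suc.prems(2)]
      by (intro Ck_on_add[OF assms] Suc.IH) auto
    then show ?thesis
      by (subst Ck_on_cong[OF assms(1)]) (simp_all add: dd_eq[OF d])
  qed
  moreover have "(\<lambda>x. f x * g x) differentiable (at x)" if "x \<in> S" for x
    by (rule differentiableI[OF d[OF that]])
  ultimately show ?case by simp
qed

text \<open>The derivative is a product of \<open>inverse f\<close> itself, which is one order lower
  and so covered by the induction hypothesis, and a derivative of \<open>f\<close>.\<close>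

lemma Ck_on_inverse:
  fixes f :: "'a::euclidean_space \<Rightarrow> real"
  assumes "open S" "\<And>x. x \<in> S \<Longrightarrow> f x \<noteq> 0"
  shows "Ck_on k S f \<Longrightarrow> Ck_on k S (\<lambda>x. inverse (f x))"
proof (induction k)
  case 0
  then show ?case using assms by (simp add: continuous_on_inverse)
next
  case (Suc k)
  have d: "((\<lambda>x. inverse (f x)) has_derivative (\<lambda>v. - 1 * ((inverse (f x) * dd f x v) * inverse (f x)))) (at x)"
    if "x \<in> S" for x
  proof -
    have "(f has_derivative dd f x) (at x)" using Suc.prems that by (intro dd_works) auto
    from Deriv.has_derivative_inverse[OF assms(2)[OF that] this] show ?thesis by (simp add: ac_simps)
  qed
  have "Ck_on k S (\<lambda>x. dd (\<lambda>x. inverse (f x)) x v)" for v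
  proof -
    have "Ck_on k S (\<lambda>x. - 1 * ((inverse (f x) * dd f x v) * inverse (f x)))"
      using Suc.prems Ck_on_SucD[OF Suc.prems] by (intro Ck_on_mult[OF assms(1)] Ck_on_const Suc.IH) auto
    then show ?thesis
      by (subst Ck_on_cong[OF assms(1)]) (simp_all add: dd_eq[OF d])
  qed
  moreover have "(\<lambda>x. inverse (f x)) differentiable (at x)" if "x \<in> S" for x
    by (rule differentiableI[OF d[OF that]])
  ultimately show ?case by simp
qed

lemma Ck_on_ln:
  fixes f :: "'a::euclidean_space \<Rightarrow> real"
  assumes "open S" "\<And>x. x \<in> S \<Longrightarrow> f x > 0"
  shows "Ck_on k S f \<Longrightarrow> Ck_on k S (\<lambda>x. ln (f x))"
proof (induction k)
  case 0
  then have "\<forall>x\<in>S. f x \<noteq> 0" using assms(2) by force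
  then show ?case using 0 by (simp add: continuous_on_ln)
next
  case (Suc k)
  have d: "((\<lambda>x. ln (f x)) has_derivative (\<lambda>v. dd f x v * inverse (f x))) (at x)"
    if "x \<in> S" for x
  proof -
    have "(f has_derivative dd f x) (at x)" using Suc.prems that by (intro dd_works) auto
    from has_derivative_ln[OF assms(2)[OF that] this] show ?thesis by (simp add: divide_inverse)
  qed
  have "Ck_on k S (\<lambda>x. dd (\<lambda>x. ln (f x)) x v)" for v
  proof -
    have "\<And>x. x \<in> S \<Longrightarrow> f x \<noteq> 0" using assms(2) by force
    then have "Ck_on k S (\<lambda>x. dd f x v * inverse (f x))"
      using Suc.prems Ck_on_SucD[OF Suc.prems] by (intro Ck_on_mult[OF assms(1)] Ck_on_inverse[OF assms(1)]) auto
    then show ?thesis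
      by (subst Ck_on_cong[OF assms(1)]) (simp_all add: dd_eq[OF d])
  qed
  moreover have "(\<lambda>x. ln (f x)) differentiable (at x)" if "x \<in> S" for x
    by (rule differentiableI[OF d[OF that]])
  ultimately show ?case by simp
qed

lemma smooth_on_cong:
  "open S \<Longrightarrow> (\<And>y. y \<in> S \<Longrightarrow> f y = g y) \<Longrightarrow> smooth_on S f \<longleftrightarrow> smooth_on S g"
  unfolding smooth_on_def using Ck_on_cong by blast

lemma smooth_on_const: "smooth_on S (\<lambda>x. c)"
  unfolding smooth_on_def using Ck_on_const by blast

lemma smooth_on_bounded_linear:
  "open S \<Longrightarrow> bounded_linear l \<Longrightarrow> smooth_on S f \<Longrightarrow> smooth_on S (\<lambda>x. l (f x))"
  unfolding smooth_on_def using Ck_on_bounded_linear by blast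

lemma smooth_on_affine_compose:
  "open S \<Longrightarrow> bounded_linear l \<Longrightarrow> open T \<Longrightarrow> (\<And>x. x \<in> T \<Longrightarrow> l x + c \<in> S) \<Longrightarrow> smooth_on S f
    \<Longrightarrow> smooth_on T (\<lambda>x. f (l x + c))"
  unfolding smooth_on_def using Ck_on_affine_compose by blast

lemma smooth_on_add:
  "open S \<Longrightarrow> smooth_on S f \<Longrightarrow> smooth_on S g \<Longrightarrow> smooth_on S (\<lambda>x. f x + g x)"
  unfolding smooth_on_def using Ck_on_add by blast

lemma smooth_on_mult:
  fixes f g :: "'a::euclidean_space \<Rightarrow> real"
  shows "open S \<Longrightarrow> smooth_on S f \<Longrightarrow> smooth_on S g \<Longrightarrow> smooth_on S (\<lambda>x. f x * g x)"
  unfolding smooth_on_def using Ck_on_mult by blast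

lemma smooth_on_inverse:
  fixes f :: "'a::euclidean_space \<Rightarrow> real"
  shows "open S \<Longrightarrow> (\<And>x. x \<in> S \<Longrightarrow> f x \<noteq> 0) \<Longrightarrow> smooth_on S f \<Longrightarrow> smooth_on S (\<lambda>x. inverse (f x))"
  unfolding smooth_on_def using Ck_on_inverse by blast

lemma smooth_on_ln:
  fixes f :: "'a::euclidean_space \<Rightarrow> real"
  shows "open S \<Longrightarrow> (\<And>x. x \<in> S \<Longrightarrow> f x > 0) \<Longrightarrow> smooth_on S f \<Longrightarrow> smooth_on S (\<lambda>x. ln (f x))"
  unfolding smooth_on_def using Ck_on_ln by blast

lemma smooth_on_imp_differentiable: "smooth_on S f \<Longrightarrow> x \<in> S \<Longrightarrow> f differentiable (at x)"
  unfolding smooth_on_def using Ck_on.simps(2) by blast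

lemma smooth_on_dd: "smooth_on S f \<Longrightarrow> smooth_on S (\<lambda>x. dd f x v)"
  unfolding smooth_on_def using Ck_on.simps(2) by blast

lemma smooth_on_has_derivative: "smooth_on S f \<Longrightarrow> x \<in> S \<Longrightarrow> (f has_derivative dd f x) (at x)"
  by (simp add: dd_works smooth_on_imp_differentiable)

lemma smooth_on_imp_isCont: "smooth_on S f \<Longrightarrow> x \<in> S \<Longrightarrow> isCont f x"
  using differentiable_imp_continuous_within smooth_on_imp_differentiable by blast

lemma dd_linear: "f differentiable (at x) \<Longrightarrow> linear (dd f x)"
  by (rule linear_frechet_derivative)

section \<open>Symmetry of second derivatives\<close>

lemma dd_along_line:
  fixes f :: "'a::real_normed_vector \<Rightarrow> real"
  assumes "f differentiable (at (x + s *\<^sub>R v))"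
  shows "((\<lambda>s. f (x + s *\<^sub>R v)) has_real_derivative dd f (x + s *\<^sub>R v) v) (at s)"
proof -
  have "((\<lambda>s. x + s *\<^sub>R v) has_derivative (\<lambda>h. h *\<^sub>R v)) (at s)"
    by (auto intro!: derivative_eq_intros)
  from has_derivative_compose[OF this dd_works[OF assms]]
  have "((\<lambda>s. f (x + s *\<^sub>R v)) has_derivative (\<lambda>h. dd f (x + s *\<^sub>R v) (h *\<^sub>R v))) (at s)" .
  then show ?thesis
    unfolding has_field_derivative_def
    by (simp add: linear_cmul[OF dd_linear[OF assms]] mult_commute_abs)
qed

text \<open>The left-hand side of the equation is symmetric in \<open>v\<close> and \<open>w\<close>; letting \<open>t\<close> tend to 0 gives
  the symmetry of second derivatives.\<close>

lemma second_difference: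
  fixes f :: "'a::euclidean_space \<Rightarrow> real"
  assumes "smooth_on S f" "t > 0"
    and S: "\<And>r s. 0 \<le> r \<Longrightarrow> r \<le> t \<Longrightarrow> 0 \<le> s \<Longrightarrow> s \<le> t \<Longrightarrow> x + r *\<^sub>R v + s *\<^sub>R w \<in> S"
  shows "\<exists>r s. 0 \<le> r \<and> r \<le> t \<and> 0 \<le> s \<and> s \<le> t \<and>
    f (x + t *\<^sub>R v + t *\<^sub>R w) - f (x + t *\<^sub>R v) - f (x + t *\<^sub>R w) + f x
      = t * t * dd (\<lambda>y. dd f y v) (x + r *\<^sub>R v + s *\<^sub>R w) w"
proof -
  \<comment> \<open>The second difference is \<open>\<phi> t - \<phi> 0\<close>. The mean value
    theorem is applied to \<open>\<phi>\<close>, and then in direction \<open>w\<close> to the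
    derivative along \<open>v\<close> that it produces.\<close>
  define \<phi> where "\<phi> s = f ((x + t *\<^sub>R w) + s *\<^sub>R v) - f (x + s *\<^sub>R v)" for s
  have "\<exists>r. 0 < r \<and> r < t \<and> \<phi> t - \<phi> 0 = (t - 0) * (dd f ((x + t *\<^sub>R w) + r *\<^sub>R v) v - dd f (x + r *\<^sub>R v) v)"
  proof (rule MVT2[OF assms(2)])
    fix r assume r: "0 \<le> r" "r \<le> t"
    have "x + t *\<^sub>R w + r *\<^sub>R v \<in> S" "x + r *\<^sub>R v \<in> S"
      using S[OF r, of t] S[OF r, of 0] assms(2) by (auto simp: algebra_simps)
    then show "(\<phi> has_real_derivative (dd f ((x + t *\<^sub>R w) + r *\<^sub>R v) v - dd f (x + r *\<^sub>R v) v)) (at r)"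
      unfolding \<phi>_def by (intro derivative_intros dd_along_line smooth_on_imp_differentiable[OF assms(1)])
  qed
  then obtain r where r: "0 < r" "r < t"
    "\<phi> t - \<phi> 0 = t * (dd f ((x + r *\<^sub>R v) + t *\<^sub>R w) v - dd f ((x + r *\<^sub>R v) + 0 *\<^sub>R w) v)"
    by (auto simp: algebra_simps)
  have "\<exists>s. 0 < s \<and> s < t \<and> dd f ((x + r *\<^sub>R v) + t *\<^sub>R w) v - dd f ((x + r *\<^sub>R v) + 0 *\<^sub>R w) v
     = (t - 0) * dd (\<lambda>y. dd f y v) ((x + r *\<^sub>R v) + s *\<^sub>R w) w"
  proof (rule MVT2[OF assms(2)])
    fix s assume s: "0 \<le> s" "s \<le> t"
    have "(x + r *\<^sub>R v) + s *\<^sub>R w \<in> S" using S[of r s] r s by auto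
    then show "((\<lambda>s. dd f ((x + r *\<^sub>R v) + s *\<^sub>R w) v) has_real_derivative
        dd (\<lambda>y. dd f y v) ((x + r *\<^sub>R v) + s *\<^sub>R w) w) (at s)"
      by (intro dd_along_line smooth_on_imp_differentiable[OF smooth_on_dd[OF assms(1)]])
  qed
  then obtain s where s: "0 < s" "s < t"
    "dd f ((x + r *\<^sub>R v) + t *\<^sub>R w) v - dd f ((x + r *\<^sub>R v) + 0 *\<^sub>R w) v
     = t * dd (\<lambda>y. dd f y v) ((x + r *\<^sub>R v) + s *\<^sub>R w) w"
    by auto
  have "\<phi> t - \<phi> 0 = f (x + t *\<^sub>R v + t *\<^sub>R w) - f (x + t *\<^sub>R v) - f (x + t *\<^sub>R w) + f x"
    by (simp add: \<phi>_def algebra_simps)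
  then show ?thesis using r s
    by (intro exI[of _ r] exI[of _ s]) (simp add: mult.assoc)
qed

lemma dd_symmetric:
  fixes f :: "'a::euclidean_space \<Rightarrow> real"
  assumes "smooth_on S f" "open S" "x \<in> S"
  shows "dd (\<lambda>y. dd f y v) x w = dd (\<lambda>y. dd f y w) x v"
proof -
  obtain e where e: "e > 0" "ball x e \<subseteq> S" using assms openE by blast
  \<comment> \<open>All parallelograms with parameters at most \<open>d\<close> stay in the ball;
    the summand 1 keeps the denominator positive when \<open>v\<close> and \<open>w\<close>
    vanish.\<close>
  define d where "d = e / (norm v + norm w + 1)"
  have d: "d > 0" unfolding d_def using e by (intro divide_pos_pos) (auto intro: add_nonneg_pos)
  \<comment> \<open>The 2 makes \<open>t n\<close> strictly smaller than \<open>d\<close> for every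
    \<open>n\<close>, including 0.\<close>
  define t where "t n = d / (real n + 2)" for n
  have t: "0 < t n" "t n < d" for n
  proof -
    show "0 < t n" using d by (simp add: t_def)
    have "d * 1 < d * (real n + 2)" using d by (intro mult_strict_left_mono) auto
    then show "t n < d" by (simp add: t_def pos_divide_less_eq)
  qed
  have "(\<lambda>n. d / real (n + 2)) \<longlonglongrightarrow> 0"
    by (rule LIMSEQ_ignore_initial_segment[OF lim_const_over_n])
  then have tlim: "t \<longlonglongrightarrow> 0" by (simp add: t_def[abs_def] add.commute)
  have inS: "x + r *\<^sub>R v + s *\<^sub>R w \<in> S" if "0 \<le> r" "r \<le> t n" "0 \<le> s" "s \<le> t n" for r s n
  proof -
    have "norm (r *\<^sub>R v + s *\<^sub>R w) \<le> r * norm v + s * norm w"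
      using norm_triangle_ineq[of "r *\<^sub>R v" "s *\<^sub>R w"] that by simp
    also have "\<dots> \<le> d * norm v + d * norm w"
      using that t[of n] by (intro add_mono mult_right_mono) auto
    also have "\<dots> < d * (norm v + norm w + 1)" using d by (simp add: algebra_simps)
    also have "\<dots> = e"
    proof -
      have "norm v + norm w + 1 > 0" by (simp add: add_nonneg_pos)
      then show ?thesis by (simp add: d_def)
    qed
    finally have "dist x (x + r *\<^sub>R v + s *\<^sub>R w) < e"
      by (simp add: dist_norm add.assoc norm_minus_cancel[of "r *\<^sub>R v + s *\<^sub>R w", symmetric] del: norm_minus_cancel)
    then show ?thesis using e by auto
  qed
  have lim: "(\<lambda>n. dd (\<lambda>y. dd f y v) (x + r n *\<^sub>R v + s n *\<^sub>R w) w) \<longlonglongrightarrow> dd (\<lambda>y. dd f y v) x w"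
    if "\<And>n. 0 \<le> r n \<and> r n \<le> t n" "\<And>n. 0 \<le> s n \<and> s n \<le> t n" for r s v w
  proof -
    have "r \<longlonglongrightarrow> 0" "s \<longlonglongrightarrow> 0"
      by (rule tendsto_sandwich[OF _ _ tendsto_const tlim]; use that in auto)+
    then have "(\<lambda>n. x + r n *\<^sub>R v + s n *\<^sub>R w) \<longlonglongrightarrow> x + 0 *\<^sub>R v + 0 *\<^sub>R w"
      by (intro tendsto_intros)
    then show ?thesis
      using isCont_tendsto_compose[OF smooth_on_imp_isCont[OF smooth_on_dd[OF smooth_on_dd[OF assms(1)]] assms(3)]]
      by simp
  qed
  have "\<exists>r s. 0 \<le> r \<and> r \<le> t n \<and> 0 \<le> s \<and> s \<le> t n \<and>
    f (x + t n *\<^sub>R v + t n *\<^sub>R w) - f (x + t n *\<^sub>R v) - f (x + t n *\<^sub>R w) + f x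
      = t n * t n * dd (\<lambda>y. dd f y v) (x + r *\<^sub>R v + s *\<^sub>R w) w" for n
    using second_difference[OF assms(1) t(1), of n x v w] inS by blast
  then obtain r s where rs: "\<And>n. 0 \<le> r n \<and> r n \<le> t n" "\<And>n. 0 \<le> s n \<and> s n \<le> t n"
    "\<And>n. f (x + t n *\<^sub>R v + t n *\<^sub>R w) - f (x + t n *\<^sub>R v) - f (x + t n *\<^sub>R w) + f x
      = t n * t n * dd (\<lambda>y. dd f y v) (x + r n *\<^sub>R v + s n *\<^sub>R w) w" by metis
  have "\<exists>r s. 0 \<le> r \<and> r \<le> t n \<and> 0 \<le> s \<and> s \<le> t n \<and>
    f (x + t n *\<^sub>R w + t n *\<^sub>R v) - f (x + t n *\<^sub>R w) - f (x + t n *\<^sub>R v) + f x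
      = t n * t n * dd (\<lambda>y. dd f y w) (x + r *\<^sub>R w + s *\<^sub>R v) v" for n
  proof (rule second_difference[OF assms(1) t(1)])
    fix r s assume "0 \<le> r" "r \<le> t n" "0 \<le> s" "s \<le> t n"
    then show "x + r *\<^sub>R w + s *\<^sub>R v \<in> S" using inS[of s n r] by (simp add: algebra_simps)
  qed
  then obtain r' s' where rs': "\<And>n. 0 \<le> r' n \<and> r' n \<le> t n" "\<And>n. 0 \<le> s' n \<and> s' n \<le> t n"
    "\<And>n. f (x + t n *\<^sub>R w + t n *\<^sub>R v) - f (x + t n *\<^sub>R w) - f (x + t n *\<^sub>R v) + f x
      = t n * t n * dd (\<lambda>y. dd f y w) (x + r' n *\<^sub>R w + s' n *\<^sub>R v) v" by metis
  have "dd (\<lambda>y. dd f y v) (x + r n *\<^sub>R v + s n *\<^sub>R w) w = dd (\<lambda>y. dd f y w) (x + r' n *\<^sub>R w + s' n *\<^sub>R v) v" for n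
  proof -
    have "t n * t n * dd (\<lambda>y. dd f y v) (x + r n *\<^sub>R v + s n *\<^sub>R w) w
        = t n * t n * dd (\<lambda>y. dd f y w) (x + r' n *\<^sub>R w + s' n *\<^sub>R v) v"
      unfolding rs(3)[symmetric] rs'(3)[symmetric] by (simp add: algebra_simps)
    then show ?thesis using t(1)[of n] by simp
  qed
  then have "(\<lambda>n. dd (\<lambda>y. dd f y w) (x + r' n *\<^sub>R w + s' n *\<^sub>R v) v) \<longlonglongrightarrow> dd (\<lambda>y. dd f y v) x w"
    using lim[OF rs(1,2), of v w] by simp
  then show ?thesis using lim[OF rs'(1,2), of w v] LIMSEQ_unique by blast
qed

section \<open>Raising an index\<close>

definition inner_product :: "('e::euclidean_space \<Rightarrow> 'e \<Rightarrow> real) \<Rightarrow> bool" where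
  "inner_product B \<longleftrightarrow> bilinear B \<and> (\<forall>v w. B v w = B w v) \<and> (\<forall>v. v \<noteq> 0 \<longrightarrow> B v v > 0)"

lemma bilinear_linear_left: "bilinear B \<Longrightarrow> linear (\<lambda>v. B v w)"
  by (simp add: bilinear_def)

lemma bilinear_linear_right: "bilinear B \<Longrightarrow> linear (B v)"
  by (simp add: bilinear_def)

lemma linear_eq_sum_Basis:
  fixes l :: "'a::euclidean_space \<Rightarrow> 'b::real_vector"
  assumes "linear l"
  shows "l v = (\<Sum>b\<in>Basis. (v \<bullet> b) *\<^sub>R l b)"
proof -
  have "l v = l (\<Sum>b\<in>Basis. (v \<bullet> b) *\<^sub>R b)" by (simp only: euclidean_representation)
  then show ?thesis by (simp only: linear_sum[OF assms] linear_cmul[OF assms])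
qed

lemma inner_product_eq_iff:
  assumes "inner_product B"
  shows "u = v \<longleftrightarrow> (\<forall>z. B u z = B v z)"
proof
  assume *: "\<forall>z. B u z = B v z"
  have "bilinear B" using assms by (simp add: inner_product_def)
  then have "B (u - v) (u - v) = 0" using * by (simp only: bilinear_lsub diff_self)
  then have "u - v = 0" using assms unfolding inner_product_def by fastforce
  then show "u = v" by simp
qed simp

lemma raise_unique:
  assumes "inner_product B" "\<And>z. B u z = \<alpha> z"
  shows "raise B \<alpha> = u"
  unfolding raise_def by (rule the_equality) (use assms(2) in \<open>simp_all add: inner_product_eq_iff[OF assms(1)]\<close>)

text \<open>The map \<open>T\<close> records the functional \<open>B u\<close> by its values on the
  basis. It is injective because \<open>B\<close> is nondegenerate, hence surjective by
  dimension.\<close>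

lemma raise_exists:
  fixes B :: "'e::euclidean_space \<Rightarrow> 'e \<Rightarrow> real"
  assumes B: "inner_product B" and a: "linear \<alpha>"
  shows "\<exists>u. \<forall>z. B u z = \<alpha> z"
proof -
  have bl: "bilinear B" using B by (simp add: inner_product_def)
  define T where "T u = (\<Sum>b\<in>Basis. B u b *\<^sub>R b)" for u
  have T: "T u \<bullet> b = B u b" if "b \<in> Basis" for u b
    using that by (simp add: T_def inner_sum_left inner_Basis if_distrib if_distribR cong: if_cong)
  have lin: "linear T"
    unfolding T_def
    by (intro linearI) (simp_all add: bilinear_ladd[OF bl] bilinear_lmul[OF bl] scaleR_add_left sum.distrib scaleR_right.sum)
  have "inj T"
  proof (rule injI)
    fix u v assume "T u = T v"
    then have *: "B u b = B v b" if "b \<in> Basis" for b using T that by metis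
    have "B u z = B v z" for z
      unfolding linear_eq_sum_Basis[OF bilinear_linear_right[OF bl], of _ z]
      by (intro sum.cong) (simp_all add: *)
    then show "u = v" using inner_product_eq_iff[OF B] by blast
  qed
  then have "surj T" by (rule linear_inj_imp_surj[OF lin])
  then obtain u where u: "T u = (\<Sum>b\<in>Basis. \<alpha> b *\<^sub>R b)" by (metis surjD)
  have "B u b = \<alpha> b" if "b \<in> Basis" for b
    using T[OF that, of u] that unfolding u
    by (simp add: inner_sum_left inner_Basis if_distrib if_distribR cong: if_cong)
  then have "B u z = \<alpha> z" for z
    unfolding linear_eq_sum_Basis[OF bilinear_linear_right[OF bl], of _ z] linear_eq_sum_Basis[OF a, of z]
    by (intro sum.cong) simp_all
  then show ?thesis by blast
qed

lemma raise_eq: "inner_product B \<Longrightarrow> linear \<alpha> \<Longrightarrow> B (raise B \<alpha>) z = \<alpha> z"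
  using raise_exists raise_unique by metis

text \<open>At a fixed \<open>B\<close> raising is linear in the covector, so it is determined by
  finitely many fixed vectors. In this form the covector can vary and be differentiated.\<close>

lemma raise_eq_sum:
  assumes "inner_product B" "linear \<alpha>"
  shows "raise B \<alpha> = (\<Sum>b\<in>Basis. \<alpha> b *\<^sub>R raise B (\<lambda>z. z \<bullet> b))"
proof (rule raise_unique[OF assms(1)])
  fix z
  have bl: "bilinear B" using assms by (simp add: inner_product_def)
  have l: "linear (\<lambda>z. z \<bullet> b)" for b :: 'a
    using bounded_linear_inner_left bounded_linear.linear by blast
  have "B (\<Sum>b\<in>Basis. \<alpha> b *\<^sub>R raise B (\<lambda>z. z \<bullet> b)) z = (\<Sum>b\<in>Basis. \<alpha> b * (z \<bullet> b))"
    by (simp add: linear_sum[OF bilinear_linear_left[OF bl]] bilinear_lmul[OF bl] raise_eq[OF assms(1) l])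
  also have "\<dots> = \<alpha> z" by (simp add: linear_eq_sum_Basis[OF assms(2), of z] mult.commute)
  finally show "B (\<Sum>b\<in>Basis. \<alpha> b *\<^sub>R raise B (\<lambda>z. z \<bullet> b)) z = \<alpha> z" .
qed

lemma dd_linear_family:
  fixes \<alpha> :: "'a::real_normed_vector \<Rightarrow> 'b::real_vector \<Rightarrow> 'c::real_normed_vector"
  assumes "open S" "x \<in> S" and lin: "\<And>y. y \<in> S \<Longrightarrow> linear (\<alpha> y)"
    and d: "\<And>z. (\<lambda>y. \<alpha> y z) differentiable (at x)"
  shows "linear (\<lambda>z. dd (\<lambda>y. \<alpha> y z) x h)"
proof (rule linearI)
  fix z w
  have "dd (\<lambda>y. \<alpha> y (z + w)) x = dd (\<lambda>y. \<alpha> y z + \<alpha> y w) x"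
    by (rule dd_cong_open[OF assms(1,2)]) (simp add: linear_add[OF lin])
  also have "\<dots> = (\<lambda>h. dd (\<lambda>y. \<alpha> y z) x h + dd (\<lambda>y. \<alpha> y w) x h)"
    by (intro dd_eq has_derivative_add dd_works d)
  finally show "dd (\<lambda>y. \<alpha> y (z + w)) x h = dd (\<lambda>y. \<alpha> y z) x h + dd (\<lambda>y. \<alpha> y w) x h" by simp
next
  fix c z
  have "dd (\<lambda>y. \<alpha> y (c *\<^sub>R z)) x = dd (\<lambda>y. c *\<^sub>R \<alpha> y z) x"
    by (rule dd_cong_open[OF assms(1,2)]) (simp add: linear_cmul[OF lin])
  also have "\<dots> = (\<lambda>h. c *\<^sub>R dd (\<lambda>y. \<alpha> y z) x h)"
    by (intro dd_eq has_derivative_scaleR_right dd_works d)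
  finally show "dd (\<lambda>y. \<alpha> y (c *\<^sub>R z)) x h = c *\<^sub>R dd (\<lambda>y. \<alpha> y z) x h" by simp
qed

text \<open>Unlike in the product rule, \<open>g\<close> need only be continuous, because \<open>f\<close> vanishes at \<open>x\<close>.\<close>

lemma has_derivative_mult_vanishing:
  fixes f g :: "'a::real_normed_vector \<Rightarrow> real"
  assumes f: "(f has_derivative f') (at x)" "f x = 0" and g: "isCont g x"
  shows "((\<lambda>y. g y * f y) has_derivative (\<lambda>h. g x * f' h)) (at x)"
proof -
  have bl: "bounded_linear f'" using f(1) by (rule has_derivative_bounded_linear)
  obtain K where K: "\<And>h. \<bar>f' h\<bar> \<le> norm h * K" using bounded_linear.bounded[OF bl] by auto
  have e: "((\<lambda>y. \<bar>f y - f' (y - x)\<bar> / norm (y - x)) \<longlongrightarrow> 0) (at x)"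
    using f unfolding has_derivative_iff_norm by simp
  have gl: "((\<lambda>y. \<bar>g y\<bar>) \<longlongrightarrow> \<bar>g x\<bar>) (at x)" "((\<lambda>y. \<bar>g y - g x\<bar>) \<longlongrightarrow> \<bar>g x - g x\<bar>) (at x)"
    using g tendsto_rabs tendsto_rabs[OF tendsto_diff[OF _ tendsto_const]] unfolding isCont_def by blast+
  have "((\<lambda>y. \<bar>g y\<bar> * (\<bar>f y - f' (y - x)\<bar> / norm (y - x)) + \<bar>g y - g x\<bar> * K) \<longlongrightarrow> \<bar>g x\<bar> * 0 + \<bar>g x - g x\<bar> * K) (at x)"
    by (intro tendsto_intros gl e)
  then have lim: "((\<lambda>y. \<bar>g y\<bar> * (\<bar>f y - f' (y - x)\<bar> / norm (y - x)) + \<bar>g y - g x\<bar> * K) \<longlongrightarrow> 0) (at x)" by simp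
  have "\<bar>g y * f y - g x * f x - g x * f' (y - x)\<bar> / norm (y - x)
     \<le> \<bar>g y\<bar> * (\<bar>f y - f' (y - x)\<bar> / norm (y - x)) + \<bar>g y - g x\<bar> * K" if "y \<noteq> x" for y
  proof -
    have n: "norm (y - x) > 0" using that by simp
    have "\<bar>g y * f y - g x * f x - g x * f' (y - x)\<bar> = \<bar>g y * (f y - f' (y - x)) + (g y - g x) * f' (y - x)\<bar>"
      using f(2) by (simp add: algebra_simps)
    also have "\<dots> \<le> \<bar>g y\<bar> * \<bar>f y - f' (y - x)\<bar> + \<bar>g y - g x\<bar> * \<bar>f' (y - x)\<bar>"
      by (metis abs_mult abs_triangle_ineq)
    also have "\<dots> \<le> \<bar>g y\<bar> * \<bar>f y - f' (y - x)\<bar> + \<bar>g y - g x\<bar> * (norm (y - x) * K)"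
      by (intro add_left_mono mult_left_mono K) simp
    finally show ?thesis using n by (simp add: field_simps)
  qed
  then have "((\<lambda>y. \<bar>g y * f y - g x * f x - g x * f' (y - x)\<bar> / norm (y - x)) \<longlongrightarrow> 0) (at x)"
    by (intro tendsto_sandwich[OF _ _ tendsto_const lim])
      (auto simp: eventually_at_filter intro!: always_eventually)
  moreover have "bounded_linear (\<lambda>h. g x * f' h)" by (rule bounded_linear_const_mult[OF bl])
  ultimately show ?thesis unfolding has_derivative_iff_norm by simp
qed

text \<open>The equation \<open>key\<close> expresses the solution \<open>u y\<close> of the perturbed system through itself and the
  inverse at \<open>x\<close>. It shows first that \<open>u\<close> is bounded near \<open>x\<close>, then that it is continuous and
  finally that it is differentiable.\<close>

lemma raise_has_derivative:
  fixes G :: "'a::real_normed_vector \<Rightarrow> 'e::euclidean_space \<Rightarrow> 'e \<Rightarrow> real"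
  assumes S: "open S" "x \<in> S"
    and G: "\<And>y. y \<in> S \<Longrightarrow> inner_product (G y)" "\<And>v w. (\<lambda>y. G y v w) differentiable (at x)"
    and \<alpha>: "\<And>y. y \<in> S \<Longrightarrow> linear (\<alpha> y)" "\<And>z. (\<lambda>y. \<alpha> y z) differentiable (at x)"
  shows "((\<lambda>y. raise (G y) (\<alpha> y)) has_derivative
    (\<lambda>h. raise (G x) (\<lambda>z. dd (\<lambda>y. \<alpha> y z) x h - dd (\<lambda>y. G y (raise (G x) (\<alpha> x)) z) x h))) (at x)"
proof -
  define u where "u y = raise (G y) (\<alpha> y)" for y
  define r where "r b = raise (G x) (\<lambda>z. z \<bullet> b)" for b
  have bl: "bilinear (G y)" if "y \<in> S" for y using G(1)[OF that] by (simp add: inner_product_def)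
  have key: "u y = (\<Sum>b\<in>Basis. (\<alpha> y b - (\<Sum>c\<in>Basis. (u y \<bullet> c) * (G y c b - G x c b))) *\<^sub>R r b)"
    if y: "y \<in> S" for y
  proof -
    \<comment> \<open>Moving the perturbation \<open>G y - G x\<close> to the right-hand side makes
      \<open>u y\<close> the solution of a system with the fixed matrix \<open>G x\<close>.\<close>
    define \<beta> where "\<beta> = (\<lambda>z. \<alpha> y z - (G y (u y) z - G x (u y) z))"
    have l: "linear \<beta>" unfolding \<beta>_def
      by (intro linear_compose_sub \<alpha>(1) bilinear_linear_right bl S y)
    have "raise (G x) \<beta> = u y"
      by (rule raise_unique[OF G(1)[OF S(2)]]) (simp add: \<beta>_def u_def raise_eq[OF G(1)[OF y] \<alpha>(1)[OF y]])
    then have "u y = (\<Sum>b\<in>Basis. \<beta> b *\<^sub>R r b)"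
      using raise_eq_sum[OF G(1)[OF S(2)] l] by (simp add: r_def)
    moreover have "\<beta> b = \<alpha> y b - (\<Sum>c\<in>Basis. (u y \<bullet> c) * (G y c b - G x c b))" for b
      unfolding \<beta>_def linear_eq_sum_Basis[OF bilinear_linear_left[OF bl[OF y]], of "u y"]
        linear_eq_sum_Basis[OF bilinear_linear_left[OF bl[OF S(2)]], of "u y"]
      by (simp add: right_diff_distrib sum_subtractf)
    ultimately show ?thesis by simp
  qed
  have Sev: "eventually (\<lambda>y. y \<in> S) (at x)"
    using S by (simp add: eventually_at_topological) blast
  have cG: "((\<lambda>y. G y v w) \<longlongrightarrow> G x v w) (at x)" for v w
    using G(2) differentiable_imp_continuous_within isCont_def by blast
  have c\<alpha>: "((\<lambda>y. \<alpha> y z) \<longlongrightarrow> \<alpha> x z) (at x)" for z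
    using \<alpha>(2) differentiable_imp_continuous_within isCont_def by blast
  \<comment> \<open>\<open>\<delta>\<close> bounds the perturbation and \<open>A\<close> the
    right-hand side, so that the norm of \<open>u y\<close> is at most \<open>A y\<close> plus
    \<open>\<delta> y\<close> times itself. Once \<open>\<delta> y < 1/2\<close> that term is
    absorbed, which is the source of the factor 2 in \<open>bnd\<close>.\<close>
  define \<delta> where "\<delta> y = (\<Sum>b\<in>Basis. (\<Sum>c\<in>Basis. \<bar>G y c b - G x c b\<bar>) * norm (r b))" for y
  define A where "A y = (\<Sum>b\<in>Basis. \<bar>\<alpha> y b\<bar> * norm (r b))" for y
  have "(\<delta> \<longlongrightarrow> (\<Sum>b\<in>Basis. (\<Sum>c\<in>Basis. \<bar>G x c b - G x c b\<bar>) * norm (r b))) (at x)"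
    unfolding \<delta>_def by (intro tendsto_intros cG)
  then have "(\<delta> \<longlongrightarrow> 0) (at x)" by simp
  then have \<delta>ev: "eventually (\<lambda>y. \<delta> y < 1/2) (at x)" by (rule order_tendstoD) simp
  have "(A \<longlongrightarrow> A x) (at x)"
    unfolding A_def by (intro tendsto_intros c\<alpha>)
  then have Aev: "eventually (\<lambda>y. A y < A x + 1) (at x)" by (rule order_tendstoD) simp
  have bnd: "eventually (\<lambda>y. norm (u y) \<le> 2 * (A x + 1)) (at x)"
    using Sev \<delta>ev Aev
  proof eventually_elim
    case (elim y)
    have "norm (u y) \<le> (\<Sum>b\<in>Basis. norm ((\<alpha> y b - (\<Sum>c\<in>Basis. (u y \<bullet> c) * (G y c b - G x c b))) *\<^sub>R r b))"
      by (subst key[OF elim(1)]) (rule norm_sum)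
    also have "\<dots> \<le> (\<Sum>b\<in>Basis. (\<bar>\<alpha> y b\<bar> + (\<Sum>c\<in>Basis. \<bar>G y c b - G x c b\<bar>) * norm (u y)) * norm (r b))"
    proof (intro sum_mono)
      fix b :: 'e
      have "\<bar>\<Sum>c\<in>Basis. (u y \<bullet> c) * (G y c b - G x c b)\<bar> \<le> (\<Sum>c\<in>Basis. \<bar>G y c b - G x c b\<bar> * norm (u y))"
        by (intro sum_norm_le[where 'a=real, unfolded real_norm_def])
          (auto simp: abs_mult mult.commute[of "\<bar>u y \<bullet> _\<bar>"] intro!: mult_left_mono Basis_le_norm)
      then have "\<bar>\<alpha> y b - (\<Sum>c\<in>Basis. (u y \<bullet> c) * (G y c b - G x c b))\<bar>
        \<le> \<bar>\<alpha> y b\<bar> + (\<Sum>c\<in>Basis. \<bar>G y c b - G x c b\<bar>) * norm (u y)"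
        unfolding sum_distrib_right by linarith
      then show "norm ((\<alpha> y b - (\<Sum>c\<in>Basis. (u y \<bullet> c) * (G y c b - G x c b))) *\<^sub>R r b)
        \<le> (\<bar>\<alpha> y b\<bar> + (\<Sum>c\<in>Basis. \<bar>G y c b - G x c b\<bar>) * norm (u y)) * norm (r b)"
        by (simp add: mult_right_mono)
    qed
    also have "\<dots> = A y + \<delta> y * norm (u y)"
      by (simp add: A_def \<delta>_def distrib_left sum.distrib sum_distrib_left[of "norm (u y)"] ac_simps)
    also have "\<dots> \<le> (A x + 1) + (1/2) * norm (u y)"
      using elim by (intro add_mono mult_right_mono) auto
    finally show ?case by simp
  qed
  have small: "((\<lambda>y. (u y \<bullet> c) * (G y c b - G x c b)) \<longlongrightarrow> 0) (at x)" if c: "c \<in> Basis" for b c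
  proof (rule Lim_null_comparison)
    show "\<forall>\<^sub>F y in at x. norm ((u y \<bullet> c) * (G y c b - G x c b)) \<le> (2 * (A x + 1)) * \<bar>G y c b - G x c b\<bar>"
      using bnd
    proof eventually_elim
      case (elim y)
      have "\<bar>u y \<bullet> c\<bar> \<le> 2 * (A x + 1)" using Basis_le_norm[OF c, of "u y"] elim by linarith
      then show ?case by (simp add: abs_mult mult_right_mono)
    qed
    have "((\<lambda>y. (2 * (A x + 1)) * \<bar>G y c b - G x c b\<bar>) \<longlongrightarrow> (2 * (A x + 1)) * \<bar>G x c b - G x c b\<bar>) (at x)"
      by (intro tendsto_intros cG)
    then show "((\<lambda>y. (2 * (A x + 1)) * \<bar>G y c b - G x c b\<bar>) \<longlongrightarrow> 0) (at x)" by simp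
  qed
  have "((\<lambda>y. \<Sum>b\<in>Basis. (\<alpha> y b - (\<Sum>c\<in>Basis. (u y \<bullet> c) * (G y c b - G x c b))) *\<^sub>R r b)
     \<longlongrightarrow> (\<Sum>b\<in>Basis. (\<alpha> x b - (\<Sum>c\<in>(Basis::'e set). 0)) *\<^sub>R r b)) (at x)"
    by (intro tendsto_intros c\<alpha> small)
  moreover have "(\<Sum>b\<in>Basis. (\<alpha> x b - (\<Sum>c\<in>(Basis::'e set). 0)) *\<^sub>R r b) = u x"
    by (subst key[OF S(2)]) simp
  ultimately have "(u \<longlongrightarrow> u x) (at x)"
    using tendsto_cong[of u _ "at x" "u x", OF eventually_mono[OF Sev key]] by simp
  then have cu: "isCont (\<lambda>y. u y \<bullet> c) x" for c by (simp add: isCont_def tendsto_inner)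
  have dG: "((\<lambda>y. G y c b - G x c b) has_derivative (\<lambda>h. dd (\<lambda>y. G y c b) x h)) (at x)" for b c
    using has_derivative_diff[OF dd_works[OF G(2)] has_derivative_const[of "G x c b"]] by simp
  \<comment> \<open>The factor \<open>G y c b - G x c b\<close> vanishes at \<open>x\<close>, so
    continuity of \<open>u\<close> is enough to differentiate its product with
    \<open>u\<close>.\<close>
  have "((\<lambda>y. \<Sum>b\<in>Basis. (\<alpha> y b - (\<Sum>c\<in>Basis. (u y \<bullet> c) * (G y c b - G x c b))) *\<^sub>R r b) has_derivative
     (\<lambda>h. \<Sum>b\<in>Basis. (dd (\<lambda>y. \<alpha> y b) x h - (\<Sum>c\<in>Basis. (u x \<bullet> c) * dd (\<lambda>y. G y c b) x h)) *\<^sub>R r b)) (at x)"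
    by (intro has_derivative_sum has_derivative_scaleR_left has_derivative_diff dd_works \<alpha>(2)
        has_derivative_mult_vanishing dG cu) simp
  moreover have "(\<Sum>b\<in>Basis. (dd (\<lambda>y. \<alpha> y b) x h - (\<Sum>c\<in>Basis. (u x \<bullet> c) * dd (\<lambda>y. G y c b) x h)) *\<^sub>R r b)
     = raise (G x) (\<lambda>z. dd (\<lambda>y. \<alpha> y z) x h - dd (\<lambda>y. G y (u x) z) x h)" for h
  proof -
    \<comment> \<open>Linearity in \<open>z\<close> reassembles the sum over the basis into a single
      \<open>raise\<close>, and linearity in \<open>v\<close> reassembles \<open>u x\<close> from
      its coordinates.\<close>
    have l1: "linear (\<lambda>z. dd (\<lambda>y. G y v z) x h)" for v
      by (rule dd_linear_family[OF S]) (auto intro: bilinear_linear_right bl G)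
    have l2: "linear (\<lambda>v. dd (\<lambda>y. G y v z) x h)" for z
      by (rule dd_linear_family[OF S]) (auto intro: bilinear_linear_left bl G)
    have l3: "linear (\<lambda>z. dd (\<lambda>y. \<alpha> y z) x h)"
      by (rule dd_linear_family[OF S]) (auto intro: \<alpha>)
    show ?thesis
      unfolding raise_eq_sum[OF G(1)[OF S(2)] linear_compose_sub[OF l3 l1]]
      by (simp add: linear_eq_sum_Basis[OF l2, of "u x"] r_def)
  qed
  ultimately have "((\<lambda>y. \<Sum>b\<in>Basis. (\<alpha> y b - (\<Sum>c\<in>Basis. (u y \<bullet> c) * (G y c b - G x c b))) *\<^sub>R r b) has_derivative
     (\<lambda>h. raise (G x) (\<lambda>z. dd (\<lambda>y. \<alpha> y z) x h - dd (\<lambda>y. G y (u x) z) x h))) (at x)" by simp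
  from has_derivative_transform_within_open[OF this S key[symmetric]]
  show ?thesis unfolding u_def .
qed

section \<open>Metrics in coordinates\<close>

definition metric_on :: "'e::euclidean_space set \<Rightarrow> ('e \<Rightarrow> 'e \<Rightarrow> 'e \<Rightarrow> real) \<Rightarrow> bool" where
  "metric_on S G \<longleftrightarrow> open S \<and> (\<forall>y\<in>S. inner_product (G y)) \<and> (\<forall>v w. smooth_on S (\<lambda>y. G y v w))"

text \<open>The Christoffel symbols of the first kind. They are built from derivatives of the metric
  without inverting it, so their smoothness is immediate.\<close>

definition lower_christoffel ::
  "('e::euclidean_space \<Rightarrow> 'e \<Rightarrow> 'e \<Rightarrow> real) \<Rightarrow> 'e \<Rightarrow> 'e \<Rightarrow> 'e \<Rightarrow> 'e \<Rightarrow> real" where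
  "lower_christoffel G x v w z =
     (dd (\<lambda>y. G y w z) x v + dd (\<lambda>y. G y v z) x w - dd (\<lambda>y. G y v w) x z) / 2"

lemma christoffel_eq_raise: "christoffel G x v w = raise (G x) (lower_christoffel G x v w)"
  by (simp add: christoffel_def lower_christoffel_def[abs_def])

context
  fixes S :: "'e::euclidean_space set" and G
  assumes metric: "metric_on S G"
begin

lemma metric_on_open: "open S"
  using metric by (simp add: metric_on_def)

lemma metric_on_inner_product: "y \<in> S \<Longrightarrow> inner_product (G y)"
  using metric by (simp add: metric_on_def)

lemma metric_on_bilinear: "y \<in> S \<Longrightarrow> bilinear (G y)"
  using metric_on_inner_product by (simp add: inner_product_def)

lemma metric_on_commute: "y \<in> S \<Longrightarrow> G y v w = G y w v"
  using metric_on_inner_product by (simp add: inner_product_def)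

lemma metric_on_smooth: "smooth_on S (\<lambda>y. G y v w)"
  using metric by (simp add: metric_on_def)

lemma metric_on_differentiable: "y \<in> S \<Longrightarrow> (\<lambda>y. G y v w) differentiable (at y)"
  by (rule smooth_on_imp_differentiable[OF metric_on_smooth])

lemma dd_metric_linear:
  assumes "y \<in> S"
  shows "linear (\<lambda>v. dd (\<lambda>y. G y v w) y z)" "linear (\<lambda>w. dd (\<lambda>y. G y v w) y z)"
    "linear (\<lambda>z. dd (\<lambda>y. G y v w) y z)"
proof -
  show "linear (\<lambda>v. dd (\<lambda>y. G y v w) y z)"
    by (rule dd_linear_family[OF metric_on_open assms])
      (auto intro: bilinear_linear_left metric_on_bilinear metric_on_differentiable assms)
  show "linear (\<lambda>w. dd (\<lambda>y. G y v w) y z)"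
    by (rule dd_linear_family[OF metric_on_open assms])
      (auto intro: bilinear_linear_right metric_on_bilinear metric_on_differentiable assms)
  show "linear (\<lambda>z. dd (\<lambda>y. G y v w) y z)"
    by (rule dd_linear[OF metric_on_differentiable[OF assms]])
qed

lemma dd_metric_commute:
  assumes "y \<in> S"
  shows "dd (\<lambda>y. G y v w) y z = dd (\<lambda>y. G y w v) y z"
  using dd_cong_open[OF metric_on_open assms, of "\<lambda>y. G y v w" "\<lambda>y. G y w v"] metric_on_commute by simp

lemma lower_christoffel_linear:
  assumes "y \<in> S"
  shows "linear (\<lambda>v. lower_christoffel G y v w z)" "linear (\<lambda>w. lower_christoffel G y v w z)"
    "linear (\<lambda>z. lower_christoffel G y v w z)"
  unfolding lower_christoffel_def
  by (intro linearI; simp add: dd_metric_linear[OF assms, THEN linear_add]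
      dd_metric_linear[OF assms, THEN linear_cmul] field_simps)+

lemma lower_christoffel_smooth: "smooth_on S (\<lambda>y. lower_christoffel G y v w z)"
proof -
  have "smooth_on S (\<lambda>y. (1/2) * ((dd (\<lambda>y. G y w z) y v + dd (\<lambda>y. G y v z) y w) + (-1) * dd (\<lambda>y. G y v w) y z))"
    by (intro smooth_on_mult smooth_on_add smooth_on_const metric_on_open smooth_on_dd metric_on_smooth)
  then show ?thesis by (simp add: lower_christoffel_def[abs_def])
qed

lemma christoffel_char: "y \<in> S \<Longrightarrow> G y (christoffel G y v w) z = lower_christoffel G y v w z"
  unfolding christoffel_eq_raise
  by (rule raise_eq[OF metric_on_inner_product lower_christoffel_linear(3)])

text \<open>The way in which Christoffel symbols are identified below: a candidate vector is paired
  with an arbitrary \<open>z\<close> and compared with the symbol of the first kind.\<close>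

lemma christoffel_eqI:
  assumes "y \<in> S" "\<And>z. G y u z = lower_christoffel G y v w z"
  shows "christoffel G y v w = u"
  unfolding christoffel_eq_raise by (rule raise_unique[OF metric_on_inner_product[OF assms(1)] assms(2)])

lemma christoffel_commute: "y \<in> S \<Longrightarrow> christoffel G y v w = christoffel G y w v"
  by (rule christoffel_eqI) (simp_all add: christoffel_char, simp add: lower_christoffel_def dd_metric_commute[of _ v w])

lemma christoffel_linear_right:
  assumes "y \<in> S"
  shows "linear (christoffel G y v)"
proof (rule linearI)
  fix a b show "christoffel G y v (a + b) = christoffel G y v a + christoffel G y v b"
    by (rule christoffel_eqI[OF assms])
      (simp add: bilinear_ladd[OF metric_on_bilinear[OF assms]] christoffel_char[OF assms]
        linear_add[OF lower_christoffel_linear(2)[OF assms]])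
next
  fix r a show "christoffel G y v (r *\<^sub>R a) = r *\<^sub>R christoffel G y v a"
    by (rule christoffel_eqI[OF assms])
      (simp add: bilinear_lmul[OF metric_on_bilinear[OF assms]] christoffel_char[OF assms]
        linear_cmul[OF lower_christoffel_linear(2)[OF assms]])
qed

lemma raise_metric_has_derivative:
  assumes x: "x \<in> S" and "\<And>y. y \<in> S \<Longrightarrow> linear (\<alpha> y)" "\<And>z. (\<lambda>y. \<alpha> y z) differentiable (at x)"
  shows "((\<lambda>y. raise (G y) (\<alpha> y)) has_derivative
    (\<lambda>h. raise (G x) (\<lambda>z. dd (\<lambda>y. \<alpha> y z) x h - dd (\<lambda>y. G y (raise (G x) (\<alpha> x)) z) x h))) (at x)"
  by (rule raise_has_derivative[OF metric_on_open x metric_on_inner_product metric_on_differentiable[OF x] assms(2,3)])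

lemma christoffel_has_derivative:
  assumes "x \<in> S"
  shows "((\<lambda>y. christoffel G y v w) has_derivative
    (\<lambda>h. raise (G x) (\<lambda>z. dd (\<lambda>y. lower_christoffel G y v w z) x h
       - dd (\<lambda>y. G y (christoffel G x v w) z) x h))) (at x)"
  unfolding christoffel_eq_raise
  by (rule raise_metric_has_derivative[OF assms lower_christoffel_linear(3)
        smooth_on_imp_differentiable[OF lower_christoffel_smooth assms]])

lemma christoffel_differentiable: "x \<in> S \<Longrightarrow> (\<lambda>y. christoffel G y v w) differentiable (at x)"
  by (rule differentiableI[OF christoffel_has_derivative])

lemma riemann_linear:
  assumes "x \<in> S"
  shows "linear (riemann G x v w)"
proof -
  have d: "linear (\<lambda>z. dd (\<lambda>y. christoffel G y v z) x w)" for v w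
    by (rule dd_linear_family[OF metric_on_open assms christoffel_linear_right christoffel_differentiable[OF assms]])
  have c: "linear (\<lambda>z. christoffel G x v (christoffel G x w z))" for v w
    using linear_compose[OF christoffel_linear_right[OF assms, of w] christoffel_linear_right[OF assms, of v]]
    by (simp add: o_def)
  have "riemann G x v w = (\<lambda>z. dd (\<lambda>y. christoffel G y w z) x v - dd (\<lambda>y. christoffel G y v z) x w
     + christoffel G x v (christoffel G x w z) - christoffel G x w (christoffel G x v z))"
    by (simp add: riemann_def[abs_def])
  then show ?thesis
    by (simp only:) (intro linear_compose_add linear_compose_sub d c)
qed

lemma ricci_linear:
  assumes "x \<in> S"
  shows "linear (ricci G x w)"
  unfolding ricci_def
  by (intro linearI) (simp_all add: linear_add[OF riemann_linear[OF assms]] linear_cmul[OF riemann_linear[OF assms]]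
      inner_add_left sum.distrib sum_distrib_left)

lemma schouten_linear:
  assumes "x \<in> S"
  shows "linear (schouten G x v)"
  unfolding schouten_def
  by (intro linearI) (simp_all add: linear_add[OF ricci_linear[OF assms]] linear_cmul[OF ricci_linear[OF assms]]
      bilinear_radd[OF metric_on_bilinear[OF assms]] bilinear_rmul[OF metric_on_bilinear[OF assms]] add_divide_distrib diff_divide_distrib distrib_left right_diff_distrib)

lemma raise_schouten:
  assumes "x \<in> S"
  shows "G x (raise (G x) (schouten G x v)) z = schouten G x v z"
  by (rule raise_eq[OF metric_on_inner_product[OF assms] schouten_linear[OF assms]])

end

section \<open>Twisted products in coordinates\<close>

text \<open>Independence of the coordinates in the range of \<open>p\<close>, tested only between
  points of \<open>S\<close>; in this form it makes sense without any assumption on the shape of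
  \<open>S\<close>.\<close>

definition shift_invariant :: "'e::real_normed_vector set \<Rightarrow> ('e \<Rightarrow> 'e) \<Rightarrow> ('e \<Rightarrow> 'b) \<Rightarrow> bool" where
  "shift_invariant S p F \<longleftrightarrow> (\<forall>y z. y \<in> S \<longrightarrow> y + p z \<in> S \<longrightarrow> F (y + p z) = F y)"

text \<open>On the line through \<open>y\<close> in direction \<open>p z\<close> the function is
  constant as long as the line stays in \<open>S\<close>, in particular near the parameter
  0.\<close>

lemma dd_shift_invariant_eq_0:
  assumes "open S" "linear p" "shift_invariant S p F" "y \<in> S" "F differentiable (at y)"
  shows "dd F y (p z) = 0"
proof -
  define T where "T = (\<lambda>t::real. y + t *\<^sub>R p z) -` S"
  have T: "open T" unfolding T_def
    by (rule open_vimage[OF assms(1)]) (intro continuous_intros)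
  have 0: "(0::real) \<in> T" using assms(4) by (simp add: T_def)
  have d: "((\<lambda>t. F (y + t *\<^sub>R p z)) has_derivative (\<lambda>h. dd F y (h *\<^sub>R p z))) (at 0)"
  proof -
    have 1: "((\<lambda>t. y + t *\<^sub>R p z) has_derivative (\<lambda>h. h *\<^sub>R p z)) (at 0)"
      by (auto intro!: derivative_eq_intros)
    have 2: "(F has_derivative dd F y) (at (y + 0 *\<^sub>R p z))" using dd_works[OF assms(5)] by simp
    show ?thesis by (rule has_derivative_compose[OF 1 2])
  qed
  have "F (y + t *\<^sub>R p z) = F y" if "t \<in> T" for t
    using assms(3,4) that unfolding shift_invariant_def T_def
    by (simp add: linear_cmul[OF assms(2), symmetric])
  from has_derivative_transform_within_open[OF d T 0 this]
  have "((\<lambda>t. F y) has_derivative (\<lambda>h. dd F y (h *\<^sub>R p z))) (at 0)" by simp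
  from fun_cong[OF has_derivative_unique[OF this has_derivative_const], of 1] have "dd F y (1 *\<^sub>R p z) = 0" .
  then show ?thesis by simp
qed

text \<open>Differentiation commutes with translation, and near \<open>y\<close> the translated
  function agrees with \<open>F\<close>.\<close>

lemma shift_invariant_dd:
  assumes "open S" "shift_invariant S p F" "\<And>y. y \<in> S \<Longrightarrow> F differentiable (at y)"
  shows "shift_invariant S p (\<lambda>y. dd F y w)"
  unfolding shift_invariant_def
proof (intro allI impI)
  fix y z assume y: "y \<in> S" "y + p z \<in> S"
  define T where "T = S \<inter> (\<lambda>x. x + p z) -` S"
  have T: "open T" unfolding T_def
    by (intro open_Int assms open_vimage) (intro continuous_intros)
  have "((\<lambda>x. x + p z) has_derivative (\<lambda>h. h)) (at y)" by (auto intro!: derivative_eq_intros)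
  from has_derivative_compose[OF this dd_works[OF assms(3)[OF y(2)]]]
  have "((\<lambda>x. F (x + p z)) has_derivative dd F (y + p z)) (at y)" .
  then have "dd (\<lambda>x. F (x + p z)) y = dd F (y + p z)" by (rule dd_eq)
  moreover have "dd (\<lambda>x. F (x + p z)) y = dd F y"
    by (rule dd_cong_open[OF T]) (use assms(2) y in \<open>auto simp: T_def shift_invariant_def\<close>)
  ultimately show "dd F (y + p z) w = dd F y w" by simp
qed

text \<open>Complementary projections to which the standard basis is adapted by
  \<open>p_Basis\<close>, so that the trace defining \<open>ricci\<close> splits into two blocks.
  Abstract \<open>p\<close> and \<open>q\<close> are used instead of the projections of a product
  type in order that they can be exchanged.\<close>

locale coordinate_split =
  fixes p q :: "'e::euclidean_space \<Rightarrow> 'e"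
  assumes p_lin: "linear p" and q_lin: "linear q" and pq_add: "p v + q v = v"
    and pp [simp]: "p (p v) = p v" and qq [simp]: "q (q v) = q v"
    and pq [simp]: "p (q v) = 0" and qp [simp]: "q (p v) = 0"
    and p_Basis: "b \<in> Basis \<Longrightarrow> p b = b \<or> p b = 0"
begin

lemmas p_simps = linear_add[OF p_lin] linear_diff[OF p_lin] linear_cmul[OF p_lin] linear_neg[OF p_lin] linear_0[OF p_lin]
lemmas q_simps = linear_add[OF q_lin] linear_diff[OF q_lin] linear_cmul[OF q_lin] linear_neg[OF q_lin] linear_0[OF q_lin]

lemma split_swap: "coordinate_split q p"
proof (rule coordinate_split.intro)
  fix b :: 'e assume "b \<in> Basis"
  then show "q b = b \<or> q b = 0" using p_Basis[of b] pq_add[of b] by auto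
qed (simp_all add: p_lin q_lin pq_add add.commute[of "q v" "p v" for v])

definition Bp where "Bp = {b \<in> Basis. p b = b}"
definition Bq where "Bq = {b \<in> Basis. q b = b}"

lemma finite_Bp [simp]: "finite Bp" and finite_Bq [simp]: "finite Bq"
  by (simp_all add: Bp_def Bq_def)

lemma q_Bp: "b \<in> Bp \<Longrightarrow> q b = 0"
  using qp[of b] by (simp only: Bp_def mem_Collect_eq)

lemma Basis_split: "Basis = Bp \<union> Bq" "Bp \<inter> Bq = {}"
proof -
  have "b \<in> Bp \<or> b \<in> Bq" if "b \<in> Basis" for b
    using p_Basis[OF that] pq_add[of b] that by (auto simp: Bp_def Bq_def)
  then show "Basis = Bp \<union> Bq" by (auto simp: Bp_def Bq_def)
  show "Bp \<inter> Bq = {}" using q_Bp by (force simp: Bp_def Bq_def)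
qed

lemma card_Bp_Bq: "card Bp + card Bq = DIM('e)"
  by (simp add: Basis_split card_Un_disjoint)

lemma sum_Basis_split: "(\<Sum>b\<in>Basis. f b) = (\<Sum>b\<in>Bp. f b) + (\<Sum>b\<in>Bq. f b)"
  unfolding Basis_split(1) by (rule sum.union_disjoint) (simp_all add: Basis_split)

lemma sum_Basis_in_Bp: "b \<in> Bp \<Longrightarrow> b \<in> Basis" "b \<in> Bq \<Longrightarrow> b \<in> Basis"
  using Basis_split by auto

text \<open>No orthogonality for the standard inner product is assumed. It follows by expanding
  \<open>v\<close> in the basis, each element of which \<open>q\<close> either kills or
  fixes.\<close>

lemma inner_q_Bp: "b \<in> Bp \<Longrightarrow> q v \<bullet> b = 0"
proof -
  assume b: "b \<in> Bp"
  have "q v \<bullet> b = (\<Sum>c\<in>Basis. (v \<bullet> c) * (q c \<bullet> b))"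
    by (subst linear_eq_sum_Basis[OF q_lin]) (simp add: inner_sum_left)
  also have "\<dots> = 0"
  proof (rule sum.neutral, rule ballI)
    fix c :: 'e assume "c \<in> Basis"
    then have "q c = 0 \<or> (c \<in> Basis \<and> c \<noteq> b \<and> q c = c)"
      using Basis_split q_Bp b by (auto simp: Bq_def)
    then show "(v \<bullet> c) * (q c \<bullet> b) = 0"
      using b inner_not_same_Basis[of c b] sum_Basis_in_Bp by auto
  qed
  finally show ?thesis .
qed

lemma inner_p_Bq: "b \<in> Bq \<Longrightarrow> p v \<bullet> b = 0"
proof -
  assume b: "b \<in> Bq"
  interpret sw: coordinate_split q p by (rule split_swap)
  show ?thesis using sw.inner_q_Bp[of b v] b by (simp add: sw.Bp_def Bq_def)
qed

lemma inner_Bq: "b \<in> Bq \<Longrightarrow> q v \<bullet> b = v \<bullet> b"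
  using inner_p_Bq[of b v] arg_cong[OF pq_add[of v], of "\<lambda>v. v \<bullet> b"] by (simp add: inner_add_left)

text \<open>The trace over the \<open>p\<close>-block of the rank one map sending \<open>c\<close>
  to \<open>l c\<close> times \<open>p v\<close>. The terms of the Ricci trace that are not
  multiples of the identity are of this kind.\<close>

lemma linear_sum_Bp: "linear (l :: 'e \<Rightarrow> real) \<Longrightarrow> (\<Sum>b\<in>Bp. l b * (p v \<bullet> b)) = l (p v)"
  by (simp add: linear_eq_sum_Basis[of l "p v"] sum_Basis_split inner_p_Bq mult.commute)

lemma linear_sum_Bq: "linear (l :: 'e \<Rightarrow> real) \<Longrightarrow> (\<Sum>b\<in>Bq. l b * (q v \<bullet> b)) = l (q v)"
  by (simp add: linear_eq_sum_Basis[of l "q v"] sum_Basis_split inner_q_Bp mult.commute)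

end

text \<open>\<open>G\<close> is \<open>e\<^sup>a g\<^sub>1 + e\<^sup>b g\<^sub>2\<close>, and \<open>m\<close> is the product metric \<open>g\<^sub>1 + g\<^sub>2\<close>. The conditions are
  invariant under exchanging the two factors, so that both families of leaves are covered.\<close>

locale twisted_metric = coordinate_split +
  fixes S :: "'a set" and m :: "'a \<Rightarrow> 'a \<Rightarrow> 'a \<Rightarrow> real" and a b :: "'a \<Rightarrow> real"
    and G :: "'a \<Rightarrow> 'a \<Rightarrow> 'a \<Rightarrow> real"
  assumes m: "metric_on S m"
    and orth: "y \<in> S \<Longrightarrow> m y (p v) (q w) = 0"
    and inv_p: "shift_invariant S q (\<lambda>y. m y (p v) (p w))"
    and inv_q: "shift_invariant S p (\<lambda>y. m y (q v) (q w))"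
    and a_smooth: "smooth_on S a" and b_smooth: "smooth_on S b"
    and G_metric: "metric_on S G"
    and G_eq: "y \<in> S \<Longrightarrow> G y v w = exp (a y) * m y (p v) (p w) + exp (b y) * m y (q v) (q w)"
begin

lemma open_S: "open S" using metric_on_open[OF m] .

lemma twisted_swap: "twisted_metric q p S m b a G"
proof -
  show ?thesis
  proof (intro twisted_metric.intro twisted_metric_axioms.intro split_swap)
    fix y v w assume y: "y \<in> S"
    show "m y (q v) (p w) = 0" using orth[OF y, of w v] metric_on_commute[OF m y] by simp
    show "G y v w = exp (b y) * m y (q v) (q w) + exp (a y) * m y (p v) (p w)"
      by (simp add: G_eq[OF y])
  qed (use m inv_p inv_q a_smooth b_smooth G_metric in auto)
qed

lemma dd_m_diff: "y \<in> S \<Longrightarrow> (\<lambda>y. m y v w) differentiable (at y)"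
  by (rule metric_on_differentiable[OF m])

lemma dd_mpp_q: "y \<in> S \<Longrightarrow> dd (\<lambda>y. m y (p v) (p w)) y (q z) = 0"
  by (rule dd_shift_invariant_eq_0[OF open_S q_lin inv_p _ dd_m_diff])

lemma dd_mqq_p: "y \<in> S \<Longrightarrow> dd (\<lambda>y. m y (q v) (q w)) y (p z) = 0"
  by (rule dd_shift_invariant_eq_0[OF open_S p_lin inv_q _ dd_m_diff])

lemma orth': "y \<in> S \<Longrightarrow> m y (q v) (p w) = 0"
  using orth[of y w v] metric_on_commute[OF m, of y "q v" "p w"] by simp

lemma m_zero: "y \<in> S \<Longrightarrow> m y 0 w = 0" "y \<in> S \<Longrightarrow> m y w 0 = 0"
  by (simp_all add: bilinear_lzero[OF metric_on_bilinear[OF m]] bilinear_rzero[OF metric_on_bilinear[OF m]])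

lemma m_split: "y \<in> S \<Longrightarrow> m y v w = m y (p v) (p w) + m y (q v) (q w)"
proof -
  assume y: "y \<in> S"
  have "m y v w = m y (p v + q v) (p w + q w)" by (simp add: pq_add)
  also have "\<dots> = m y (p v) (p w) + m y (q v) (q w)"
    by (simp add: bilinear_ladd[OF metric_on_bilinear[OF m y]] bilinear_radd[OF metric_on_bilinear[OF m y]]
        orth[OF y] orth'[OF y])
  finally show ?thesis .
qed

lemma m_p: "y \<in> S \<Longrightarrow> m y v (p w) = m y (p v) (p w)" "y \<in> S \<Longrightarrow> m y (p v) w = m y (p v) (p w)"
  using m_split[of y v "p w"] m_split[of y "p v" w] m_zero by simp_all

lemma m_q: "y \<in> S \<Longrightarrow> m y v (q w) = m y (q v) (q w)" "y \<in> S \<Longrightarrow> m y (q v) w = m y (q v) (q w)"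
  using m_split[of y v "q w"] m_split[of y "q v" w] m_zero by simp_all

text \<open>The cross terms are missing because the metric of each factor is constant along the
  other factor.\<close>

lemma dd_m_split:
  assumes "y \<in> S"
  shows "dd (\<lambda>y. m y v w) y z = dd (\<lambda>y. m y (p v) (p w)) y (p z) + dd (\<lambda>y. m y (q v) (q w)) y (q z)"
proof -
  have "dd (\<lambda>y. m y v w) y = dd (\<lambda>y. m y (p v) (p w) + m y (q v) (q w)) y"
    by (rule dd_cong_open[OF open_S assms]) (rule m_split)
  also have "\<dots> = (\<lambda>z. dd (\<lambda>y. m y (p v) (p w)) y z + dd (\<lambda>y. m y (q v) (q w)) y z)"
    by (intro dd_eq has_derivative_add dd_works dd_m_diff assms)
  finally have "dd (\<lambda>y. m y v w) y z = dd (\<lambda>y. m y (p v) (p w)) y (p z + q z) + dd (\<lambda>y. m y (q v) (q w)) y (p z + q z)"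
    by (simp add: pq_add)
  then show ?thesis
    by (simp only: linear_add[OF dd_linear[OF dd_m_diff[OF assms]]] dd_mpp_q[OF assms] dd_mqq_p[OF assms]
        add_0_left add_0_right)
qed

text \<open>\<open>lp\<close> and \<open>lq\<close> are the Christoffel symbols of the first kind of
  the two factor metrics.\<close>

abbreviation lp where
  "lp y v w z \<equiv> (dd (\<lambda>y. m y (p w) (p z)) y (p v) + dd (\<lambda>y. m y (p v) (p z)) y (p w) - dd (\<lambda>y. m y (p v) (p w)) y (p z)) / 2"

abbreviation lq where
  "lq y v w z \<equiv> (dd (\<lambda>y. m y (q w) (q z)) y (q v) + dd (\<lambda>y. m y (q v) (q z)) y (q w) - dd (\<lambda>y. m y (q v) (q w)) y (q z)) / 2"

lemma dd_m_zero:
  assumes "y \<in> S"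
  shows "dd (\<lambda>y. m y 0 w) y z = 0" "dd (\<lambda>y. m y w 0) y z = 0" "dd (\<lambda>y. m y v w) y 0 = 0"
  using dd_metric_linear[OF m assms, THEN linear_0] by auto

lemma lower_christoffel_m:
  assumes "y \<in> S"
  shows "lower_christoffel m y v w z = lp y v w z + lq y v w z"
  unfolding lower_christoffel_def dd_m_split[OF assms, of w z] dd_m_split[OF assms, of v z] dd_m_split[OF assms, of v w]
  by (simp add: field_simps)

lemma lp_eq: "y \<in> S \<Longrightarrow> lp y v w z = lower_christoffel m y v w (p z)"
  by (subst lower_christoffel_m) (simp_all add: dd_m_zero)

lemma lq_eq: "y \<in> S \<Longrightarrow> lq y v w z = lower_christoffel m y v w (q z)"
  by (subst lower_christoffel_m) (simp_all add: dd_m_zero)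

lemma m_p_christoffel: "y \<in> S \<Longrightarrow> m y (p (christoffel m y v w)) (p z) = lp y v w z"
  by (simp only: m_p(1)[symmetric] christoffel_char[OF m] lp_eq)

lemma m_q_christoffel: "y \<in> S \<Longrightarrow> m y (q (christoffel m y v w)) (q z) = lq y v w z"
  by (simp only: m_q(1)[symmetric] christoffel_char[OF m] lq_eq)

lemma christoffel_m_mixed:
  assumes "y \<in> S"
  shows "christoffel m y (p v) (q w) = 0"
  by (rule christoffel_eqI[OF m assms])
    (simp add: lower_christoffel_m[OF assms] dd_m_zero[OF assms] m_zero[OF assms])

lemma eq_0_if_m_eq_0:
  assumes "y \<in> S" "\<And>z. m y u z = 0"
  shows "u = 0"
  using inner_product_eq_iff[OF metric_on_inner_product[OF m assms(1)], of u 0] assms(2)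
    bilinear_lzero[OF metric_on_bilinear[OF m assms(1)]] by simp

lemma q_christoffel_m:
  assumes "y \<in> S"
  shows "q (christoffel m y v w) = christoffel m y (q v) (q w)"
proof (rule christoffel_eqI[OF m assms, symmetric])
  fix z
  show "m y (q (christoffel m y v w)) z = lower_christoffel m y (q v) (q w) z"
    unfolding m_q(2)[OF assms, of _ z] m_q_christoffel[OF assms] lower_christoffel_m[OF assms]
    by (simp add: dd_m_zero[OF assms])
qed

lemma p_christoffel_m:
  assumes "y \<in> S"
  shows "p (christoffel m y v w) = christoffel m y (p v) (p w)"
proof -
  interpret sw: twisted_metric q p S m b a G by (rule twisted_swap)
  show ?thesis by (rule sw.q_christoffel_m[OF assms])
qed

section \<open>Gradients and the Christoffel symbols of the twisted metric\<close>

definition grad :: "('a \<Rightarrow> real) \<Rightarrow> 'a \<Rightarrow> 'a" where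
  "grad c y = raise (m y) (dd c y)"

text \<open>The gradient with respect to \<open>G\<close>, expressed through the one for
  \<open>m\<close>: the inverse of \<open>G\<close> is the inverse of \<open>m\<close> scaled by
  \<open>exp (- a)\<close> on one block and by \<open>exp (- b)\<close> on the other.\<close>

definition grad_G :: "('a \<Rightarrow> real) \<Rightarrow> 'a \<Rightarrow> 'a" where
  "grad_G c y = exp (- a y) *\<^sub>R p (grad c y) + exp (- b y) *\<^sub>R q (grad c y)"

lemma m_grad: "y \<in> S \<Longrightarrow> c differentiable (at y) \<Longrightarrow> m y (grad c y) z = dd c y z"
  unfolding grad_def by (rule raise_eq[OF metric_on_inner_product[OF m] dd_linear])

lemma G_grad_G:
  assumes "y \<in> S" "c differentiable (at y)"
  shows "G y (grad_G c y) z = dd c y z"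
proof -
  have "G y (grad_G c y) z = exp (a y) * (exp (- a y) * m y (p (grad c y)) (p z)) + exp (b y) * (exp (- b y) * m y (q (grad c y)) (q z))"
    by (simp add: G_eq[OF assms(1)] grad_G_def p_simps q_simps
        q_simps bilinear_lmul[OF metric_on_bilinear[OF m assms(1)]])
  also have "\<dots> = m y (grad c y) z"
    by (simp add: m_split[OF assms(1), of "grad c y" z] exp_minus mult.assoc[symmetric])
  finally show ?thesis by (simp add: m_grad[OF assms])
qed

lemma a_diff: "y \<in> S \<Longrightarrow> a differentiable (at y)" and b_diff: "y \<in> S \<Longrightarrow> b differentiable (at y)"
  using a_smooth b_smooth by (auto intro: smooth_on_imp_differentiable)

lemma dd_G:
  assumes "y \<in> S"
  shows "dd (\<lambda>y. G y v w) y z =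
    exp (a y) * (dd a y z * m y (p v) (p w) + dd (\<lambda>y. m y (p v) (p w)) y (p z)) +
    exp (b y) * (dd b y z * m y (q v) (q w) + dd (\<lambda>y. m y (q v) (q w)) y (q z))"
proof -
  have e: "((\<lambda>y. exp (c y)) has_derivative (\<lambda>z. dd c y z * exp (c y))) (at y)" if "c differentiable (at y)" for c :: "'a \<Rightarrow> real"
    using has_derivative_exp[OF dd_works[OF that]] by (simp add: mult.commute)
  have "dd (\<lambda>y. G y v w) y = dd (\<lambda>y. exp (a y) * m y (p v) (p w) + exp (b y) * m y (q v) (q w)) y"
    by (rule dd_cong_open[OF open_S assms]) (rule G_eq)
  also have "\<dots> = (\<lambda>z. (exp (a y) * dd (\<lambda>y. m y (p v) (p w)) y z + dd a y z * exp (a y) * m y (p v) (p w))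
     + (exp (b y) * dd (\<lambda>y. m y (q v) (q w)) y z + dd b y z * exp (b y) * m y (q v) (q w)))"
    by (intro dd_eq has_derivative_add has_derivative_mult e dd_works dd_m_diff assms a_diff b_diff)
  finally show ?thesis
    using dd_m_split[OF assms, of "p v" "p w" z] dd_m_split[OF assms, of "q v" "q w" z]
    by (simp add: dd_m_zero[OF assms] algebra_simps)
qed

text \<open>The derivative of the factor \<open>exp a\<close> enters each of the three terms of the
  symbol of the first kind. The two terms differentiated along \<open>v\<close> and \<open>w\<close>
  give multiples of \<open>p w\<close> and \<open>p v\<close>, the one differentiated along
  \<open>z\<close> gives the gradient; likewise for \<open>b\<close>.\<close>

lemma christoffel_G:
  assumes "y \<in> S"
  shows "christoffel G y v w = christoffel m y v w + (1/2) *\<^sub>R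
    (dd a y v *\<^sub>R p w + dd a y w *\<^sub>R p v + dd b y v *\<^sub>R q w + dd b y w *\<^sub>R q v
     - (exp (a y) * m y (p v) (p w)) *\<^sub>R grad_G a y - (exp (b y) * m y (q v) (q w)) *\<^sub>R grad_G b y)"
proof (rule christoffel_eqI[OF G_metric assms])
  fix z
  note bG = metric_on_bilinear[OF G_metric assms]
  have 1: "G y (p u) z = exp (a y) * m y (p u) (p z)" "G y (q u) z = exp (b y) * m y (q u) (q z)" for u
    by (simp_all add: G_eq[OF assms] m_zero[OF assms])
  have 2: "G y (christoffel m y v w) z = exp (a y) * lp y v w z + exp (b y) * lq y v w z"
    by (simp only: G_eq[OF assms] m_p_christoffel[OF assms] m_q_christoffel[OF assms])
  show "G y (christoffel m y v w + (1/2) *\<^sub>R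
    (dd a y v *\<^sub>R p w + dd a y w *\<^sub>R p v + dd b y v *\<^sub>R q w + dd b y w *\<^sub>R q v
     - (exp (a y) * m y (p v) (p w)) *\<^sub>R grad_G a y - (exp (b y) * m y (q v) (q w)) *\<^sub>R grad_G b y)) z
    = lower_christoffel G y v w z"
    unfolding lower_christoffel_def dd_G[OF assms]
    by (simp add: bilinear_ladd[OF bG] bilinear_lsub[OF bG] bilinear_lmul[OF bG] 1 2
        G_grad_G[OF assms a_diff[OF assms]] G_grad_G[OF assms b_diff[OF assms]] field_simps)
qed

lemma christoffel_G_mixed:
  assumes "y \<in> S"
  shows "christoffel G y (p v) (q w) = (1/2) *\<^sub>R (dd a y (q w) *\<^sub>R p v + dd b y (p v) *\<^sub>R q w)"
  by (simp add: christoffel_G[OF assms] christoffel_m_mixed[OF assms] m_zero[OF assms] p_simps q_simps)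

text \<open>For \<open>w\<close> tangent to the \<open>p\<close>-leaf only the second term survives,
  which is the second fundamental form of the leaf; for normal \<open>w\<close> only the first,
  which is the normal connection. In \<open>exp (a y - b y)\<close> one exponent comes from
  \<open>G\<close> on tangent vectors and the other from raising the index of \<open>dd a\<close> in
  the normal block.\<close>

lemma q_christoffel_G_p:
  assumes "y \<in> S"
  shows "q (christoffel G y (p v) w) = (1/2) *\<^sub>R (dd b y (p v) *\<^sub>R q w
     - (exp (a y - b y) * m y (p v) (p w)) *\<^sub>R q (grad a y))"
proof -
  have "q (christoffel m y (p v) w) = 0"
    using christoffel_m_mixed[OF assms, of 0 w] by (simp add: q_christoffel_m[OF assms] p_simps)
  moreover have "q (grad_G a y) = exp (- b y) *\<^sub>R q (grad a y)"
    by (simp add: grad_G_def q_simps)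
  ultimately show ?thesis
    by (simp add: christoffel_G[OF assms] q_simps
        m_zero[OF assms] exp_diff exp_minus field_simps)
qed

lemma christoffel_G_qq:
  assumes "y \<in> S"
  shows "q (christoffel G y (q v) (q w)) = christoffel m y (q v) (q w) + (1/2) *\<^sub>R
      (dd b y (q v) *\<^sub>R q w + dd b y (q w) *\<^sub>R q v - m y (q v) (q w) *\<^sub>R q (grad b y))"
    "p (christoffel G y (q v) (q w)) = - ((1/2) * exp (b y - a y) * m y (q v) (q w)) *\<^sub>R p (grad b y)"
proof -
  have c: "q (grad_G b y) = exp (- b y) *\<^sub>R q (grad b y)" "p (grad_G b y) = exp (- a y) *\<^sub>R p (grad b y)"
    by (simp_all add: grad_G_def q_simps p_simps)
  \<comment> \<open>The zero vector lies in both factors, so this is a mixed symbol.\<close>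
  have 0: "christoffel m y 0 0 = 0" 
    using christoffel_m_mixed[OF assms, of 0 0] by (simp add: p_simps q_simps)
  show "q (christoffel G y (q v) (q w)) = christoffel m y (q v) (q w) + (1/2) *\<^sub>R
      (dd b y (q v) *\<^sub>R q w + dd b y (q w) *\<^sub>R q v - m y (q v) (q w) *\<^sub>R q (grad b y))"
    by (simp add: christoffel_G[OF assms] q_simps
        q_christoffel_m[OF assms] q_simps
        m_zero[OF assms] c exp_minus)
  show "p (christoffel G y (q v) (q w)) = - ((1/2) * exp (b y - a y) * m y (q v) (q w)) *\<^sub>R p (grad b y)"
    by (simp add: christoffel_G[OF assms] p_simps
        p_christoffel_m[OF assms] 0 p_simps
        m_zero[OF assms] c exp_minus exp_diff field_simps)
qed

end

section \<open>The mixed part of the Ricci tensor\<close>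

context twisted_metric
begin

text \<open>Second derivatives in coordinates. With one direction in each factor this is also the
  covariant Hessian for \<open>m\<close>, whose mixed Christoffel symbols vanish.\<close>

abbreviation hess :: "('a \<Rightarrow> real) \<Rightarrow> 'a \<Rightarrow> 'a \<Rightarrow> 'a \<Rightarrow> real" where
  "hess c y v z \<equiv> dd (\<lambda>y. dd c y v) y z"

lemma dd_a_diff: "y \<in> S \<Longrightarrow> (\<lambda>y. dd a y v) differentiable (at y)"
  and dd_b_diff: "y \<in> S \<Longrightarrow> (\<lambda>y. dd b y v) differentiable (at y)"
  using a_smooth b_smooth by (auto intro: smooth_on_imp_differentiable smooth_on_dd)

lemma dd_christoffel_mixed:
  assumes "y \<in> S"
  shows "dd (\<lambda>y. christoffel G y (p v) (q w)) y z =
    (1/2) *\<^sub>R (hess a y (q w) z *\<^sub>R p v + hess b y (p v) z *\<^sub>R q w)"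
proof -
  have "dd (\<lambda>y. christoffel G y (p v) (q w)) y
     = dd (\<lambda>y. (1/2) *\<^sub>R (dd a y (q w) *\<^sub>R p v + dd b y (p v) *\<^sub>R q w)) y"
    by (rule dd_cong_open[OF open_S assms]) (rule christoffel_G_mixed)
  also have "\<dots> = (\<lambda>z. (1/2) *\<^sub>R (hess a y (q w) z *\<^sub>R p v + hess b y (p v) z *\<^sub>R q w))"
    by (intro dd_eq has_derivative_scaleR_right has_derivative_add has_derivative_scaleR_left dd_works
        dd_a_diff dd_b_diff assms)
  finally show ?thesis by simp
qed

text \<open>The symbol with two entries in the \<open>p\<close>-block, which would bring in the
  geometry of the first factor, occurs symmetrically in \<open>v\<close> and \<open>w\<close> and
  cancels, so the mixed symbols suffice. The last term points in the \<open>q\<close>-direction and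
  drops out of the trace over \<open>Bp\<close>.\<close>

lemma riemann_p:
  assumes "y \<in> S"
  shows "riemann G y (p w) (p v) (q z) =
    (1/2) *\<^sub>R (hess a y (q z) (p w) *\<^sub>R p v - hess a y (q z) (p v) *\<^sub>R p w)
    + (1/4) *\<^sub>R ((dd b y (p v) * dd a y (q z)) *\<^sub>R p w - (dd b y (p w) * dd a y (q z)) *\<^sub>R p v)
    + (1/2) *\<^sub>R ((hess b y (p v) (p w) - hess b y (p w) (p v)) *\<^sub>R q z)"
proof -
  note c = christoffel_G_mixed[OF assms]
  note l = linear_add[OF christoffel_linear_right[OF G_metric assms]]
    linear_cmul[OF christoffel_linear_right[OF G_metric assms]]
  have s: "christoffel G y (p w) (p v) = christoffel G y (p v) (p w)"
    by (rule christoffel_commute[OF G_metric assms])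
  show ?thesis
    unfolding riemann_def dd_christoffel_mixed[OF assms] c l s
    by (simp add: scaleR_add_right scaleR_diff_right scaleR_diff_left ac_simps)
qed

lemma q_dd:
  assumes "F differentiable (at y)"
  shows "q (dd F y z) = dd (\<lambda>y. q (F y)) y z"
proof -
  have "((\<lambda>y. q (F y)) has_derivative (\<lambda>z. q (dd F y z))) (at y)"
    by (rule bounded_linear.has_derivative[OF _ dd_works[OF assms]]) (rule linear_conv_bounded_linear[THEN iffD1, OF q_lin])
  then show ?thesis by (simp add: dd_eq)
qed

lemma grad_has_derivative:
  assumes "x \<in> S" "smooth_on S c"
  shows "(grad c has_derivative (\<lambda>h. raise (m x) (\<lambda>z. hess c x z h - dd (\<lambda>y. m y (grad c x) z) x h))) (at x)"
  unfolding grad_def[abs_def]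
  by (rule raise_metric_has_derivative[OF m assms(1) dd_linear])
    (use assms smooth_on_dd smooth_on_imp_differentiable in blast)+

text \<open>Differentiate \<open>m (grad c) (q z) = dd c (q z)\<close> along \<open>p v\<close>; the
  metric on the \<open>q\<close>-block does not vary in that direction.\<close>

lemma m_dd_grad:
  assumes "y \<in> S" "smooth_on S c"
  shows "m y (q (dd (grad c) y (p v))) (q z) = hess c y (q z) (p v)"
proof -
  define g where "g = grad c y"
  have "dd (grad c) y = (\<lambda>h. raise (m y) (\<lambda>z. hess c y z h - dd (\<lambda>y. m y g z) y h))"
    unfolding g_def by (rule dd_eq[OF grad_has_derivative[OF assms]])
  moreover have "m y (raise (m y) (\<lambda>z. hess c y z (p v) - dd (\<lambda>y. m y g z) y (p v))) (q z)
      = hess c y (q z) (p v) - dd (\<lambda>y. m y g (q z)) y (p v)"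
  proof (rule raise_eq[OF metric_on_inner_product[OF m assms(1)]])
    have "linear (\<lambda>z. hess c y z (p v))"
      by (rule dd_linear_family[OF open_S assms(1)])
        (use assms smooth_on_dd smooth_on_imp_differentiable dd_linear in blast)+
    then show "linear (\<lambda>z. hess c y z (p v) - dd (\<lambda>y. m y g z) y (p v))"
      by (rule linear_compose_sub[OF _ dd_metric_linear(2)[OF m assms(1)]])
  qed
  moreover have "dd (\<lambda>y. m y g (q z)) y (p v) = 0"
    using dd_m_split[OF assms(1), of g "q z" "p v"]
    by (simp add: dd_m_zero[OF assms(1)])
  ultimately show ?thesis by (simp add: m_q(1)[OF assms(1), symmetric])
qed

text \<open>The Christoffel symbols of the second factor are constant along the first. As
  \<open>raise\<close> involves the whole of \<open>m\<close>, which does vary there, this is read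
  off from the derivative formula: both covectors under \<open>raise\<close> vanish.\<close>

lemma dd_christoffel_m_qq:
  assumes "y \<in> S"
  shows "dd (\<lambda>y. christoffel m y (q v) (q w)) y (p z) = 0"
proof -
  have 1: "dd (\<lambda>y. lower_christoffel m y (q v) (q w) u) y (p z) = 0" for u
  proof -
    have "dd (\<lambda>y. lower_christoffel m y (q v) (q w) u) y = dd (\<lambda>y. lq y v w u) y"
    proof (rule dd_cong_open[OF open_S assms])
      fix x assume x: "x \<in> S"
      show "lower_christoffel m x (q v) (q w) u = lq x v w u"
        by (simp add: lower_christoffel_m[OF x] dd_m_zero[OF x])
    qed
    moreover have "dd (\<lambda>y. lq y v w u) y (p z) = 0"
    proof (rule dd_shift_invariant_eq_0[OF open_S p_lin _ assms])
      have "shift_invariant S p (\<lambda>y. dd (\<lambda>y. m y (q v) (q w)) y h)" for v w h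
        by (rule shift_invariant_dd[OF open_S inv_q dd_m_diff])
      then show "shift_invariant S p (\<lambda>y. lq y v w u)" by (simp add: shift_invariant_def)
      have "(\<lambda>y. dd (\<lambda>y. m y v w) y h) differentiable (at y)" for v w h
        by (rule smooth_on_imp_differentiable[OF smooth_on_dd[OF metric_on_smooth[OF m]] assms])
      then show "(\<lambda>y. lq y v w u) differentiable (at y)"
        by (intro differentiable_divide differentiable_add differentiable_diff differentiable_const) auto
    qed
    ultimately show ?thesis by simp
  qed
  \<comment> \<open>The symbol is frozen at \<open>y0\<close> while the point of evaluation of
    \<open>m\<close> is differentiated. Its value is a vector of the \<open>q\<close>-block.\<close>
  have 2: "dd (\<lambda>y. m y (christoffel m y0 (q v) (q w)) u) y (p z) = 0" if "y0 = y" for u y0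
  proof -
    define c where "c = christoffel m y0 (q v) (q w)"
    have "c = q c" using q_christoffel_m[OF assms, of "q v" "q w"] that by (simp add: c_def)
    have "p c = 0" by (subst \<open>c = q c\<close>) (rule pq)
    then show ?thesis
      unfolding c_def[symmetric] using dd_m_split[OF assms, of c u "p z"]
      by (simp add: dd_m_zero[OF assms])
  qed
  have "raise (m y) (\<lambda>u. 0) = 0"
    by (rule raise_unique[OF metric_on_inner_product[OF m assms]])
      (simp add: m_zero[OF assms])
  then show ?thesis
    unfolding dd_eq[OF christoffel_has_derivative[OF m assms]] by (simp add: 1 2)
qed

lemma q_dd_christoffel_qq:
  assumes "y \<in> S"
  shows "q (dd (\<lambda>y. christoffel G y (q w) (q v)) y (p z)) =
    (1/2) *\<^sub>R (hess b y (q w) (p z) *\<^sub>R q v + hess b y (q v) (p z) *\<^sub>R q w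
      - m y (q w) (q v) *\<^sub>R q (dd (grad b) y (p z)))"
proof -
  have gd: "grad b differentiable (at y)"
    by (rule differentiableI[OF grad_has_derivative[OF assms b_smooth]])
  have qd: "(\<lambda>y. q (grad b y)) differentiable (at y)"
    using bounded_linear.has_derivative[OF linear_conv_bounded_linear[THEN iffD1, OF q_lin] dd_works[OF gd]]
    by (rule differentiableI)
  have "q (dd (\<lambda>y. christoffel G y (q w) (q v)) y (p z)) = dd (\<lambda>y. q (christoffel G y (q w) (q v))) y (p z)"
    by (rule q_dd[OF christoffel_differentiable[OF G_metric assms]])
  also have "dd (\<lambda>y. q (christoffel G y (q w) (q v))) y = dd (\<lambda>y. christoffel m y (q w) (q v) + (1/2) *\<^sub>R
      (dd b y (q w) *\<^sub>R q v + dd b y (q v) *\<^sub>R q w - m y (q w) (q v) *\<^sub>R q (grad b y))) y"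
    by (rule dd_cong_open[OF open_S assms]) (rule christoffel_G_qq(1))
  also have "\<dots> = (\<lambda>z. dd (\<lambda>y. christoffel m y (q w) (q v)) y z + (1/2) *\<^sub>R
      (hess b y (q w) z *\<^sub>R q v + hess b y (q v) z *\<^sub>R q w
       - (m y (q w) (q v) *\<^sub>R dd (\<lambda>y. q (grad b y)) y z + dd (\<lambda>y. m y (q w) (q v)) y z *\<^sub>R q (grad b y))))"
    by (intro dd_eq has_derivative_scaleR_right has_derivative_add has_derivative_diff has_derivative_scaleR_left
        has_derivative_scaleR dd_works christoffel_differentiable[OF m] dd_b_diff dd_m_diff qd assms)
  finally show ?thesis
    by (simp add: dd_christoffel_m_qq[OF assms] dd_mqq_p[OF assms] q_dd[OF gd])
qed

text \<open>Only the \<open>q\<close>-part matters for the trace over \<open>Bq\<close>. The symbol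
  \<open>christoffel G y (q w) (q z)\<close>, which carries the geometry of the second factor,
  occurs in both quadratic terms with the same coefficient and cancels up to its
  \<open>p\<close>-part.\<close>

lemma q_riemann_q:
  assumes "y \<in> S"
  shows "q (riemann G y (q w) (p v) (q z)) =
    (1/2) *\<^sub>R (m y (q w) (q z) *\<^sub>R q (dd (grad b) y (p v)) - hess b y (q z) (p v) *\<^sub>R q w)
    + (1/4) *\<^sub>R ((dd a y (q z) * dd b y (p v)) *\<^sub>R q w - (m y (q w) (q z) * dd b y (p v)) *\<^sub>R q (grad a y))"
proof -
  note l = linear_add[OF christoffel_linear_right[OF G_metric assms]]
    linear_cmul[OF christoffel_linear_right[OF G_metric assms]]
  have s: "christoffel G y (q w) (p v) = christoffel G y (p v) (q w)"
    by (rule christoffel_commute[OF G_metric assms])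
  have 1: "q (christoffel G y (q w) (christoffel G y (p v) (q z)))
     = (1/4) *\<^sub>R (dd a y (q z) * dd b y (p v)) *\<^sub>R q w + (1/2) *\<^sub>R dd b y (p v) *\<^sub>R q (christoffel G y (q w) (q z))"
    by (simp add: christoffel_G_mixed[OF assms] l s q_simps scaleR_add_right)
  \<comment> \<open>The \<open>p\<close>-part of the symbol is the second fundamental form of the
    other family of leaves. Its factor \<open>exp (b - a)\<close> cancels the
    \<open>exp (a - b)\<close> of \<open>q_christoffel_G_p\<close>.\<close>
  have "m y (p v) (p (christoffel G y (q w) (q z))) = - (1/2) * exp (b y - a y) * m y (q w) (q z) * m y (p v) (p (grad b y))"
    by (simp add: christoffel_G_qq(2)[OF assms] bilinear_rmul[OF metric_on_bilinear[OF m assms]]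
        bilinear_rneg[OF metric_on_bilinear[OF m assms]])
  also have "m y (p v) (p (grad b y)) = dd b y (p v)"
    using m_grad[OF assms b_diff[OF assms], of "p v"] metric_on_commute[OF m assms, of "p v" "grad b y"]
    by (simp add: m_p(2)[OF assms, symmetric])
  finally have 2: "exp (a y - b y) * m y (p v) (p (christoffel G y (q w) (q z))) = - (1/2) * m y (q w) (q z) * dd b y (p v)"
    by (simp add: exp_diff)
  have 3: "q (christoffel G y (p v) (christoffel G y (q w) (q z))) =
     (1/2) *\<^sub>R dd b y (p v) *\<^sub>R q (christoffel G y (q w) (q z)) + (1/4) *\<^sub>R (m y (q w) (q z) * dd b y (p v)) *\<^sub>R q (grad a y)"
    by (simp only: q_christoffel_G_p[OF assms] 2) (simp add: algebra_simps)
  have h: "hess b y (p v) (q w) = hess b y (q w) (p v)"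
    by (rule dd_symmetric[OF b_smooth open_S assms])
  show ?thesis
    unfolding riemann_def
    by (simp only: q_simps 1 3 q_dd_christoffel_qq[OF assms] dd_christoffel_mixed[OF assms] h pq qq)
      (simp add: algebra_simps)
qed

text \<open>In each block the multiples of the identity are counted with the dimension of the block,
  while the rank one terms contribute once with the opposite sign. Hence the coefficients
  \<open>card - 1\<close>.\<close>

theorem ricci_mixed:
  assumes "y \<in> S"
  shows "ricci G y (p v) (q z) =
    (real (card Bp) - 1) * (dd a y (q z) * dd b y (p v) / 4 - hess a y (q z) (p v) / 2)
    + (real (card Bq) - 1) * (dd a y (q z) * dd b y (p v) / 4 - hess b y (q z) (p v) / 2)"
proof -
  have 1: "riemann G y c (p v) (q z) \<bullet> c =
      (hess a y (q z) c * (p v \<bullet> c) - hess a y (q z) (p v)) / 2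
      + (dd b y (p v) * dd a y (q z) - (dd b y c * (p v \<bullet> c)) * dd a y (q z)) / 4"
    if c: "c \<in> Bp" for c
  proof -
    have "p c = c" "c \<bullet> c = 1" using c by (auto simp: Bp_def)
    then have "riemann G y c (p v) (q z) \<bullet> c = riemann G y (p c) (p v) (q z) \<bullet> c" by simp
    also have "\<dots> = (hess a y (q z) (p c) * (p v \<bullet> c) - hess a y (q z) (p v) * (p c \<bullet> c)) / 2
      + (dd b y (p v) * dd a y (q z) * (p c \<bullet> c) - (dd b y (p c) * dd a y (q z)) * (p v \<bullet> c)) / 4"
      unfolding riemann_p[OF assms] by (simp add: inner_add_left inner_diff_left inner_q_Bp[OF c])
    finally show ?thesis using \<open>p c = c\<close> \<open>c \<bullet> c = 1\<close> by (simp add: algebra_simps)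
  qed
  have 2: "riemann G y c (p v) (q z) \<bullet> c =
      (m y c (q z) * (q (dd (grad b) y (p v)) \<bullet> c) - hess b y (q z) (p v)) / 2
      + (dd a y (q z) * dd b y (p v) - (m y c (q z) * (q (grad a y) \<bullet> c)) * dd b y (p v)) / 4"
    if c: "c \<in> Bq" for c
  proof -
    have qc: "q c = c" "c \<bullet> c = 1" using c by (auto simp: Bq_def)
    then have "riemann G y c (p v) (q z) \<bullet> c = q (riemann G y (q c) (p v) (q z)) \<bullet> c"
      by (simp add: inner_Bq[OF c])
    also have "\<dots> = (m y (q c) (q z) * (q (dd (grad b) y (p v)) \<bullet> c) - hess b y (q z) (p v) * (q c \<bullet> c)) / 2
      + (dd a y (q z) * dd b y (p v) * (q c \<bullet> c) - m y (q c) (q z) * dd b y (p v) * (q (grad a y) \<bullet> c)) / 4"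
      unfolding q_riemann_q[OF assms] by (simp add: inner_add_left inner_diff_left)
    finally show ?thesis using qc by (simp add: algebra_simps)
  qed
  have la: "linear (hess a y (q z))" "linear (dd b y)"
    by (rule dd_linear[OF dd_a_diff[OF assms]], rule dd_linear[OF b_diff[OF assms]])
  have lm: "linear (\<lambda>c. m y c (q z))" by (rule bilinear_linear_left[OF metric_on_bilinear[OF m assms]])
  have sp: "(\<Sum>c\<in>Bp. riemann G y c (p v) (q z) \<bullet> c) =
     (hess a y (q z) (p v) - real (card Bp) * hess a y (q z) (p v)) / 2
     + (real (card Bp) * (dd b y (p v) * dd a y (q z)) - dd b y (p v) * dd a y (q z)) / 4"
    by (simp add: 1 sum.distrib sum_subtractf sum_divide_distrib[symmetric] sum_distrib_right[symmetric]
        linear_sum_Bp[OF la(1)] linear_sum_Bp[OF la(2)])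
  have g: "m y (q (grad a y)) (q z) = dd a y (q z)"
    by (simp add: m_q(1)[OF assms, symmetric] m_grad[OF assms a_diff[OF assms]])
  have sq: "(\<Sum>c\<in>Bq. riemann G y c (p v) (q z) \<bullet> c) =
     (hess b y (q z) (p v) - real (card Bq) * hess b y (q z) (p v)) / 2
     + (real (card Bq) * (dd a y (q z) * dd b y (p v)) - dd a y (q z) * dd b y (p v)) / 4"
    by (simp add: 2 sum.distrib sum_subtractf sum_divide_distrib[symmetric] sum_distrib_right[symmetric]
        linear_sum_Bq[OF lm] m_dd_grad[OF assms b_smooth] g)
  show ?thesis
    unfolding ricci_def sum_Basis_split sp sq by (simp add: field_simps)
qed

end

section \<open>Leaves\<close>

text \<open>The sum over \<open>j\<close> reassembles the vector dual to \<open>i\<close>, and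
  pairing that vector with \<open>i\<close> gives 1.\<close>

lemma sum_inverse_comp:
  fixes B :: "'e::euclidean_space \<Rightarrow> 'e \<Rightarrow> real"
  assumes B: "inner_product B"
  shows "(\<Sum>i\<in>Basis. \<Sum>j\<in>Basis. inverse_comp B i j * B i j) = real DIM('e)"
proof -
  have bl: "bilinear B" and c: "B v w = B w v" for v w using B by (auto simp: inner_product_def)
  have l: "linear (\<lambda>z. z \<bullet> i)" for i :: 'e
    using bounded_linear_inner_left bounded_linear.linear by blast
  have "(\<Sum>j\<in>Basis. inverse_comp B i j * B i j) = 1" if "i \<in> Basis" for i
  proof -
    have "(\<Sum>j\<in>Basis. inverse_comp B i j * B i j) = B i (raise B (\<lambda>z. z \<bullet> i))"
      unfolding inverse_comp_def
      by (subst (2) linear_eq_sum_Basis[OF bilinear_linear_right[OF bl]]) simp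
    also have "\<dots> = B (raise B (\<lambda>z. z \<bullet> i)) i" by (rule c)
    also have "\<dots> = i \<bullet> i" by (rule raise_eq[OF B l])
    finally show ?thesis using that by simp
  qed
  then show ?thesis by simp
qed

definition tractor_condition_at ::
  "('e::euclidean_space \<Rightarrow> 'e \<Rightarrow> 'e \<Rightarrow> real) \<Rightarrow> ('d::euclidean_space \<Rightarrow> 'e) \<Rightarrow> 'd \<Rightarrow> 'd \<Rightarrow> bool" where
  "tractor_condition_at G u x v \<longleftrightarrow> normal_proj G u x
     (raise (G (u x)) (schouten G (u x) (dd u x v)) - cov_along G u (mean_curvature G u) x v) = 0"

text \<open>Only the tangent spaces of \<open>u\<close> are prescribed, so that the chart on the
  leaf may be unrelated to the ambient one. The second family is the instance with \<open>p\<close>,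
  \<open>q\<close> and \<open>a\<close>, \<open>b\<close> exchanged.\<close>

locale leaf = twisted_metric p q S m a b G
  for p q :: "'a::euclidean_space \<Rightarrow> 'a" and S m a b G +
  fixes U :: "'f::euclidean_space set" and u :: "'f \<Rightarrow> 'a"
  assumes open_U: "open U" and u_in: "x \<in> U \<Longrightarrow> u x \<in> S" and u_smooth: "smooth_on U u"
    and u_range: "x \<in> U \<Longrightarrow> range (dd u x) = range p" and u_inj: "x \<in> U \<Longrightarrow> inj (dd u x)"
begin

lemma u_diff: "x \<in> U \<Longrightarrow> u differentiable (at x)"
  using u_smooth smooth_on_imp_differentiable by blast

lemma p_dd_u: "x \<in> U \<Longrightarrow> p (dd u x v) = dd u x v"
proof -
  assume "x \<in> U"
  then have "dd u x v \<in> range p" using u_range by blast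
  then obtain w where "dd u x v = p w" by blast
  then show ?thesis by simp
qed

lemma q_dd_u: "x \<in> U \<Longrightarrow> q (dd u x v) = 0"
  using p_dd_u[of x v] qp[of "dd u x v"] by simp

lemma normal_proj_leaf:
  assumes x: "x \<in> U"
  shows "normal_proj G u x w = q w"
proof -
  note y = u_in[OF x]
  note bm = metric_on_bilinear[OF m y]
  show ?thesis unfolding normal_proj_def
  proof (rule the_equality)
    have "w - q w = p w" using pq_add[of w] by (simp add: algebra_simps)
    then have "w - q w \<in> range (dd u x)" using u_range[OF x] by auto
    moreover have "G (u x) (q w) (dd u x v) = 0" for v
      by (subst p_dd_u[OF x, symmetric]) (simp add: G_eq[OF y] m_zero[OF y])
    ultimately show "w - q w \<in> range (dd u x) \<and> (\<forall>v. G (u x) (q w) (dd u x v) = 0)" by simp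
  next
    fix n assume n: "w - n \<in> range (dd u x) \<and> (\<forall>v. G (u x) n (dd u x v) = 0)"
    then obtain z where z: "w - n = p z" using u_range[OF x] by auto
    from arg_cong[OF z, of q] have "q n = q w" by (simp add: q_simps)
    moreover have "p n = 0"
    proof (rule eq_0_if_m_eq_0[OF y])
      fix z
      have "p z \<in> range (dd u x)" using u_range[OF x] by simp
      then have "G (u x) n (p z) = 0" using n by auto
      then have "exp (a (u x)) * m (u x) (p n) (p z) = 0"
        by (simp add: G_eq[OF y] m_zero[OF y])
      then show "m (u x) (p n) z = 0" by (simp add: m_p(2)[OF y, of n z])
    qed
    ultimately show "n = q w" using pq_add[of n] by simp
  qed
qed

lemma inner_product_induced:
  assumes x: "x \<in> U"
  shows "inner_product (induced_metric G u x)"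
proof -
  note y = u_in[OF x]
  note bG = metric_on_bilinear[OF G_metric y]
  note l = dd_linear[OF u_diff[OF x]]
  have "bilinear (induced_metric G u x)"
    unfolding bilinear_def induced_metric_def
    by (auto intro!: linearI simp: linear_add[OF l] linear_cmul[OF l] bilinear_ladd[OF bG]
        bilinear_radd[OF bG] bilinear_lmul[OF bG] bilinear_rmul[OF bG])
  moreover have "induced_metric G u x v v > 0" if "v \<noteq> 0" for v
  proof -
    have "dd u x v \<noteq> 0" using that injD[OF u_inj[OF x], of v 0] linear_0[OF l] by auto
    then show ?thesis
      using metric_on_inner_product[OF G_metric y] by (simp add: induced_metric_def inner_product_def)
  qed
  ultimately show ?thesis
    using metric_on_commute[OF G_metric y] by (simp add: inner_product_def induced_metric_def)
qed

text \<open>Minus half the normal part of the \<open>G\<close>-gradient of \<open>a\<close>. As a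
  vector field on all of \<open>S\<close> it can be differentiated along \<open>u\<close> by the
  chain rule.\<close>

definition leaf_mean_curvature :: "'a \<Rightarrow> 'a" where
  "leaf_mean_curvature y = (- (1/2) * exp (- b y)) *\<^sub>R q (grad a y)"

lemma q_leaf_mean_curvature [simp]: "q (leaf_mean_curvature y) = leaf_mean_curvature y"
  by (simp add: leaf_mean_curvature_def q_simps)

lemma second_ff_leaf:
  assumes x: "x \<in> U"
  shows "second_ff G u x v w = induced_metric G u x v w *\<^sub>R leaf_mean_curvature (u x)"
proof -
  note y = u_in[OF x]
  have s: "smooth_on U (\<lambda>y. dd u y w)" by (rule smooth_on_dd[OF u_smooth])
  \<comment> \<open>The tangent spaces are the fixed subspace \<open>range p\<close>, so derivatives
    of tangent vectors have no \<open>q\<close>-part.\<close>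
  have "q (dd (\<lambda>y. dd u y w) x v) = dd (\<lambda>y. q (dd u y w)) x v"
  proof -
    have "((\<lambda>y. q (dd u y w)) has_derivative (\<lambda>z. q (dd (\<lambda>y. dd u y w) x z))) (at x)"
      by (rule bounded_linear.has_derivative[OF _ smooth_on_has_derivative[OF s x]])
        (rule linear_conv_bounded_linear[THEN iffD1, OF q_lin])
    then show ?thesis by (simp add: dd_eq)
  qed
  also have "\<dots> = 0"
    using dd_cong_open[OF open_U x, of "\<lambda>y. q (dd u y w)" "\<lambda>_. 0"] q_dd_u by simp
  finally have 1: "q (dd (\<lambda>y. dd u y w) x v) = 0" .
  from q_christoffel_G_p[OF y, of "dd u x v" "dd u x w"] have 2: "q (christoffel G (u x) (dd u x v) (dd u x w))
     = (- (1/2) * (exp (a (u x) - b (u x)) * m (u x) (dd u x v) (dd u x w))) *\<^sub>R q (grad a (u x))"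
    by (simp add: p_dd_u[OF x] q_dd_u[OF x])
  have 3: "induced_metric G u x v w = exp (a (u x)) * m (u x) (dd u x v) (dd u x w)"
    by (simp add: induced_metric_def G_eq[OF y] p_dd_u[OF x] q_dd_u[OF x] m_zero[OF y])
  show ?thesis
    unfolding second_ff_def normal_proj_leaf[OF x] cov_along_def
    by (simp add: q_simps 1 2 3 leaf_mean_curvature_def exp_diff exp_minus field_simps)
qed

lemma mean_curvature_leaf:
  assumes x: "x \<in> U"
  shows "mean_curvature G u x = leaf_mean_curvature (u x)"
proof -
  have "mean_curvature G u x = (1 / real DIM('f)) *\<^sub>R
     ((\<Sum>i\<in>Basis. \<Sum>j\<in>Basis. inverse_comp (induced_metric G u x) i j * induced_metric G u x i j) *\<^sub>R leaf_mean_curvature (u x))"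
    by (simp add: mean_curvature_def second_ff_leaf[OF x] scaleR_sum_left)
  then show ?thesis by (simp add: sum_inverse_comp[OF inner_product_induced[OF x]])
qed

lemma tracefree_leaf: "x \<in> U \<Longrightarrow> tracefree_ff G u x v w = 0"
  by (simp add: tracefree_ff_def second_ff_leaf mean_curvature_leaf)

lemma leaf_mean_curvature_has_derivative:
  assumes y: "y \<in> S"
  shows "(leaf_mean_curvature has_derivative (\<lambda>h. (- (1/2) * exp (- b y)) *\<^sub>R q (dd (grad a) y h) +
     ((1/2) * exp (- b y) * dd b y h) *\<^sub>R q (grad a y))) (at y)"
proof -
  have gd: "grad a differentiable (at y)"
    by (rule differentiableI[OF grad_has_derivative[OF y a_smooth]])
  have 1: "((\<lambda>y. q (grad a y)) has_derivative (\<lambda>h. q (dd (grad a) y h))) (at y)"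
    by (rule bounded_linear.has_derivative[OF linear_conv_bounded_linear[THEN iffD1, OF q_lin] dd_works[OF gd]])
  have 2: "((\<lambda>y. - (1/2) * exp (- b y)) has_derivative (\<lambda>h. (1/2) * exp (- b y) * dd b y h)) (at y)"
    using has_derivative_mult_right[OF has_derivative_exp[OF has_derivative_minus[OF dd_works[OF b_diff[OF y]]]], of "- (1/2)"]
    by (simp add: mult.commute)
  show ?thesis unfolding leaf_mean_curvature_def[abs_def] by (rule has_derivative_scaleR[OF 2 1])
qed

text \<open>The derivative of \<open>exp (- b)\<close> contributes the coefficient 1/2 and the
  normal part of the Christoffel term -1/4, both times the same vector. The tangential part of that
  term is removed by \<open>q\<close>.\<close>

lemma cov_along_mean_curvature:
  assumes x: "x \<in> U"
  shows "q (cov_along G u (mean_curvature G u) x v) = (- (1/2) * exp (- b (u x))) *\<^sub>R q (dd (grad a) (u x) (dd u x v)) +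
     ((1/4) * exp (- b (u x)) * dd b (u x) (dd u x v)) *\<^sub>R q (grad a (u x))"
proof -
  note y = u_in[OF x]
  have "dd (mean_curvature G u) x = dd (\<lambda>x. leaf_mean_curvature (u x)) x"
    by (rule dd_cong_open[OF open_U x mean_curvature_leaf])
  also have "\<dots> = (\<lambda>v. (- (1/2) * exp (- b (u x))) *\<^sub>R q (dd (grad a) (u x) (dd u x v)) +
     ((1/2) * exp (- b (u x)) * dd b (u x) (dd u x v)) *\<^sub>R q (grad a (u x)))"
    by (rule dd_eq[OF has_derivative_compose[OF dd_works[OF u_diff[OF x]] leaf_mean_curvature_has_derivative[OF y]]])
  finally have 1: "dd (mean_curvature G u) x v = (- (1/2) * exp (- b (u x))) *\<^sub>R q (dd (grad a) (u x) (dd u x v)) +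
     ((1/2) * exp (- b (u x)) * dd b (u x) (dd u x v)) *\<^sub>R q (grad a (u x))" by simp
  have "christoffel G (u x) (p (dd u x v)) (q (leaf_mean_curvature (u x)))
     = (1/2) *\<^sub>R (dd a (u x) (q (leaf_mean_curvature (u x))) *\<^sub>R p (dd u x v) + dd b (u x) (p (dd u x v)) *\<^sub>R q (leaf_mean_curvature (u x)))"
    by (rule christoffel_G_mixed[OF y])
  then have 2: "christoffel G (u x) (dd u x v) (leaf_mean_curvature (u x))
     = (1/2) *\<^sub>R (dd a (u x) (leaf_mean_curvature (u x)) *\<^sub>R dd u x v + dd b (u x) (dd u x v) *\<^sub>R leaf_mean_curvature (u x))"
    by (simp add: p_dd_u[OF x])
  have 3: "(1/2) *\<^sub>R dd b (u x) (dd u x v) *\<^sub>R leaf_mean_curvature (u x) = (- (1/4) * exp (- b (u x)) * dd b (u x) (dd u x v)) *\<^sub>R q (grad a (u x))"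
    by (simp add: leaf_mean_curvature_def)
  have "q (cov_along G u (mean_curvature G u) x v) = (- (1/2) * exp (- b (u x))) *\<^sub>R q (dd (grad a) (u x) (dd u x v)) +
     ((1/2) * exp (- b (u x)) * dd b (u x) (dd u x v)) *\<^sub>R q (grad a (u x))
     + (1/2) *\<^sub>R dd b (u x) (dd u x v) *\<^sub>R leaf_mean_curvature (u x)"
    unfolding cov_along_def mean_curvature_leaf[OF x] 1 2
    by (simp add: q_simps q_dd_u[OF x])
  also have "\<dots> = (- (1/2) * exp (- b (u x))) *\<^sub>R q (dd (grad a) (u x) (dd u x v)) +
     ((1/4) * exp (- b (u x)) * dd b (u x) (dd u x v)) *\<^sub>R q (grad a (u x))"
    unfolding 3 add.assoc scaleR_add_left[symmetric] by (simp add: algebra_simps)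
  finally show ?thesis .
qed

text \<open>The terms \<open>da(z) db(X)\<close> of the Schouten tensor and of the derivative of the mean curvature
  cancel. What remains is a multiple of the mixed second derivative of \<open>a - b\<close>, in which a common
  conformal factor drops out.\<close>

theorem distinguished_leaf_iff:
  assumes x: "x \<in> U" and card: "card Bp \<ge> 1" "card Bq \<ge> 2"
  shows "tractor_condition_at G u x v
    \<longleftrightarrow> (\<forall>z. hess a (u x) (q z) (dd u x v) = hess b (u x) (q z) (dd u x v))"
proof -
  define y where "y = u x"
  have y: "y \<in> S" using u_in[OF x] by (simp add: y_def)
  note bG = metric_on_bilinear[OF G_metric y] and bm = metric_on_bilinear[OF m y]
  define X where "X = dd u x v"
  have pX: "p X = X" by (simp add: X_def p_dd_u[OF x])
  define P where "P = raise (G y) (schouten G y X)"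
  define H where "H = cov_along G u (mean_curvature G u) x v"
  define E where "E = q (P - H)"
  have n: "real DIM('a) - 2 > 0" using card_Bp_Bq card by simp
  have GX: "G y X (q z) = 0" for z
    by (subst pX[symmetric]) (simp add: G_eq[OF y] m_zero[OF y])
  have Gq: "G y (q w) (q z) = G y w (q z)" for w z
    by (simp add: G_eq[OF y] m_zero[OF y])
  have Gm: "G y (q w) (q z) = exp (b y) * m y (q w) (q z)" for w z
    by (simp add: G_eq[OF y] m_zero[OF y])
  have h: "m y (q (dd (grad a) y X)) (q z) = hess a y (q z) X" for z
    using m_dd_grad[OF y a_smooth, of X z] by (simp add: pX)
  have g: "m y (q (grad a y)) (q z) = dd a y (q z)" for z
    by (simp add: m_q(1)[OF y, symmetric] m_grad[OF y a_diff[OF y]])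
  have E: "(real DIM('a) - 2) * G y E (q z) = (real (card Bq) - 1) / 2 * (hess a y (q z) X - hess b y (q z) X)" for z
  proof -
    \<comment> \<open>Tangent and normal vectors are orthogonal for \<open>G\<close>, so the scalar
      curvature drops out of the mixed Schouten tensor.\<close>
    have "(real DIM('a) - 2) * G y P (q z) = ricci G y X (q z)"
      unfolding P_def raise_schouten[OF G_metric y] schouten_def GX using n by simp
    also have "\<dots> = (real (card Bp) - 1) * (dd a y (q z) * dd b y X / 4 - hess a y (q z) X / 2)
    + (real (card Bq) - 1) * (dd a y (q z) * dd b y X / 4 - hess b y (q z) X / 2)"
      using ricci_mixed[OF y, of X z] by (simp add: pX)
    finally have 1: "(real DIM('a) - 2) * G y P (q z) = (real (card Bp) - 1) * (dd a y (q z) * dd b y X / 4 - hess a y (q z) X / 2)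
    + (real (card Bq) - 1) * (dd a y (q z) * dd b y X / 4 - hess b y (q z) X / 2)" .
    have qH: "q H = (- (1/2) * exp (- b y)) *\<^sub>R q (dd (grad a) y X) + ((1/4) * exp (- b y) * dd b y X) *\<^sub>R q (grad a y)"
      unfolding H_def X_def y_def by (rule cov_along_mean_curvature[OF x])
    have "G y H (q z) = exp (b y) * m y (q H) (q z)" by (rule trans[OF Gq[symmetric] Gm])
    also have "\<dots> = exp (b y) * (- (1/2) * exp (- b y) * hess a y (q z) X + (1/4) * exp (- b y) * dd b y X * dd a y (q z))"
      unfolding qH bilinear_ladd[OF bm] bilinear_lmul[OF bm] h g by simp
    also have "\<dots> = dd a y (q z) * dd b y X / 4 - hess a y (q z) X / 2"
      by (simp add: exp_minus field_simps)
    finally have 2: "G y H (q z) = dd a y (q z) * dd b y X / 4 - hess a y (q z) X / 2" .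
    have "(real DIM('a) - 2) * G y E (q z) = (real DIM('a) - 2) * G y P (q z) - (real DIM('a) - 2) * G y H (q z)"
      by (simp add: E_def Gq bilinear_lsub[OF bG] right_diff_distrib)
    \<comment> \<open>Here \<open>n - 2\<close> is the sum of \<open>card Bp - 1\<close> and
      \<open>card Bq - 1\<close>, so the derivative of the mean curvature cancels the whole first
      part of the Ricci tensor and, in the second part, leaves \<open>a\<close> against
      \<open>b\<close>.\<close>
    also have "\<dots> = (real (card Bq) - 1) / 2 * (hess a y (q z) X - hess b y (q z) X)"
      unfolding 1 2 unfolding card_Bp_Bq[symmetric] by (simp add: field_simps)
    finally show ?thesis .
  qed
  have "E = 0 \<longleftrightarrow> (\<forall>z. G y E (q z) = 0)"
  proof
    assume *: "\<forall>z. G y E (q z) = 0"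
    show "E = 0"
    proof (rule eq_0_if_m_eq_0[OF y])
      fix z
      have "exp (b y) * m y (q (P - H)) (q z) = 0" using * by (simp add: E_def flip: Gm)
      then show "m y E z = 0" by (simp add: E_def m_q(2)[OF y, of "P - H" z])
    qed
  qed (simp add: bilinear_lzero[OF bG])
  also have "\<dots> \<longleftrightarrow> (\<forall>z. hess a y (q z) X = hess b y (q z) X)"
  proof -
    have "G y E (q z) = 0 \<longleftrightarrow> hess a y (q z) X = hess b y (q z) X" for z
    proof -
      have "G y E (q z) = 0 \<longleftrightarrow> (real DIM('a) - 2) * G y E (q z) = 0" using n by simp
      then show ?thesis unfolding E using card(2) by simp
    qed
    then show ?thesis by simp
  qed
  finally show ?thesis
    unfolding tractor_condition_at_def normal_proj_leaf[OF x] E_def P_def H_def X_def y_def .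
qed

end

text \<open>\<open>F\<close> will be \<open>ln f\<close> for the leaves
  \<open>M1 \<times> {p2}\<close> and \<open>- ln f\<close> for the other family, while
  \<open>a\<close> absorbs the conformal factor. Directions tangent to the leaf become arbitrary
  vectors \<open>p v\<close>, which frees the condition from the parametrisation.\<close>

lemma (in leaf) distinguished_leaf_iff_mixed:
  assumes x: "x \<in> U" and card: "card Bp \<ge> 1" "card Bq \<ge> 2"
    and b: "b = (\<lambda>y. a y + F y)" and F: "smooth_on S F"
  shows "(\<forall>v. tractor_condition_at G u x v)
    \<longleftrightarrow> (\<forall>v w. dd (\<lambda>y. dd F y (q w)) (u x) (p v) = 0)"
proof -
  note y = u_in[OF x]
  have *: "hess b (u x) w z = hess a (u x) w z + dd (\<lambda>y. dd F y w) (u x) z" for w z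
  proof -
    have "hess b (u x) w z = dd (\<lambda>y. dd a y w + dd F y w) (u x) z"
    proof (rule fun_cong[OF dd_cong_open[OF open_S y]])
      fix x assume x: "x \<in> S"
      have "dd b x = (\<lambda>w. dd a x w + dd F x w)"
        unfolding b by (intro dd_eq has_derivative_add dd_works a_diff[OF x] smooth_on_imp_differentiable[OF F x])
      then show "dd b x w = dd a x w + dd F x w" by simp
    qed
    also have "dd (\<lambda>y. dd a y w + dd F y w) (u x) = (\<lambda>z. hess a (u x) w z + dd (\<lambda>y. dd F y w) (u x) z)"
      by (intro dd_eq has_derivative_add dd_works dd_a_diff[OF y] smooth_on_imp_differentiable[OF smooth_on_dd[OF F] y])
    finally show ?thesis .
  qed
  have "(\<forall>v. \<forall>w. dd (\<lambda>y. dd F y (q w)) (u x) (dd u x v) = 0) \<longleftrightarrow> (\<forall>v w. dd (\<lambda>y. dd F y (q w)) (u x) (p v) = 0)"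
  proof (intro iffI allI)
    fix v w assume "\<forall>v w. dd (\<lambda>y. dd F y (q w)) (u x) (dd u x v) = 0"
    moreover have "p v \<in> range (dd u x)" using u_range[OF x] by simp
    ultimately show "dd (\<lambda>y. dd F y (q w)) (u x) (p v) = 0" by auto
  next
    fix v w assume "\<forall>v w. dd (\<lambda>y. dd F y (q w)) (u x) (p v) = 0"
    then show "dd (\<lambda>y. dd F y (q w)) (u x) (dd u x v) = 0"
      using p_dd_u[OF x, of v] by metis
  qed
  then show ?thesis
    unfolding distinguished_leaf_iff[OF x card] * by simp
qed

text \<open>In the applications \<open>\<phi>\<close> is the transition from the chart of the leaf
  to the corresponding component of a product chart, \<open>l\<close> inserts that factor and
  \<open>k\<close> is the fixed coordinate in the other factor.\<close>

lemma (in twisted_metric) leafI: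
  fixes l :: "'f::euclidean_space \<Rightarrow> 'a" and \<phi> :: "'f \<Rightarrow> 'f"
  assumes l: "linear l" "inj l" "range l = range p" and U: "open U" "\<And>x. x \<in> U \<Longrightarrow> l (\<phi> x) + k \<in> S"
    and \<phi>: "smooth_on U \<phi>" "\<And>x. x \<in> U \<Longrightarrow> bij (dd \<phi> x)"
  shows "leaf p q S m a b G U (\<lambda>x. l (\<phi> x) + k)"
proof -
  have bl: "bounded_linear l" using l(1) by (simp add: linear_conv_bounded_linear)
  have d: "dd (\<lambda>x. l (\<phi> x) + k) x = (\<lambda>v. l (dd \<phi> x v))" if "x \<in> U" for x
  proof -
    have "((\<lambda>x. l (\<phi> x) + k) has_derivative (\<lambda>v. l (dd \<phi> x v) + 0)) (at x)"
      by (intro has_derivative_add bounded_linear.has_derivative[OF bl] smooth_on_has_derivative[OF \<phi>(1) that] has_derivative_const)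
    then show ?thesis by (simp add: dd_eq)
  qed
  show ?thesis
  proof (intro leaf.intro leaf_axioms.intro twisted_metric_axioms)
    show "smooth_on U (\<lambda>x. l (\<phi> x) + k)"
      by (rule smooth_on_add[OF U(1) smooth_on_bounded_linear[OF U(1) bl \<phi>(1)] smooth_on_const])
    fix x assume x: "x \<in> U"
    have "range (\<lambda>v. l (dd \<phi> x v)) = l ` range (dd \<phi> x)" by (simp add: image_image)
    then show "range (dd (\<lambda>x. l (\<phi> x) + k) x) = range p"
      using \<phi>(2)[OF x] l(3) by (simp add: d[OF x] bij_def)
    show "inj (dd (\<lambda>x. l (\<phi> x) + k) x)"
      unfolding d[OF x] using inj_compose[OF l(2), of "dd \<phi> x"] \<phi>(2)[OF x] by (simp add: bij_def o_def)
  qed (use U in auto)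
qed

section \<open>Charts\<close>

abbreviation img :: "('a, 'e) chart \<Rightarrow> 'e set" where
  "img c \<equiv> snd c ` fst c"

lemma is_chart_inj: "is_chart X c \<Longrightarrow> inj_on (snd c) (fst c)"
  unfolding is_chart_def using homeomorphic_map_def
  by (metis homeomorphic_imp_injective_map openin_subset topspace_subtopology_subset)

lemma is_chart_subset: "is_chart X c \<Longrightarrow> fst c \<subseteq> topspace X"
  unfolding is_chart_def by (meson openin_subset)

lemma open_img: "is_chart X c \<Longrightarrow> open (img c)"
  by (simp add: is_chart_def)

lemma chart_inv_left: "is_chart X c \<Longrightarrow> p \<in> fst c \<Longrightarrow> chart_inv c (snd c p) = p"
  unfolding chart_inv_def by (rule inv_into_f_f[OF is_chart_inj])

lemma chart_inv_right: "x \<in> img c \<Longrightarrow> snd c (chart_inv c x) = x"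
  unfolding chart_inv_def by (rule f_inv_into_f)

lemma chart_inv_in: "x \<in> img c \<Longrightarrow> chart_inv c x \<in> fst c"
  unfolding chart_inv_def by (rule inv_into_into)

lemma open_chart_image:
  assumes "is_chart X c" "openin X W"
  shows "open (snd c ` (fst c \<inter> W))"
proof -
  have o: "open_map (subtopology X (fst c)) (top_of_set (img c)) (snd c)"
    using assms(1) homeomorphic_imp_open_map by (auto simp: is_chart_def)
  have "openin (subtopology X (fst c)) (fst c \<inter> W)"
    using assms(2) by (simp add: openin_subtopology_Int2)
  then have "openin (top_of_set (img c)) (snd c ` (fst c \<inter> W))"
    using o by (simp add: open_map_def)
  then show ?thesis using open_img[OF assms(1)] openin_open_trans by blast
qed

lemma openin_chart_vimage:
  assumes "is_chart X c" "open V"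
  shows "openin X {p \<in> fst c. snd c p \<in> V}"
proof -
  have c: "continuous_map (subtopology X (fst c)) (top_of_set (img c)) (snd c)"
    using assms(1) homeomorphic_imp_continuous_map by (auto simp: is_chart_def)
  have "openin (top_of_set (img c)) (img c \<inter> V)"
    using assms(2) by (simp add: openin_open_Int)
  from openin_continuous_map_preimage[OF c this]
  have 1: "openin (subtopology X (fst c)) {p \<in> topspace (subtopology X (fst c)). snd c p \<in> img c \<inter> V}" .
  have 2: "topspace (subtopology X (fst c)) = fst c"
    using is_chart_subset[OF assms(1)] by (simp add: Int_absorb1)
  have 3: "{p \<in> fst c. snd c p \<in> img c \<inter> V} = {p \<in> fst c. snd c p \<in> V}" by blast
  have "openin X (fst c)" using assms(1) by (simp add: is_chart_def)
  from openin_trans_full[OF 1[unfolded 2 3] this] show ?thesis .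
qed

lemma manifold_is_chart: "smooth_manifold M \<Longrightarrow> c \<in> atlas M \<Longrightarrow> is_chart (mtop M) c"
  by (simp add: smooth_manifold_def)

lemma manifold_chart_at: "smooth_manifold M \<Longrightarrow> p \<in> points M \<Longrightarrow> \<exists>c\<in>atlas M. p \<in> fst c"
  unfolding smooth_manifold_def by blast

lemma chart_domain_open: "smooth_manifold M \<Longrightarrow> c \<in> atlas M \<Longrightarrow> openin (mtop M) (fst c)"
  by (simp add: smooth_manifold_def is_chart_def)

abbreviation trans_dom :: "('a, 'e) chart \<Rightarrow> ('a, 'e) chart \<Rightarrow> 'e set" where
  "trans_dom c d \<equiv> snd c ` (fst c \<inter> fst d)"

abbreviation transition :: "('a, 'e) chart \<Rightarrow> ('a, 'e) chart \<Rightarrow> 'e \<Rightarrow> 'e" where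
  "transition c d \<equiv> snd d \<circ> chart_inv c"

context
  fixes M :: "('a, 'e::euclidean_space) manifold" and c d
  assumes M: "smooth_manifold M" and c: "c \<in> atlas M" and d: "d \<in> atlas M"
begin

lemma open_trans_dom: "open (trans_dom c d)"
  by (rule open_chart_image[OF manifold_is_chart[OF M c] chart_domain_open[OF M d]])

lemma trans_smooth: "smooth_on (trans_dom c d) (transition c d)"
  using M c d by (simp add: smooth_manifold_def)

lemma trans_in: "x \<in> trans_dom c d \<Longrightarrow> transition c d x \<in> trans_dom d c"
  using chart_inv_left[OF manifold_is_chart[OF M c]] by auto

lemma trans_trans: "x \<in> trans_dom c d \<Longrightarrow> transition d c (transition c d x) = x"
  using chart_inv_left[OF manifold_is_chart[OF M c]] chart_inv_left[OF manifold_is_chart[OF M d]] by auto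

end

lemma dd_trans_left_inverse:
  assumes M: "smooth_manifold M" and c: "c \<in> atlas M" and d: "d \<in> atlas M" and x: "x \<in> trans_dom c d"
  shows "dd (transition d c) (transition c d x) (dd (transition c d) x v) = v"
proof -
  have 1: "(transition c d has_derivative dd (transition c d) x) (at x)"
    by (rule smooth_on_has_derivative[OF trans_smooth[OF M c d] x])
  have 2: "(transition d c has_derivative dd (transition d c) (transition c d x)) (at (transition c d x))"
    by (rule smooth_on_has_derivative[OF trans_smooth[OF M d c] trans_in[OF M c d x]])
  have "((\<lambda>x. transition d c (transition c d x)) has_derivative (\<lambda>v. dd (transition d c) (transition c d x) (dd (transition c d) x v))) (at x)"
    by (rule has_derivative_compose[OF 1 2])
  from has_derivative_transform_within_open[OF this open_trans_dom[OF M c d] x trans_trans[OF M c d]]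
  have "((\<lambda>x. x) has_derivative (\<lambda>v. dd (transition d c) (transition c d x) (dd (transition c d) x v))) (at x)" .
  from fun_cong[OF has_derivative_unique[OF this has_derivative_ident]] show ?thesis .
qed

lemma bij_dd_trans:
  assumes M: "smooth_manifold M" and c: "c \<in> atlas M" and d: "d \<in> atlas M" and x: "x \<in> trans_dom c d"
  shows "bij (dd (transition c d) x)"
proof (rule bijI)
  show i: "inj (dd (transition c d) x)"
    by (rule inj_on_inverseI[of _ "dd (transition d c) (transition c d x)"]) (rule dd_trans_left_inverse[OF assms])
  show "surj (dd (transition c d) x)"
    by (rule linear_inj_imp_surj[OF dd_linear[OF smooth_on_imp_differentiable[OF trans_smooth[OF M c d] x]] i])
qed

text \<open>Openness of the chart images is the form of the hypothesis that is established for the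
  product atlas in \<open>open_img_M\<close>.\<close>

lemma riemannian_metric_on:
  assumes M: "\<forall>c\<in>atlas M. open (img c)" and g: "riemannian_metric M g" and c: "c \<in> atlas M"
  shows "metric_on (img c) (local_metric g c)"
  unfolding metric_on_def inner_product_def local_metric_def
proof (intro conjI allI ballI)
  fix y assume "y \<in> img c"
  then have "chart_inv c y \<in> fst c" by (rule chart_inv_in)
  then show "bilinear (g c (chart_inv c y))" "\<And>v w. g c (chart_inv c y) v w = g c (chart_inv c y) w v"
    "\<And>v. v \<noteq> 0 \<longrightarrow> g c (chart_inv c y) v v > 0"
    using g c unfolding riemannian_metric_def by blast+
qed (use M g c in \<open>auto simp: riemannian_metric_def\<close>)

lemma riemannian_metric_scale:
  assumes M: "smooth_manifold M" and g: "riemannian_metric M g" and k: "smooth_fun M k" "\<forall>p\<in>points M. k p > 0"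
  shows "riemannian_metric M (\<lambda>c p v w. k p * g c p v w)"
  unfolding riemannian_metric_def
proof (intro conjI ballI allI)
  fix c v w assume c: "c \<in> atlas M"
  show "smooth_on (img c) (\<lambda>x. k (chart_inv c x) * g c (chart_inv c x) v w)"
    using k(1) g c by (intro smooth_on_mult open_img[OF manifold_is_chart[OF M c]])
      (auto simp: smooth_fun_def riemannian_metric_def o_def)
next
  fix c p assume c: "c \<in> atlas M" and p: "p \<in> fst c"
  have kp: "k p > 0" using k(2) is_chart_subset[OF manifold_is_chart[OF M c]] p by auto
  have bl: "bilinear (g c p)" and pos: "\<And>v. v \<noteq> 0 \<Longrightarrow> g c p v v > 0" and sym: "\<And>v w. g c p v w = g c p w v"
    using g c p unfolding riemannian_metric_def by blast+
  show "bilinear (\<lambda>v w. k p * g c p v w)"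
    by (auto intro!: linearI simp: bilinear_def bilinear_ladd[OF bl] bilinear_radd[OF bl] bilinear_lmul[OF bl]
        bilinear_rmul[OF bl] distrib_left)
  show "\<And>v w. k p * g c p v w = k p * g c p w v" using sym by simp
  show "v \<noteq> 0 \<longrightarrow> k p * g c p v v > 0" for v using kp pos by simp
next
  fix c d p v w assume "c \<in> atlas M" "d \<in> atlas M" "p \<in> fst c \<inter> fst d"
  then show "k p * g c p v w = k p * g d p (dd (transition c d) (snd c p) v) (dd (transition c d) (snd c p) w)"
    using g unfolding riemannian_metric_def by metis
qed

section \<open>Product charts\<close>

abbreviation pc :: "('a, 'd) chart \<Rightarrow> ('b, 'e) chart \<Rightarrow> ('a \<times> 'b, 'd \<times> 'e) chart" where
  "pc c d \<equiv> (fst c \<times> fst d, map_prod (snd c) (snd d))"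

text \<open>Here and in \<open>mtop_prod\<close> the name \<open>leaf_mean_curvature\<close> is just
  a variable for the second manifold; it has no relation to the vector field in the locale
  \<open>leaf\<close>.\<close>

lemma atlas_prod: "atlas (prod_manifold M leaf_mean_curvature) = {pc c d | c d. c \<in> atlas M \<and> d \<in> atlas leaf_mean_curvature}"
  by (simp add: prod_manifold_def)

lemma mtop_prod: "mtop (prod_manifold M leaf_mean_curvature) = prod_topology (mtop M) (mtop leaf_mean_curvature)"
  by (simp add: prod_manifold_def)

lemma img_pc: "img (pc c d) = img c \<times> img d"
  by (simp add: map_prod_surj_on)

lemma chart_inv_pc:
  assumes "is_chart X c" "is_chart Y d" "x \<in> img c" "y \<in> img d"
  shows "chart_inv (pc c d) (x, y) = (chart_inv c x, chart_inv d y)"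
  unfolding chart_inv_def[of "pc c d"]
proof (rule inv_into_f_eq)
  show "inj_on (snd (pc c d)) (fst (pc c d))"
    using map_prod_inj_on[OF is_chart_inj[OF assms(1)] is_chart_inj[OF assms(2)]] by simp
  show "(chart_inv c x, chart_inv d y) \<in> fst (pc c d)"
    using chart_inv_in[OF assms(3)] chart_inv_in[OF assms(4)] by simp
  show "snd (pc c d) (chart_inv c x, chart_inv d y) = (x, y)"
    using chart_inv_right[OF assms(3)] chart_inv_right[OF assms(4)] by simp
qed

abbreviation hor :: "'d \<times> 'e::zero \<Rightarrow> 'd \<times> 'e" where
  "hor \<equiv> \<lambda>v. (fst v, 0)"

abbreviation ver :: "'d::zero \<times> 'e \<Rightarrow> 'd \<times> 'e" where
  "ver \<equiv> \<lambda>v. (0, snd v)"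

lemma bounded_linear_fst_snd: "bounded_linear (\<lambda>v. (fst v, 0))" "bounded_linear (\<lambda>v. (0, snd v))"
  by (intro bounded_linear_Pair bounded_linear_fst bounded_linear_snd bounded_linear_zero)+

lemma coordinate_split_prod:
  "coordinate_split (\<lambda>v::'d::euclidean_space \<times> 'e::euclidean_space. (fst v, 0)) (\<lambda>v. (0, snd v))"
proof (rule coordinate_split.intro)
  fix b :: "'d \<times> 'e" assume "b \<in> Basis"
  then show "(fst b, 0) = b \<or> (fst b, 0) = 0" by (auto simp: Basis_prod_def zero_prod_def)
qed (auto simp: bounded_linear.linear[OF bounded_linear_fst_snd(1)] bounded_linear.linear[OF bounded_linear_fst_snd(2)] zero_prod_def)

interpretation prod_split: coordinate_split
  "\<lambda>v::'d::euclidean_space \<times> 'e::euclidean_space. (fst v, 0)" "\<lambda>v. (0, snd v)"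
  by (rule coordinate_split_prod)

lemma card_prod_Bp: "card (prod_split.Bp :: ('d::euclidean_space \<times> 'e::euclidean_space) set) = DIM('d)"
proof -
  have "(prod_split.Bp :: ('d \<times> 'e) set) = (\<lambda>b. (b, 0)) ` Basis"
    unfolding prod_split.Bp_def by (auto simp: Basis_prod_def)
  then show ?thesis by (simp add: card_image inj_on_def)
qed

lemma card_prod_Bq: "card (prod_split.Bq :: ('d::euclidean_space \<times> 'e::euclidean_space) set) = DIM('e)"
proof -
  have "(prod_split.Bq :: ('d \<times> 'e) set) = (\<lambda>b. (0, b)) ` Basis"
    unfolding prod_split.Bq_def by (auto simp: Basis_prod_def)
  then show ?thesis by (simp add: card_image inj_on_def)
qed

interpretation prod_split_swap: coordinate_split
  "\<lambda>v::'d::euclidean_space \<times> 'e::euclidean_space. (0, snd v)" "\<lambda>v. (fst v, 0)"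
  by (rule prod_split.split_swap)

lemma swap_Bp: "prod_split_swap.Bp = prod_split.Bq" and swap_Bq: "prod_split_swap.Bq = prod_split.Bp"
  by (simp_all add: prod_split_swap.Bp_def prod_split_swap.Bq_def prod_split.Bp_def prod_split.Bq_def)

lemma conformal_refl: "conformal M g g"
  unfolding conformal_def tensor_eq_def smooth_fun_def
  by (intro exI[of _ "\<lambda>_. 1"]) (simp add: o_def smooth_on_const)

lemma smooth_on_fst_compose:
  fixes F :: "'d::euclidean_space \<Rightarrow> real"
  assumes "open S" "open T" "smooth_on S F"
  shows "smooth_on (S \<times> (T::'e::euclidean_space set)) (\<lambda>z. F (fst z))"
  using smooth_on_affine_compose[OF assms(1) bounded_linear_fst open_Times[OF assms(1,2)], of 0 F] assms(3) by auto

lemma smooth_on_snd_compose: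
  fixes F :: "'e::euclidean_space \<Rightarrow> real"
  assumes "open S" "open T" "smooth_on T F"
  shows "smooth_on ((S::'d::euclidean_space set) \<times> T) (\<lambda>z. F (snd z))"
  using smooth_on_affine_compose[OF assms(2) bounded_linear_snd open_Times[OF assms(1,2)], of 0 F] assms(3) by auto

lemma riemannian_metric_transform:
  assumes "riemannian_metric M g" "c \<in> atlas M" "d \<in> atlas M" "p \<in> fst c" "p \<in> fst d"
  shows "g c p v w = g d p (dd (transition c d) (snd c p) v) (dd (transition c d) (snd c p) w)"
  using assms unfolding riemannian_metric_def by blast

lemma riemannian_metric_inner_product:
  "riemannian_metric M g \<Longrightarrow> c \<in> atlas M \<Longrightarrow> p \<in> fst c \<Longrightarrow> inner_product (g c p)"
  unfolding riemannian_metric_def inner_product_def by blast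

section \<open>The twisted product metric in product charts\<close>

locale twisted_setting =
  fixes M1 :: "('a, 'd::euclidean_space) manifold"
    and M2 :: "('b, 'e::euclidean_space) manifold"
    and g1 :: "('a, 'd) tensor2" and g2 :: "('b, 'e) tensor2" and f :: "'a \<times> 'b \<Rightarrow> real"
  assumes M1: "smooth_manifold M1" and M2: "smooth_manifold M2"
    and g1: "riemannian_metric M1 g1" and g2: "riemannian_metric M2 g2"
    and f_smooth: "smooth_fun (prod_manifold M1 M2) f"
    and f_pos: "\<And>x y. x \<in> points M1 \<Longrightarrow> y \<in> points M2 \<Longrightarrow> f (x, y) > 0"
begin

abbreviation "M \<equiv> prod_manifold M1 M2"
abbreviation "g \<equiv> twisted_product M1 M2 g1 f g2"

lemma is_chart1: "c \<in> atlas M1 \<Longrightarrow> is_chart (mtop M1) c" and is_chart2: "d \<in> atlas M2 \<Longrightarrow> is_chart (mtop M2) d"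
  using manifold_is_chart M1 M2 by blast+

lemma points1: "c \<in> atlas M1 \<Longrightarrow> x \<in> fst c \<Longrightarrow> x \<in> points M1" and points2: "d \<in> atlas M2 \<Longrightarrow> y \<in> fst d \<Longrightarrow> y \<in> points M2"
  using is_chart_subset[OF is_chart1] is_chart_subset[OF is_chart2] by blast+

lemma points_prod: "points M = points M1 \<times> points M2"
  by (simp add: mtop_prod)

lemma pc_in: "c \<in> atlas M1 \<Longrightarrow> d \<in> atlas M2 \<Longrightarrow> pc c d \<in> atlas M"
  unfolding atlas_prod by blast

lemma open_imgs: "c \<in> atlas M1 \<Longrightarrow> open (img c)" "d \<in> atlas M2 \<Longrightarrow> open (img d)"
  "c \<in> atlas M1 \<Longrightarrow> d \<in> atlas M2 \<Longrightarrow> open (img c \<times> img d)"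
  by (simp_all add: open_Times open_img[OF is_chart1] open_img[OF is_chart2])

lemma open_img_M: "\<forall>c\<in>atlas M. open (img c)"
proof
  fix C assume "C \<in> atlas M"
  then obtain c d where C: "C = pc c d" "c \<in> atlas M1" "d \<in> atlas M2" unfolding atlas_prod by blast
  show "open (img C)" unfolding C(1) img_pc by (rule open_imgs(3)[OF C(2,3)])
qed

lemma inv_pc: "c \<in> atlas M1 \<Longrightarrow> d \<in> atlas M2 \<Longrightarrow> z \<in> img c \<times> img d \<Longrightarrow>
    chart_inv (pc c d) z = (chart_inv c (fst z), chart_inv d (snd z))"
  using chart_inv_pc[OF is_chart1 is_chart2, of c d "fst z" "snd z"] by (simp add: mem_Times_iff)

text \<open>\<open>pullback\<close> evaluates \<open>h\<close> in a chart \<open>e\<close> of its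
  own choice. The derivative of the projection read in \<open>c\<close> and \<open>e\<close> is that
  of the transition map, and the transformation law of \<open>h\<close> leads back to
  \<open>c\<close>.\<close>

lemma pullback_fst:
  assumes c: "c \<in> atlas M1" and d: "d \<in> atlas M2" and P: "P \<in> fst c \<times> fst d" and h: "riemannian_metric M1 h"
  shows "pullback M1 fst h (pc c d) P v w = h c (fst P) (fst v) (fst w)"
proof -
  define e where "e = (SOME e. e \<in> atlas M1 \<and> fst P \<in> fst e)"
  have "e \<in> atlas M1 \<and> fst P \<in> fst e"
    unfolding e_def by (rule someI[of _ c]) (use c P in auto)
  then have e: "e \<in> atlas M1" "fst P \<in> fst e" by auto
  define W where "W = trans_dom c e \<times> img d"
  have W: "open W" unfolding W_def by (intro open_Times open_trans_dom[OF M1 c e(1)] open_imgs(2)[OF d])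
  define x where "x = snd c (fst P)"
  have x: "x \<in> trans_dom c e" using P e by (auto simp: x_def)
  have z: "(x, snd d (snd P)) \<in> W" using x P by (auto simp: W_def)
  have "dd (local_rep (pc c d) e fst) (x, snd d (snd P)) = dd (\<lambda>z. transition c e (fst z)) (x, snd d (snd P))"
  proof (rule dd_cong_open[OF W z])
    fix y assume "y \<in> W"
    then have "y \<in> img c \<times> img d" by (auto simp: W_def)
    then show "local_rep (pc c d) e fst y = transition c e (fst y)"
      by (simp add: local_rep_def inv_pc[OF c d])
  qed
  also have "\<dots> = (\<lambda>v. dd (transition c e) x (fst v))"
  proof (rule dd_eq)
    have 1: "(fst has_derivative fst) (at (x, snd d (snd P)))" by (rule has_derivative_fst) (rule has_derivative_ident)
    have 2: "(transition c e has_derivative dd (transition c e) x) (at (fst (x, snd d (snd P))))"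
      using smooth_on_has_derivative[OF trans_smooth[OF M1 c e(1)] x] by simp
    show "((\<lambda>z. transition c e (fst z)) has_derivative (\<lambda>v. dd (transition c e) x (fst v))) (at (x, snd d (snd P)))"
      by (rule has_derivative_compose[OF 1 2])
  qed
  finally have "pullback M1 fst h (pc c d) P v w = h e (fst P) (dd (transition c e) x (fst v)) (dd (transition c e) x (fst w))"
    by (simp add: pullback_def e_def[symmetric] x_def map_prod_def split_beta)
  also have "\<dots> = h c (fst P) (fst v) (fst w)"
    unfolding x_def by (rule riemannian_metric_transform[OF h c e(1) _ e(2), symmetric]) (use P in auto)
  finally show ?thesis .
qed

lemma pullback_snd:
  assumes c: "c \<in> atlas M1" and d: "d \<in> atlas M2" and P: "P \<in> fst c \<times> fst d" and h: "riemannian_metric M2 h"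
  shows "pullback M2 snd h (pc c d) P v w = h d (snd P) (snd v) (snd w)"
proof -
  define e where "e = (SOME e. e \<in> atlas M2 \<and> snd P \<in> fst e)"
  have "e \<in> atlas M2 \<and> snd P \<in> fst e"
    unfolding e_def by (rule someI[of _ d]) (use d P in auto)
  then have e: "e \<in> atlas M2" "snd P \<in> fst e" by auto
  define W where "W = img c \<times> trans_dom d e"
  have W: "open W" unfolding W_def by (intro open_Times open_trans_dom[OF M2 d e(1)] open_imgs(1)[OF c])
  define x where "x = snd d (snd P)"
  have x: "x \<in> trans_dom d e" using P e by (auto simp: x_def)
  have z: "(snd c (fst P), x) \<in> W" using x P by (auto simp: W_def)
  have "dd (local_rep (pc c d) e snd) (snd c (fst P), x) = dd (\<lambda>z. transition d e (snd z)) (snd c (fst P), x)"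
  proof (rule dd_cong_open[OF W z])
    fix y assume "y \<in> W"
    then have "y \<in> img c \<times> img d" by (auto simp: W_def)
    then show "local_rep (pc c d) e snd y = transition d e (snd y)"
      by (simp add: local_rep_def inv_pc[OF c d])
  qed
  also have "\<dots> = (\<lambda>v. dd (transition d e) x (snd v))"
  proof (rule dd_eq)
    have 1: "(snd has_derivative snd) (at (snd c (fst P), x))" by (rule has_derivative_snd) (rule has_derivative_ident)
    have 2: "(transition d e has_derivative dd (transition d e) x) (at (snd (snd c (fst P), x)))"
      using smooth_on_has_derivative[OF trans_smooth[OF M2 d e(1)] x] by simp
    show "((\<lambda>z. transition d e (snd z)) has_derivative (\<lambda>v. dd (transition d e) x (snd v))) (at (snd c (fst P), x))"
      by (rule has_derivative_compose[OF 1 2])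
  qed
  finally have "pullback M2 snd h (pc c d) P v w = h e (snd P) (dd (transition d e) x (snd v)) (dd (transition d e) x (snd w))"
    by (simp add: pullback_def e_def[symmetric] x_def map_prod_def split_beta)
  also have "\<dots> = h d (snd P) (snd v) (snd w)"
    unfolding x_def by (rule riemannian_metric_transform[OF h d e(1) _ e(2), symmetric]) (use P in auto)
  finally show ?thesis .
qed

lemma twisted_product_pc:
  assumes "c \<in> atlas M1" "d \<in> atlas M2" "P \<in> fst c \<times> fst d" "riemannian_metric M1 h1" "riemannian_metric M2 h2"
  shows "twisted_product M1 M2 h1 k h2 (pc c d) P v w
    = h1 c (fst P) (fst v) (fst w) + k P * h2 d (snd P) (snd v) (snd w)"
  unfolding twisted_product_def pullback_fst[OF assms(1-4)] pullback_snd[OF assms(1-3,5)] ..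

lemma smooth_f: "c \<in> atlas M1 \<Longrightarrow> d \<in> atlas M2 \<Longrightarrow> smooth_on (img c \<times> img d) (\<lambda>z. f (chart_inv (pc c d) z))"
  using f_smooth pc_in[of c d] unfolding smooth_fun_def o_def img_pc[of c d, symmetric] by blast

lemma dd_trans_pc:
  assumes c: "c \<in> atlas M1" "c' \<in> atlas M1" and d: "d \<in> atlas M2" "d' \<in> atlas M2"
    and P: "P \<in> fst (pc c d) \<inter> fst (pc c' d')"
  shows "dd (transition (pc c d) (pc c' d')) (snd (pc c d) P) v
    = (dd (transition c c') (snd c (fst P)) (fst v), dd (transition d d') (snd d (snd P)) (snd v))"
proof -
  define x y where "x = snd c (fst P)" and "y = snd d (snd P)"
  have xy: "x \<in> trans_dom c c'" "y \<in> trans_dom d d'" using P by (auto simp: x_def y_def)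
  define W where "W = trans_dom c c' \<times> trans_dom d d'"
  have W: "open W" unfolding W_def by (rule open_Times[OF open_trans_dom[OF M1 c] open_trans_dom[OF M2 d]])
  have "dd (transition (pc c d) (pc c' d')) (x, y) = dd (\<lambda>z. (transition c c' (fst z), transition d d' (snd z))) (x, y)"
  proof (rule dd_cong_open[OF W])
    show "(x, y) \<in> W" using xy by (simp add: W_def)
    fix z assume "z \<in> W"
    then have "z \<in> img c \<times> img d" by (auto simp: W_def)
    then show "transition (pc c d) (pc c' d') z = (transition c c' (fst z), transition d d' (snd z))"
      by (simp add: inv_pc[OF c(1) d(1)])
  qed
  also have "\<dots> = (\<lambda>v. (dd (transition c c') x (fst v), dd (transition d d') y (snd v)))"
  proof (rule dd_eq[OF has_derivative_Pair])
    have 1: "(fst has_derivative fst) (at (x, y))" "(snd has_derivative snd) (at (x, y))"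
      by (rule has_derivative_fst has_derivative_snd, rule has_derivative_ident)+
    have 2: "(transition c c' has_derivative dd (transition c c') x) (at (fst (x, y)))"
      "(transition d d' has_derivative dd (transition d d') y) (at (snd (x, y)))"
      using smooth_on_has_derivative[OF trans_smooth[OF M1 c] xy(1)]
        smooth_on_has_derivative[OF trans_smooth[OF M2 d] xy(2)] by simp_all
    show "((\<lambda>z. transition c c' (fst z)) has_derivative (\<lambda>v. dd (transition c c') x (fst v))) (at (x, y))"
      by (rule has_derivative_compose[OF 1(1) 2(1)])
    show "((\<lambda>z. transition d d' (snd z)) has_derivative (\<lambda>v. dd (transition d d') y (snd v))) (at (x, y))"
      by (rule has_derivative_compose[OF 1(2) 2(2)])
  qed
  finally show ?thesis by (simp add: x_def y_def map_prod_def split_beta)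
qed

lemma local_g:
  assumes "c \<in> atlas M1" "d \<in> atlas M2" "z \<in> img c \<times> img d"
  shows "g (pc c d) (chart_inv (pc c d) z) v w = local_metric g1 c (fst z) (fst v) (fst w)
    + f (chart_inv (pc c d) z) * local_metric g2 d (snd z) (snd v) (snd w)"
proof -
  have "chart_inv (pc c d) z \<in> fst c \<times> fst d"
    using assms chart_inv_in[of "fst z" c] chart_inv_in[of "snd z" d] by (auto simp: inv_pc)
  from twisted_product_pc[OF assms(1,2) this g1 g2] show ?thesis
    by (simp add: inv_pc[OF assms] local_metric_def)
qed

lemma local_metric_on1: "c \<in> atlas M1 \<Longrightarrow> metric_on (img c) (local_metric g1 c)"
  using riemannian_metric_on[OF _ g1] open_imgs(1) by blast

lemma local_metric_on2: "d \<in> atlas M2 \<Longrightarrow> metric_on (img d) (local_metric g2 d)"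
  using riemannian_metric_on[OF _ g2] open_imgs(2) by blast

lemma local_metrics_smooth:
  assumes "c \<in> atlas M1" "d \<in> atlas M2"
  shows "smooth_on (img c \<times> img d) (\<lambda>z. local_metric g1 c (fst z) v w)"
    "smooth_on (img c \<times> img d) (\<lambda>z. local_metric g2 d (snd z) v' w')"
  using smooth_on_fst_compose[OF open_imgs(1)[OF assms(1)] open_imgs(2)[OF assms(2)] metric_on_smooth[OF local_metric_on1[OF assms(1)]]]
    smooth_on_snd_compose[OF open_imgs(1)[OF assms(1)] open_imgs(2)[OF assms(2)] metric_on_smooth[OF local_metric_on2[OF assms(2)]]]
  by simp_all

lemma inner_product_sum:
  fixes A :: "'d \<Rightarrow> 'd \<Rightarrow> real" and B :: "'e \<Rightarrow> 'e \<Rightarrow> real"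
  assumes A: "inner_product A" and B: "inner_product B" and k: "k > 0"
  shows "inner_product (\<lambda>v w. A (fst v) (fst w) + k * B (snd v) (snd w))"
proof -
  have bA: "bilinear A" and bB: "bilinear B" using A B by (auto simp: inner_product_def)
  have "bilinear (\<lambda>v w. A (fst v) (fst w) + k * B (snd v) (snd w))"
    unfolding bilinear_def
    by (auto intro!: linearI simp: bilinear_ladd[OF bA] bilinear_radd[OF bA] bilinear_lmul[OF bA] bilinear_rmul[OF bA]
        bilinear_ladd[OF bB] bilinear_radd[OF bB] bilinear_lmul[OF bB] bilinear_rmul[OF bB] algebra_simps)
  moreover have "A (fst v) (fst v) + k * B (snd v) (snd v) > 0" if "v \<noteq> 0" for v
  proof -
    have nA: "A u u \<ge> 0" for u
      using A bilinear_lzero[OF bA] unfolding inner_product_def by (cases "u = 0") (auto intro: less_imp_le)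
    have nB: "B u u \<ge> 0" for u
      using B bilinear_lzero[OF bB] unfolding inner_product_def by (cases "u = 0") (auto intro: less_imp_le)
    have "fst v \<noteq> 0 \<or> snd v \<noteq> 0" using that by (cases v) (simp add: zero_prod_def)
    then consider "fst v \<noteq> 0" | "snd v \<noteq> 0" by blast
    then show ?thesis
    proof cases
      case 1
      then have "A (fst v) (fst v) > 0" using A by (simp add: inner_product_def)
      then show ?thesis using nB[of "snd v"] k by (simp add: add_pos_nonneg)
    next
      case 2
      then have "k * B (snd v) (snd v) > 0" using B k by (simp add: inner_product_def)
      then show ?thesis using nA[of "fst v"] by (simp add: add_nonneg_pos)
    qed
  qed
  moreover have "A v w = A w v" "B v' w' = B w' v'" for v w v' w' using A B by (auto simp: inner_product_def)
  ultimately show ?thesis by (simp add: inner_product_def)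
qed

text \<open>This makes \<open>g\<close> itself available as the witness in
  \<open>distinguished\<close>.\<close>

lemma riemannian_g: "riemannian_metric M g"
  unfolding riemannian_metric_def
proof (intro conjI ballI allI)
  fix C v w assume "C \<in> atlas M"
  then obtain c d where C: "C = pc c d" and c: "c \<in> atlas M1" and d: "d \<in> atlas M2" unfolding atlas_prod by blast
  have "smooth_on (img c \<times> img d) (\<lambda>z. local_metric g1 c (fst z) (fst v) (fst w)
      + f (chart_inv (pc c d) z) * local_metric g2 d (snd z) (snd v) (snd w))"
    by (intro smooth_on_add smooth_on_mult open_imgs(3) local_metrics_smooth smooth_f c d)
  then show "smooth_on (img C) (\<lambda>x. g C (chart_inv C x) v w)"
    unfolding C img_pc by (subst smooth_on_cong[OF open_imgs(3)[OF c d]]) (rule local_g[OF c d])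
next
  fix C P assume "C \<in> atlas M" and P: "P \<in> fst C"
  then obtain c d where C: "C = pc c d" and c: "c \<in> atlas M1" and d: "d \<in> atlas M2" unfolding atlas_prod by blast
  have P': "P \<in> fst c \<times> fst d" using P C by simp
  have i1: "inner_product (g1 c (fst P))" and i2: "inner_product (g2 d (snd P))"
    using P' by (auto intro: riemannian_metric_inner_product[OF g1 c] riemannian_metric_inner_product[OF g2 d])
  have "f P > 0" using f_pos[OF points1[OF c] points2[OF d], of "fst P" "snd P"] P' by auto
  then have "inner_product (\<lambda>v w. g1 c (fst P) (fst v) (fst w) + f P * g2 d (snd P) (snd v) (snd w))"
    by (rule inner_product_sum[OF i1 i2])
  then have "inner_product (g C P)"
    unfolding C twisted_product_pc[OF c d P' g1 g2, abs_def] .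
  then show "bilinear (g C P)" "\<And>v w. g C P v w = g C P w v" "\<And>v. v \<noteq> 0 \<longrightarrow> g C P v v > 0"
    by (auto simp: inner_product_def)
next
  fix C C' P and v w :: "'d \<times> 'e" assume "C \<in> atlas M" "C' \<in> atlas M" and P: "P \<in> fst C \<inter> fst C'"
  then obtain c d c' d' where C: "C = pc c d" "C' = pc c' d'" and c: "c \<in> atlas M1" "c' \<in> atlas M1"
    and d: "d \<in> atlas M2" "d' \<in> atlas M2" unfolding atlas_prod by blast
  have P': "P \<in> fst c \<times> fst d" "P \<in> fst c' \<times> fst d'" using P C by auto
  have "g1 c (fst P) (fst v) (fst w) = g1 c' (fst P) (dd (transition c c') (snd c (fst P)) (fst v)) (dd (transition c c') (snd c (fst P)) (fst w))"
    by (rule riemannian_metric_transform[OF g1 c]) (use P' in auto)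
  moreover have "g2 d (snd P) (snd v) (snd w) = g2 d' (snd P) (dd (transition d d') (snd d (snd P)) (snd v)) (dd (transition d d') (snd d (snd P)) (snd w))"
    by (rule riemannian_metric_transform[OF g2 d]) (use P' in auto)
  ultimately show "g C P v w = g C' P (dd (transition C C') (snd C P) v) (dd (transition C C') (snd C P) w)"
    using dd_trans_pc[OF c d P[unfolded C]]
    unfolding C twisted_product_pc[OF c(1) d(1) P'(1) g1 g2] twisted_product_pc[OF c(2) d(2) P'(2) g1 g2]
    by simp
qed

end

section \<open>Leaves of a twisted product manifold\<close>

text \<open>For the pairs of charts in which the leaf misses the ambient chart.\<close>

lemma smooth_on_empty: "smooth_on {} f"
proof -
  have "Ck_on k {} f" for k by (induction k arbitrary: f) auto
  then show ?thesis by (simp add: smooth_on_def)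
qed

context twisted_setting
begin

definition lnf :: "('a, 'd) chart \<Rightarrow> ('b, 'e) chart \<Rightarrow> 'd \<times> 'e \<Rightarrow> real" where
  "lnf c d z = ln (f (chart_inv (pc c d) z))"

definition msum :: "('a, 'd) chart \<Rightarrow> ('b, 'e) chart \<Rightarrow> 'd \<times> 'e \<Rightarrow> 'd \<times> 'e \<Rightarrow> 'd \<times> 'e \<Rightarrow> real" where
  "msum c d z v w = local_metric g1 c (fst z) (fst v) (fst w) + local_metric g2 d (snd z) (snd v) (snd w)"

lemma inv_pc_points:
  assumes "c \<in> atlas M1" "d \<in> atlas M2" "z \<in> img c \<times> img d"
  shows "fst (chart_inv (pc c d) z) \<in> points M1" "snd (chart_inv (pc c d) z) \<in> points M2"
    "chart_inv (pc c d) z \<in> fst c \<times> fst d"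
  using points1[OF assms(1) chart_inv_in[of "fst z" c]] points2[OF assms(2) chart_inv_in[of "snd z" d]]
    chart_inv_in[of "fst z" c] chart_inv_in[of "snd z" d] assms(3)
  by (simp_all add: inv_pc[OF assms] mem_Times_iff)

lemma f_inv_pos:
  assumes "c \<in> atlas M1" "d \<in> atlas M2" "z \<in> img c \<times> img d"
  shows "f (chart_inv (pc c d) z) > 0"
  using f_pos[OF inv_pc_points(1,2)[OF assms]] by simp

lemma lnf_smooth: "c \<in> atlas M1 \<Longrightarrow> d \<in> atlas M2 \<Longrightarrow> smooth_on (img c \<times> img d) (lnf c d)"
  unfolding lnf_def[abs_def] by (rule smooth_on_ln[OF open_imgs(3) f_inv_pos smooth_f])

lemma msum_metric:
  assumes c: "c \<in> atlas M1" and d: "d \<in> atlas M2"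
  shows "metric_on (img c \<times> img d) (msum c d)"
  unfolding metric_on_def
proof (intro conjI ballI allI)
  show "open (img c \<times> img d)" by (rule open_imgs(3)[OF c d])
  fix z assume "z \<in> img c \<times> img d"
  then have z: "fst z \<in> img c" "snd z \<in> img d" by auto
  show "inner_product (msum c d z)"
    using inner_product_sum[OF metric_on_inner_product[OF local_metric_on1[OF c] z(1)] metric_on_inner_product[OF local_metric_on2[OF d] z(2)], of 1]
    by (simp add: msum_def[abs_def])
next
  fix v w
  show "smooth_on (img c \<times> img d) (\<lambda>z. msum c d z v w)"
    unfolding msum_def by (rule smooth_on_add[OF open_imgs(3)[OF c d] local_metrics_smooth[OF c d]])
qed

text \<open>If \<open>h\<close> is \<open>\<Omega>\<close> times \<open>g\<close>, the exponents are
  \<open>ln \<Omega>\<close> and \<open>ln \<Omega> + ln f\<close>. Their difference does not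
  involve \<open>h\<close>, which is what makes the choice of metric in \<open>distinguished\<close>
  harmless.\<close>

lemma local_twisted:
  assumes h: "riemannian_metric M h" "conformal M h g" and c: "c \<in> atlas M1" and d: "d \<in> atlas M2"
  shows "\<exists>a. twisted_metric hor ver (img c \<times> img d) (msum c d) a
    (\<lambda>z. a z + lnf c d z) (local_metric h (pc c d))"
proof -
  obtain \<Omega> where \<Omega>: "smooth_fun M \<Omega>" "\<And>p. p \<in> points M \<Longrightarrow> \<Omega> p > 0"
    and eq: "tensor_eq M h (\<lambda>c p v w. \<Omega> p * g c p v w)"
    using h(2) unfolding conformal_def by blast
  define S where "S = img c \<times> img d"
  have S: "open S" unfolding S_def by (rule open_imgs(3)[OF c d])
  define a where "a z = ln (\<Omega> (chart_inv (pc c d) z))" for z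
  have \<Omega>pos: "\<Omega> (chart_inv (pc c d) z) > 0" if "z \<in> S" for z
    using inv_pc_points(1,2)[OF c d that[unfolded S_def]] by (intro \<Omega>(2)) (simp add: points_prod mem_Times_iff)
  have "smooth_on S (\<lambda>z. \<Omega> (chart_inv (pc c d) z))"
    using \<Omega>(1) pc_in[OF c d] unfolding smooth_fun_def o_def S_def img_pc[symmetric] by blast
  then have as: "smooth_on S a"
    unfolding a_def[abs_def] by (rule smooth_on_ln[OF S, rotated]) (rule \<Omega>pos)
  have z1: "local_metric g1 c (fst z) 0 v = 0" "local_metric g1 c (fst z) v 0 = 0" if "z \<in> S" for z v
    using that bilinear_lzero[OF metric_on_bilinear[OF local_metric_on1[OF c]], of "fst z" v]
      bilinear_rzero[OF metric_on_bilinear[OF local_metric_on1[OF c]], of "fst z" v] by (auto simp: S_def)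
  have z2: "local_metric g2 d (snd z) 0 v = 0" "local_metric g2 d (snd z) v 0 = 0" if "z \<in> S" for z v
    using that bilinear_lzero[OF metric_on_bilinear[OF local_metric_on2[OF d]], of "snd z" v]
      bilinear_rzero[OF metric_on_bilinear[OF local_metric_on2[OF d]], of "snd z" v] by (auto simp: S_def)
  have "twisted_metric hor ver S (msum c d) a (\<lambda>z. a z + lnf c d z) (local_metric h (pc c d))"
  proof (intro twisted_metric.intro twisted_metric_axioms.intro coordinate_split_prod)
    show "metric_on S (msum c d)" unfolding S_def by (rule msum_metric[OF c d])
    show "msum c d z (fst v, 0) (0, snd w) = 0" if "z \<in> S" for z v w
      by (simp add: msum_def z1[OF that] z2[OF that])
    show "shift_invariant S (\<lambda>v. (0, snd v)) (\<lambda>y. msum c d y (fst v, 0) (fst w, 0))" for v w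
      unfolding shift_invariant_def
    proof (intro allI impI)
      fix y z :: "'d \<times> 'e" assume y: "y \<in> S" "y + (0, snd z) \<in> S"
      show "msum c d (y + (0, snd z)) (fst v, 0) (fst w, 0) = msum c d y (fst v, 0) (fst w, 0)"
        using z2(1)[OF y(1), of 0] z2(1)[OF y(2), of 0] by (simp add: msum_def)
    qed
    show "shift_invariant S (\<lambda>v. (fst v, 0)) (\<lambda>y. msum c d y (0, snd v) (0, snd w))" for v w
      unfolding shift_invariant_def
    proof (intro allI impI)
      fix y z :: "'d \<times> 'e" assume y: "y \<in> S" "y + (fst z, 0) \<in> S"
      show "msum c d (y + (fst z, 0)) (0, snd v) (0, snd w) = msum c d y (0, snd v) (0, snd w)"
        using z1(1)[OF y(1), of 0] z1(1)[OF y(2), of 0] by (simp add: msum_def)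
    qed
    show "smooth_on S a" by (rule as)
    show "smooth_on S (\<lambda>z. a z + lnf c d z)"
      by (rule smooth_on_add[OF S as lnf_smooth[OF c d, folded S_def]])
    have "metric_on (img (pc c d)) (local_metric h (pc c d))"
      by (rule riemannian_metric_on[OF open_img_M h(1) pc_in[OF c d]])
    then show "metric_on S (local_metric h (pc c d))" unfolding img_pc S_def .
    fix z v w assume z: "z \<in> S"
    have P: "chart_inv (pc c d) z \<in> fst (pc c d)" using inv_pc_points(3)[OF c d] z by (simp add: S_def)
    have "local_metric h (pc c d) z v w = \<Omega> (chart_inv (pc c d) z) * g (pc c d) (chart_inv (pc c d) z) v w"
      using eq pc_in[OF c d] P unfolding tensor_eq_def local_metric_def by blast
    also have "\<dots> = \<Omega> (chart_inv (pc c d) z) * (local_metric g1 c (fst z) (fst v) (fst w)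
       + f (chart_inv (pc c d) z) * local_metric g2 d (snd z) (snd v) (snd w))"
      by (simp only: local_g[OF c d z[unfolded S_def]])
    also have "\<dots> = exp (a z) * msum c d z (fst v, 0) (fst w, 0) + exp (a z + lnf c d z) * msum c d z (0, snd v) (0, snd w)"
      using \<Omega>pos[OF z] f_inv_pos[OF c d z[unfolded S_def]]
      by (simp add: a_def lnf_def exp_add msum_def z1[OF z] z2[OF z] distrib_left)
    finally show "local_metric h (pc c d) z v w = exp (a z) * msum c d z (fst v, 0) (fst w, 0)
      + exp (a z + lnf c d z) * msum c d z (0, snd v) (0, snd w)" .
  qed
  then show ?thesis unfolding S_def by blast
qed

text \<open>Written as a sum to match the shape \<open>l (\<phi> x) + k\<close> of
  \<open>leafI\<close>.\<close>

lemma local_rep1: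
  fixes c c' :: "('a, 'd) chart" and d :: "('b, 'e) chart"
  assumes "p2 \<in> fst d"
  shows "local_dom c (pc c' d) (\<lambda>p. (p, p2)) = trans_dom c c'"
    "local_rep c (pc c' d) (\<lambda>p. (p, p2)) = (\<lambda>x. (transition c c' x, 0) + (0, snd d p2))"
  using assms by (auto simp: local_dom_def local_rep_def fun_eq_iff)

lemma local_rep2:
  fixes c :: "('a, 'd) chart" and d d' :: "('b, 'e) chart"
  assumes "p1 \<in> fst c"
  shows "local_dom d (pc c d') (\<lambda>p. (p1, p)) = trans_dom d d'"
    "local_rep d (pc c d') (\<lambda>p. (p1, p)) = (\<lambda>x. (0, transition d d' x) + (snd c p1, 0))"
  using assms by (auto simp: local_dom_def local_rep_def fun_eq_iff)

lemma local_leaf1: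
  assumes tw: "twisted_metric hor ver (img c' \<times> img d) m a b G"
    and c: "c \<in> atlas M1" "c' \<in> atlas M1" and d: "d \<in> atlas M2" "p2 \<in> fst d"
  shows "leaf hor ver (img c' \<times> img d) m a b G (trans_dom c c')
    (local_rep c (pc c' d) (\<lambda>p. (p, p2)))"
  unfolding local_rep1(2)[OF d(2)]
proof (rule twisted_metric.leafI[OF tw, of "\<lambda>v. (v, 0)"])
  show "linear (\<lambda>v::'d. (v, 0::'e))" by (intro linearI) auto
  show "inj (\<lambda>v::'d. (v, 0::'e))" by (simp add: inj_def)
  show "range (\<lambda>v::'d. (v, 0::'e)) = range (\<lambda>v. (fst v, 0))" by (auto simp: image_def)
  show "open (trans_dom c c')" by (rule open_trans_dom[OF M1 c])
  show "smooth_on (trans_dom c c') (transition c c')" by (rule trans_smooth[OF M1 c])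
  fix x assume x: "x \<in> trans_dom c c'"
  show "bij (dd (transition c c') x)" by (rule bij_dd_trans[OF M1 c x])
  show "(transition c c' x, 0) + (0, snd d p2) \<in> img c' \<times> img d"
    using trans_in[OF M1 c x] d(2) by auto
qed

lemma local_leaf2:
  assumes tw: "twisted_metric hor ver (img c \<times> img d') m a b G"
    and c: "c \<in> atlas M1" "p1 \<in> fst c" and d: "d \<in> atlas M2" "d' \<in> atlas M2"
  shows "leaf ver hor (img c \<times> img d') m b a G (trans_dom d d')
    (local_rep d (pc c d') (\<lambda>p. (p1, p)))"
  unfolding local_rep2(2)[OF c(2)]
proof (rule twisted_metric.leafI[OF twisted_metric.twisted_swap[OF tw], of "\<lambda>v. (0, v)"])
  show "linear (\<lambda>v::'e. (0::'d, v))" by (intro linearI) auto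
  show "inj (\<lambda>v::'e. (0::'d, v))" by (simp add: inj_def)
  show "range (\<lambda>v::'e. (0::'d, v)) = range (\<lambda>v. (0, snd v))" by (auto simp: image_def)
  show "open (trans_dom d d')" by (rule open_trans_dom[OF M2 d])
  show "smooth_on (trans_dom d d') (transition d d')" by (rule trans_smooth[OF M2 d])
  fix x assume x: "x \<in> trans_dom d d'"
  show "bij (dd (transition d d') x)" by (rule bij_dd_trans[OF M2 d x])
  show "(0, transition d d' x) + (snd c p1, 0) \<in> img c \<times> img d'"
    using trans_in[OF M2 d x] c(2) by auto
qed

lemma leaf_at1:
  assumes h: "riemannian_metric M h" "conformal M h g" and c: "c \<in> atlas M1" and C: "C \<in> atlas M"
    and x: "x \<in> local_dom c C (\<lambda>p. (p, p2))"
  obtains c' d a where "c' \<in> atlas M1" "d \<in> atlas M2" "C = pc c' d" "p2 \<in> fst d" "x \<in> trans_dom c c'"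
    "leaf hor ver (img c' \<times> img d) (msum c' d) a (\<lambda>z. a z + lnf c' d z)
       (local_metric h C) (trans_dom c c') (local_rep c C (\<lambda>p. (p, p2)))"
proof -
  obtain c' d where C': "C = pc c' d" and c': "c' \<in> atlas M1" and d: "d \<in> atlas M2"
    using C unfolding atlas_prod by blast
  have p: "p2 \<in> fst d" using x C' by (auto simp: local_dom_def)
  obtain a where a: "twisted_metric hor ver (img c' \<times> img d) (msum c' d) a
    (\<lambda>z. a z + lnf c' d z) (local_metric h (pc c' d))"
    using local_twisted[OF h c' d] by blast
  show ?thesis
    using that[OF c' d C' p _ local_leaf1[OF a c c' d p, folded C']] x unfolding C' local_rep1(1)[OF p] by blast
qed

lemma leaf_at2:
  assumes h: "riemannian_metric M h" "conformal M h g" and d: "d \<in> atlas M2" and C: "C \<in> atlas M"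
    and x: "x \<in> local_dom d C (\<lambda>p. (p1, p))"
  obtains c d' a where "c \<in> atlas M1" "d' \<in> atlas M2" "C = pc c d'" "p1 \<in> fst c" "x \<in> trans_dom d d'"
    "leaf ver hor (img c \<times> img d') (msum c d') (\<lambda>z. a z + lnf c d' z) a
       (local_metric h C) (trans_dom d d') (local_rep d C (\<lambda>p. (p1, p)))"
proof -
  obtain c d' where C': "C = pc c d'" and c: "c \<in> atlas M1" and d': "d' \<in> atlas M2"
    using C unfolding atlas_prod by blast
  have p: "p1 \<in> fst c" using x C' by (auto simp: local_dom_def)
  obtain a where a: "twisted_metric hor ver (img c \<times> img d') (msum c d') a
    (\<lambda>z. a z + lnf c d' z) (local_metric h (pc c d'))"
    using local_twisted[OF h c d'] by blast
  show ?thesis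
    using that[OF c d' C' p _ local_leaf2[OF a c p d d', folded C']] x unfolding C' local_rep2(1)[OF p] by blast
qed

text \<open>Smoothness and injectivity of the differential belong to the locale \<open>leaf\<close>,
  applied with \<open>g\<close> as the metric; only the topological part needs an argument.\<close>

lemma embedding1:
  assumes p: "p2 \<in> points M2"
  shows "smooth_embedding M1 M (\<lambda>p. (p, p2))"
proof -
  note h = riemannian_g conformal_refl[of M g]
  \<comment> \<open>The inclusion is the graph of a constant map.\<close>
  have "embedding_map (mtop M1) (mtop M) (\<lambda>p. (p, p2))"
    unfolding mtop_prod by (rule embedding_map_graph[THEN iffD2]) (simp add: p)
  moreover have "continuous_map (mtop M1) (mtop M) (\<lambda>p. (p, p2))"
    unfolding mtop_prod by (simp add: continuous_map_paired p)
  moreover have "smooth_on (local_dom c C (\<lambda>p. (p, p2))) (local_rep c C (\<lambda>p. (p, p2)))"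
    if c: "c \<in> atlas M1" and C: "C \<in> atlas M" for c C
  proof (cases "local_dom c C (\<lambda>p. (p, p2)) = {}")
    case True
    then show ?thesis by (simp add: smooth_on_empty)
  next
    case False
    then obtain x where "x \<in> local_dom c C (\<lambda>p. (p, p2))" by blast
    from leaf_at1[OF h c C this] show ?thesis
    proof cases
      case (1 c' d a)
      from leaf.u_smooth[OF 1(6)] show ?thesis using local_rep1(1)[OF 1(4)] 1(3) by simp
    qed
  qed
  moreover have "inj (dd (local_rep c C (\<lambda>p. (p, p2))) x)"
    if c: "c \<in> atlas M1" and C: "C \<in> atlas M" and x: "x \<in> local_dom c C (\<lambda>p. (p, p2))" for c C x
    using leaf_at1[OF h c C x]
  proof cases
    case (1 c' d a)
    show ?thesis by (rule leaf.u_inj[OF 1(6,5)])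
  qed
  ultimately show ?thesis
    unfolding smooth_embedding_def smooth_map_def by blast
qed

lemma embedding2:
  assumes p: "p1 \<in> points M1"
  shows "smooth_embedding M2 M (\<lambda>p. (p1, p))"
proof -
  note h = riemannian_g conformal_refl[of M g]
  \<comment> \<open>Again the graph of a constant map, now followed by the homeomorphism that swaps
    the factors.\<close>
  have "embedding_map (mtop M2) (prod_topology (mtop M2) (mtop M1)) (\<lambda>p. (p, p1))"
    by (rule embedding_map_graph[THEN iffD2]) (simp add: p)
  from embedding_map_compose[OF this surjective_embedding_map[THEN iffD2, OF homeomorphic_map_swap, THEN conjunct1]]
  have "embedding_map (mtop M2) (mtop M) (\<lambda>p. (p1, p))"
    unfolding mtop_prod by (simp add: o_def)
  moreover have "continuous_map (mtop M2) (mtop M) (\<lambda>p. (p1, p))"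
    unfolding mtop_prod by (simp add: continuous_map_paired p)
  moreover have "smooth_on (local_dom c C (\<lambda>p. (p1, p))) (local_rep c C (\<lambda>p. (p1, p)))"
    if c: "c \<in> atlas M2" and C: "C \<in> atlas M" for c C
  proof (cases "local_dom c C (\<lambda>p. (p1, p)) = {}")
    case True
    then show ?thesis by (simp add: smooth_on_empty)
  next
    case False
    then obtain x where "x \<in> local_dom c C (\<lambda>p. (p1, p))" by blast
    from leaf_at2[OF h c C this] show ?thesis
    proof cases
      case (1 c' d a)
      from leaf.u_smooth[OF 1(6)] show ?thesis using local_rep2(1)[OF 1(4)] 1(3) by simp
    qed
  qed
  moreover have "inj (dd (local_rep c C (\<lambda>p. (p1, p))) x)"
    if c: "c \<in> atlas M2" and C: "C \<in> atlas M" and x: "x \<in> local_dom c C (\<lambda>p. (p1, p))" for c C x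
    using leaf_at2[OF h c C x]
  proof cases
    case (1 c' d a)
    show ?thesis by (rule leaf.u_inj[OF 1(6,5)])
  qed
  ultimately show ?thesis
    unfolding smooth_embedding_def smooth_map_def by blast
qed

lemma umbilic1:
  assumes h: "riemannian_metric M h" "conformal M h g" and p: "p2 \<in> points M2"
  shows "umbilic M h M1 (\<lambda>p. (p, p2))"
  unfolding umbilic_def
proof (intro conjI embedding1[OF p] ballI allI)
  fix c C x v w assume "c \<in> atlas M1" "C \<in> atlas M" "x \<in> local_dom c C (\<lambda>p. (p, p2))"
  from leaf_at1[OF h this] show "tracefree_ff (local_metric h C) (local_rep c C (\<lambda>p. (p, p2))) x v w = 0"
  proof cases
    case (1 c' d a)
    show ?thesis by (rule leaf.tracefree_leaf[OF 1(6,5)])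
  qed
qed

lemma umbilic2:
  assumes h: "riemannian_metric M h" "conformal M h g" and p: "p1 \<in> points M1"
  shows "umbilic M h M2 (\<lambda>p. (p1, p))"
  unfolding umbilic_def
proof (intro conjI embedding2[OF p] ballI allI)
  fix c C x v w assume "c \<in> atlas M2" "C \<in> atlas M" "x \<in> local_dom c C (\<lambda>p. (p1, p))"
  from leaf_at2[OF h this] show "tracefree_ff (local_metric h C) (local_rep c C (\<lambda>p. (p1, p))) x v w = 0"
  proof cases
    case (1 c' d a)
    show ?thesis by (rule leaf.tracefree_leaf[OF 1(6,5)])
  qed
qed

end

section \<open>The tractor condition along leaves and the mixed derivatives of
  \<open>ln f\<close>\<close>

definition tractor_condition ::
  "('b, 'e::euclidean_space) manifold \<Rightarrow> ('b, 'e) tensor2 \<Rightarrow>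
   ('a, 'd::euclidean_space) manifold \<Rightarrow> ('a \<Rightarrow> 'b) \<Rightarrow> bool" where
  "tractor_condition M h S F \<longleftrightarrow> (\<forall>c\<in>atlas S. \<forall>d\<in>atlas M. \<forall>x\<in>local_dom c d F. \<forall>v.
      tractor_condition_at (local_metric h d) (local_rep c d F) x v)"

lemma distinguished_iff:
  "distinguished M g S F \<longleftrightarrow> (\<exists>h. riemannian_metric M h \<and> conformal M h g \<and> umbilic M h S F \<and> tractor_condition M h S F)"
  unfolding distinguished_def tractor_condition_def tractor_condition_at_def Let_def ..

text \<open>An equivalence relation with open classes on a connected space has a single class.
  Reflexivity is part of \<open>nb\<close>, since \<open>x\<close> belongs to its own
  neighbourhood.\<close>

lemma connected_space_equiv:
  assumes X: "connected_space X"
    and nb: "\<And>x. x \<in> topspace X \<Longrightarrow> \<exists>U. openin X U \<and> x \<in> U \<and> (\<forall>y\<in>U. R x y)"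
    and sym: "\<And>x y. x \<in> topspace X \<Longrightarrow> y \<in> topspace X \<Longrightarrow> R x y \<Longrightarrow> R y x"
    and trans: "\<And>x y z. x \<in> topspace X \<Longrightarrow> y \<in> topspace X \<Longrightarrow> z \<in> topspace X \<Longrightarrow> R x y \<Longrightarrow> R y z \<Longrightarrow> R x z"
    and x: "x \<in> topspace X" and y: "y \<in> topspace X"
  shows "R x y"
proof -
  define T where "T = {z \<in> topspace X. R x z}"
  have "openin X T"
  proof (subst openin_subopen, rule ballI)
    fix z assume z: "z \<in> T"
    then obtain U where U: "openin X U" "z \<in> U" "\<forall>w\<in>U. R z w" using nb[of z] by (auto simp: T_def)
    have "U \<subseteq> T"
    proof
      fix w assume w: "w \<in> U"
      then have "w \<in> topspace X" using openin_subset[OF U(1)] by blast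
      then show "w \<in> T" using trans[OF x, of z w] z w U(3) by (simp add: T_def)
    qed
    then show "\<exists>U. openin X U \<and> z \<in> U \<and> U \<subseteq> T" using U by blast
  qed
  moreover have "closedin X T"
    unfolding closedin_def
  proof
    show "openin X (topspace X - T)"
    proof (subst openin_subopen, rule ballI)
      fix z assume z: "z \<in> topspace X - T"
      then obtain U where U: "openin X U" "z \<in> U" "\<forall>w\<in>U. R z w" using nb[of z] by auto
      have "U \<subseteq> topspace X - T"
      proof
        fix w assume w: "w \<in> U"
        then have wt: "w \<in> topspace X" using openin_subset[OF U(1)] by blast
        have "R w z" using sym[of z w] wt z w U(3) by simp
        then show "w \<in> topspace X - T" using trans[OF x wt, of z] z wt by (auto simp: T_def)
      qed
      then show "\<exists>U. openin X U \<and> z \<in> U \<and> U \<subseteq> topspace X - T" using U by blast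
    qed
  qed (auto simp: T_def)
  ultimately have "T = {} \<or> T = topspace X" using X unfolding connected_space_clopen_in by blast
  moreover have "x \<in> T"
  proof -
    obtain U where "x \<in> U" "\<forall>w\<in>U. R x w" using nb[OF x] by blast
    then show ?thesis using x by (simp add: T_def)
  qed
  ultimately have "y \<in> T" using y by blast
  then show ?thesis by (simp add: T_def)
qed

text \<open>The preimage of a ball. Convexity will turn a vanishing derivative into
  constancy.\<close>

lemma convex_chart_nbhd:
  assumes M: "smooth_manifold M" and p: "p \<in> points M"
  shows "\<exists>c\<in>atlas M. \<exists>A. openin (mtop M) A \<and> p \<in> A \<and> A \<subseteq> fst c \<and> convex (snd c ` A)"
proof -
  obtain c where c: "c \<in> atlas M" "p \<in> fst c" using manifold_chart_at[OF M p] by blast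
  have ic: "is_chart (mtop M) c" by (rule manifold_is_chart[OF M c(1)])
  obtain e where e: "e > 0" "ball (snd c p) e \<subseteq> img c"
    using open_img[OF ic] c(2) openE[of "img c" "snd c p"] by blast
  define A where "A = {q \<in> fst c. snd c q \<in> ball (snd c p) e}"
  have "openin (mtop M) A" unfolding A_def by (rule openin_chart_vimage[OF ic open_ball])
  moreover have "p \<in> A" using c e by (simp add: A_def)
  moreover have "snd c ` A = ball (snd c p) e" using e(2) unfolding A_def by blast
  then have "convex (snd c ` A)" by simp
  ultimately show ?thesis using c(1) by (intro bexI[of _ c] exI[of _ A]) (auto simp: A_def)
qed

context twisted_setting
begin

text \<open>Not a curvature condition: the mixed derivatives of \<open>ln f\<close> vanish. This is
  the pivot to which (i), (ii) and (iii) are each compared.\<close>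

definition flat :: bool where
  "flat \<longleftrightarrow> (\<forall>c\<in>atlas M1. \<forall>d\<in>atlas M2. \<forall>z\<in>img c \<times> img d. \<forall>(v :: 'd \<times> 'e) (w :: 'd \<times> 'e).
     dd (\<lambda>y. dd (lnf c d) y (0, snd w)) z (fst v, 0) = 0)"

lemma flatD:
  assumes flat "c \<in> atlas M1" "d \<in> atlas M2" "z \<in> img c \<times> img d"
  shows "\<forall>(v :: 'd \<times> 'e) (w :: 'd \<times> 'e). dd (\<lambda>y. dd (lnf c d) y (0, snd w)) z (fst v, 0) = 0"
  by (rule assms(1)[unfolded flat_def, THEN bspec, OF assms(2), THEN bspec, OF assms(3), THEN bspec, OF assms(4)])

text \<open>For the second family the roles of the factors are exchanged and \<open>ln f\<close>
  changes sign; symmetry of second derivatives leads back to the expression in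
  \<open>flat\<close>.\<close>

lemma mixed_swap:
  assumes c: "c \<in> atlas M1" and d: "d \<in> atlas M2" and z: "z \<in> img c \<times> img d"
  shows "dd (\<lambda>y. dd (\<lambda>y. - lnf c d y) y v) z w = - dd (\<lambda>y. dd (lnf c d) y w) z v"
proof -
  note S = open_imgs(3)[OF c d] and s = lnf_smooth[OF c d]
  have "dd (\<lambda>y. dd (\<lambda>y. - lnf c d y) y v) z = dd (\<lambda>y. - dd (lnf c d) y v) z"
  proof (rule dd_cong_open[OF S z])
    fix y assume "y \<in> img c \<times> img d"
    from dd_eq[OF has_derivative_minus[OF smooth_on_has_derivative[OF s this]]]
    show "dd (\<lambda>y. - lnf c d y) y v = - dd (lnf c d) y v" by simp
  qed
  also have "\<dots> = (\<lambda>w. - dd (\<lambda>y. dd (lnf c d) y v) z w)"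
    by (rule dd_eq[OF has_derivative_minus[OF smooth_on_has_derivative[OF smooth_on_dd[OF s] z]]])
  finally show ?thesis by (simp add: dd_symmetric[OF s S z, of v w])
qed

lemma neg_lnf_smooth: "c \<in> atlas M1 \<Longrightarrow> d \<in> atlas M2 \<Longrightarrow> smooth_on (img c \<times> img d) (\<lambda>y. - lnf c d y)"
  by (rule smooth_on_bounded_linear[OF open_imgs(3) bounded_linear_minus[OF bounded_linear_ident] lnf_smooth])

lemma card_split:
  assumes "DIM('d) \<ge> 2" "DIM('e) \<ge> 2"
  shows "1 \<le> card (prod_split.Bp :: ('d \<times> 'e) set)" "2 \<le> card (prod_split.Bq :: ('d \<times> 'e) set)"
  using assms by (simp_all add: card_prod_Bp card_prod_Bq)

lemma card_split_swap:
  assumes "DIM('d) \<ge> 2" "DIM('e) \<ge> 2"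
  shows "1 \<le> card (prod_split_swap.Bp :: ('d \<times> 'e) set)" "2 \<le> card (prod_split_swap.Bq :: ('d \<times> 'e) set)"
  using assms by (simp_all add: card_prod_Bp card_prod_Bq swap_Bp swap_Bq)

lemma flat_imp_tractor1:
  assumes dims: "DIM('d) \<ge> 2" "DIM('e) \<ge> 2" and flat
    and h: "riemannian_metric M h" "conformal M h g"
  shows "tractor_condition M h M1 (\<lambda>p. (p, p2))"
  unfolding tractor_condition_def
proof (intro ballI)
  fix c C x assume "c \<in> atlas M1" "C \<in> atlas M" "x \<in> local_dom c C (\<lambda>p. (p, p2))"
  from leaf_at1[OF h this] show "\<forall>v. tractor_condition_at (local_metric h C) (local_rep c C (\<lambda>p. (p, p2))) x v"
  proof cases
    case (1 c' d a)
    have "local_rep c C (\<lambda>p. (p, p2)) x \<in> img c' \<times> img d" by (rule leaf.u_in[OF 1(6,5)])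
    from flatD[OF \<open>flat\<close> 1(1,2) this] have "\<forall>(v :: 'd \<times> 'e) (w :: 'd \<times> 'e). dd (\<lambda>y. dd (lnf c' d) y (0, snd w)) (local_rep c C (\<lambda>p. (p, p2)) x) (fst v, 0) = 0" .
    then show ?thesis
      by (rule leaf.distinguished_leaf_iff_mixed[OF 1(6,5) card_split[OF dims] refl lnf_smooth[OF 1(1,2)], THEN iffD2])
  qed
qed

lemma flat_imp_tractor2:
  assumes dims: "DIM('d) \<ge> 2" "DIM('e) \<ge> 2" and flat
    and h: "riemannian_metric M h" "conformal M h g"
  shows "tractor_condition M h M2 (\<lambda>p. (p1, p))"
  unfolding tractor_condition_def
proof (intro ballI)
  fix c C x assume "c \<in> atlas M2" "C \<in> atlas M" "x \<in> local_dom c C (\<lambda>p. (p1, p))"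
  from leaf_at2[OF h this] show "\<forall>v. tractor_condition_at (local_metric h C) (local_rep c C (\<lambda>p. (p1, p))) x v"
  proof cases
    case (1 c' d a)
    have z: "local_rep c C (\<lambda>p. (p1, p)) x \<in> img c' \<times> img d" by (rule leaf.u_in[OF 1(6,5)])
    \<comment> \<open>After the exchange the tangential exponent is \<open>a + ln f\<close> and the
      normal one is \<open>a\<close>, so the difference is \<open>- ln f\<close>.\<close>
    have a: "a = (\<lambda>y. (a y + lnf c' d y) + - lnf c' d y)" by simp
    have "\<forall>(v :: 'd \<times> 'e) (w :: 'd \<times> 'e). dd (\<lambda>y. dd (lnf c' d) y (0, snd w)) (local_rep c C (\<lambda>p. (p1, p)) x) (fst v, 0) = 0"
      by (rule flatD[OF \<open>flat\<close> 1(1,2) z])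
    then have "\<forall>(v :: 'd \<times> 'e) (w :: 'd \<times> 'e). dd (\<lambda>y. dd (\<lambda>y. - lnf c' d y) y (fst w, 0)) (local_rep c C (\<lambda>p. (p1, p)) x) (0, snd v) = 0"
      by (simp only: mixed_swap[OF 1(1,2) z]) simp
    then show ?thesis
      by (rule leaf.distinguished_leaf_iff_mixed[OF 1(6,5) card_split_swap[OF dims] a neg_lnf_smooth[OF 1(1,2)], THEN iffD2])
  qed
qed

text \<open>Every coordinate point \<open>z\<close> lies on one of the leaves, namely that over the
  point of \<open>M2\<close> with coordinates \<open>snd z\<close>. With the same chart
  \<open>c\<close> on the leaf and in the product, the leaf passes through \<open>z\<close> at the
  parameter \<open>fst z\<close>.\<close>

lemma tractor1_imp:
  fixes v w :: "'d \<times> 'e"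
  assumes dims: "DIM('d) \<ge> 2" "DIM('e) \<ge> 2" and h: "riemannian_metric M h" "conformal M h g"
    and t: "tractor_condition M h M1 (\<lambda>p. (p, chart_inv d (snd z)))"
    and c: "c \<in> atlas M1" and d: "d \<in> atlas M2" and z: "z \<in> img c \<times> img d"
  shows "dd (\<lambda>y. dd (lnf c d) y (0, snd w)) z (fst v, 0) = 0"
proof -
  define p2 where "p2 = chart_inv d (snd z)"
  have z': "fst z \<in> img c" "snd z \<in> img d" using z by auto
  have p: "p2 \<in> fst d" unfolding p2_def by (rule chart_inv_in[OF z'(2)])
  obtain a where a: "twisted_metric hor ver (img c \<times> img d) (msum c d) a
    (\<lambda>z. a z + lnf c d z) (local_metric h (pc c d))"
    using local_twisted[OF h c d] by blast
  note lf = local_leaf1[OF a c c d p]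
  have x: "fst z \<in> trans_dom c c" using z' by simp
  have u: "local_rep c (pc c d) (\<lambda>p. (p, p2)) (fst z) = z"
    unfolding local_rep1(2)[OF p] by (simp add: chart_inv_right z' p2_def)
  have "fst z \<in> local_dom c (pc c d) (\<lambda>p. (p, p2))" unfolding local_rep1(1)[OF p] by (rule x)
  note t' = t[folded p2_def, unfolded tractor_condition_def, THEN bspec, OF c, THEN bspec, OF pc_in[OF c d], THEN bspec, OF this]
  from leaf.distinguished_leaf_iff_mixed[OF lf x card_split[OF dims] refl lnf_smooth[OF c d], THEN iffD1, OF t']
  show ?thesis unfolding u by blast
qed

lemma tractor2_imp:
  fixes v w :: "'d \<times> 'e"
  assumes dims: "DIM('d) \<ge> 2" "DIM('e) \<ge> 2" and h: "riemannian_metric M h" "conformal M h g"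
    and t: "tractor_condition M h M2 (\<lambda>p. (chart_inv c (fst z), p))"
    and c: "c \<in> atlas M1" and d: "d \<in> atlas M2" and z: "z \<in> img c \<times> img d"
  shows "dd (\<lambda>y. dd (lnf c d) y (0, snd w)) z (fst v, 0) = 0"
proof -
  define p1 where "p1 = chart_inv c (fst z)"
  have z': "fst z \<in> img c" "snd z \<in> img d" using z by auto
  have p: "p1 \<in> fst c" unfolding p1_def by (rule chart_inv_in[OF z'(1)])
  obtain a where a: "twisted_metric hor ver (img c \<times> img d) (msum c d) a
    (\<lambda>z. a z + lnf c d z) (local_metric h (pc c d))"
    using local_twisted[OF h c d] by blast
  note lf = local_leaf2[OF a c p d d]
  have x: "snd z \<in> trans_dom d d" using z' by simp
  have u: "local_rep d (pc c d) (\<lambda>p. (p1, p)) (snd z) = z"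
    unfolding local_rep2(2)[OF p] by (simp add: chart_inv_right z' p1_def)
  have b: "a = (\<lambda>y. (a y + lnf c d y) + - lnf c d y)" by simp
  have "snd z \<in> local_dom d (pc c d) (\<lambda>p. (p1, p))" unfolding local_rep2(1)[OF p] by (rule x)
  note t' = t[folded p1_def, unfolded tractor_condition_def, THEN bspec, OF d, THEN bspec, OF pc_in[OF c d], THEN bspec, OF this]
  from leaf.distinguished_leaf_iff_mixed[OF lf x card_split_swap[OF dims] b neg_lnf_smooth[OF c d], THEN iffD1, OF t']
  have "dd (\<lambda>y. dd (\<lambda>y. - lnf c d y) y (fst v, 0)) z (0, snd w) = 0" unfolding u by blast
  then show ?thesis by (simp add: mixed_swap[OF c d z])
qed

text \<open>Each leaf may come with its own metric, but all of them give the same equation for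
  \<open>f\<close>. Conversely \<open>g\<close> serves for every leaf.\<close>

lemma distinguished1_iff:
  assumes dims: "DIM('d) \<ge> 2" "DIM('e) \<ge> 2"
  shows "(\<forall>p2\<in>points M2. distinguished M g M1 (\<lambda>p. (p, p2))) \<longleftrightarrow> flat"
proof
  assume *: "\<forall>p2\<in>points M2. distinguished M g M1 (\<lambda>p. (p, p2))"
  show flat unfolding flat_def
  proof (intro ballI allI)
    fix c d z and v w :: "'d \<times> 'e"
    assume c: "c \<in> atlas M1" and d: "d \<in> atlas M2" and z: "z \<in> img c \<times> img d"
    have "snd z \<in> img d" using z by auto
    then have "chart_inv d (snd z) \<in> points M2" by (rule points2[OF d chart_inv_in])
    then obtain h where "riemannian_metric M h" "conformal M h g" "tractor_condition M h M1 (\<lambda>p. (p, chart_inv d (snd z)))"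
      using * unfolding distinguished_iff by blast
    from tractor1_imp[OF dims this c d z] show "dd (\<lambda>y. dd (lnf c d) y (0, snd w)) z (fst v, 0) = 0" .
  qed
next
  assume flat
  then show "\<forall>p2\<in>points M2. distinguished M g M1 (\<lambda>p. (p, p2))"
    unfolding distinguished_iff
    using riemannian_g conformal_refl[of M g] umbilic1[OF riemannian_g conformal_refl]
      flat_imp_tractor1[OF dims _ riemannian_g conformal_refl] by blast
qed

lemma distinguished2_iff:
  assumes dims: "DIM('d) \<ge> 2" "DIM('e) \<ge> 2"
  shows "(\<forall>p1\<in>points M1. distinguished M g M2 (\<lambda>p. (p1, p))) \<longleftrightarrow> flat"
proof
  assume *: "\<forall>p1\<in>points M1. distinguished M g M2 (\<lambda>p. (p1, p))"
  show flat unfolding flat_def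
  proof (intro ballI allI)
    fix c d z and v w :: "'d \<times> 'e"
    assume c: "c \<in> atlas M1" and d: "d \<in> atlas M2" and z: "z \<in> img c \<times> img d"
    have "fst z \<in> img c" using z by auto
    then have "chart_inv c (fst z) \<in> points M1" by (rule points1[OF c chart_inv_in])
    then obtain h where "riemannian_metric M h" "conformal M h g" "tractor_condition M h M2 (\<lambda>p. (chart_inv c (fst z), p))"
      using * unfolding distinguished_iff by blast
    from tractor2_imp[OF dims this c d z] show "dd (\<lambda>y. dd (lnf c d) y (0, snd w)) z (fst v, 0) = 0" .
  qed
next
  assume flat
  then show "\<forall>p1\<in>points M1. distinguished M g M2 (\<lambda>p. (p1, p))"
    unfolding distinguished_iff
    using riemannian_g conformal_refl[of M g] umbilic2[OF riemannian_g conformal_refl]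
      flat_imp_tractor2[OF dims _ riemannian_g conformal_refl] by blast
qed

end

section \<open>Splitting of the twisting function\<close>

context twisted_setting
begin

lemma lnf_at:
  assumes "c \<in> atlas M1" "d \<in> atlas M2" "p \<in> fst c" "q \<in> fst d"
  shows "lnf c d (snd c p, snd d q) = ln (f (p, q))"
proof -
  have "(snd c p, snd d q) \<in> img c \<times> img d" using assms by auto
  then show ?thesis
    by (simp add: lnf_def inv_pc[OF assms(1,2)] chart_inv_left[OF is_chart1[OF assms(1)] assms(3)]
        chart_inv_left[OF is_chart2[OF assms(2)] assms(4)])
qed

text \<open>Integrate the vanishing mixed derivative twice: on \<open>U\<close> the derivatives of
  \<open>lnf\<close> along the second factor do not depend on the first variable, hence a difference
  in the first variable is constant on \<open>V\<close>.\<close>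

lemma lnf_rectangle:
  assumes flat and c: "c \<in> atlas M1" and d: "d \<in> atlas M2"
    and U: "U \<subseteq> img c" "convex U" and V: "V \<subseteq> img d" "convex V"
    and x: "x \<in> U" "x' \<in> U" and y: "y \<in> V" "y' \<in> V"
  shows "lnf c d (x, y) - lnf c d (x', y) = lnf c d (x, y') - lnf c d (x', y')"
proof -
  note s = lnf_smooth[OF c d]
  have in_S: "(x, y) \<in> img c \<times> img d" if "x \<in> U" "y \<in> V" for x y
    using U V that by blast
  have 1: "dd (lnf c d) (x, y) (0, w) = dd (lnf c d) (x', y) (0, w)" if y: "y \<in> V" for y w
  proof -
    have "((\<lambda>x. dd (lnf c d) (x, y) (0, w)) has_derivative (\<lambda>h. 0)) (at x within U)" if xU: "x \<in> U" for x
    proof -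
      have "((\<lambda>x. (x, y)) has_derivative (\<lambda>h. (h, 0))) (at x within U)"
        by (intro has_derivative_Pair has_derivative_ident has_derivative_const)
      from has_derivative_compose[OF this smooth_on_has_derivative[OF smooth_on_dd[OF s] in_S[OF xU y]]]
      have "((\<lambda>x. dd (lnf c d) (x, y) (0, w)) has_derivative (\<lambda>h. dd (\<lambda>z. dd (lnf c d) z (0, w)) (x, y) (h, 0))) (at x within U)" .
      moreover have "dd (\<lambda>z. dd (lnf c d) z (0, w)) (x, y) (h, 0) = 0" for h
        using flatD[OF \<open>flat\<close> c d in_S[OF xU y], rule_format, of "(0, w)" "(h, 0)"] by simp
      ultimately show ?thesis by simp
    qed
    from has_derivative_zero_constant[OF U(2) this] obtain k where "\<forall>x\<in>U. dd (lnf c d) (x, y) (0, w) = k" by blast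
    then show ?thesis using x by simp
  qed
  have "((\<lambda>y. lnf c d (x, y) - lnf c d (x', y)) has_derivative (\<lambda>h. 0)) (at y within V)" if yV: "y \<in> V" for y
  proof -
    have d1: "((\<lambda>y. lnf c d (x, y)) has_derivative (\<lambda>h. dd (lnf c d) (x, y) (0, h))) (at y within V)" if xU: "x \<in> U" for x
    proof -
      have "((\<lambda>y. (x, y)) has_derivative (\<lambda>h. (0, h))) (at y within V)"
        by (intro has_derivative_Pair has_derivative_ident has_derivative_const)
      from has_derivative_compose[OF this smooth_on_has_derivative[OF s in_S[OF xU yV]]] show ?thesis .
    qed
    from has_derivative_diff[OF d1[OF x(1)] d1[OF x(2)]] show ?thesis by (simp add: 1[OF yV])
  qed
  from has_derivative_zero_constant[OF V(2) this] obtain k where "\<forall>y\<in>V. lnf c d (x, y) - lnf c d (x', y) = k" by blast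
  then show ?thesis using y by simp
qed

text \<open>The rectangle identity is an equivalence relation in \<open>q\<close>, \<open>q'\<close>
  and also in \<open>p\<close>, \<open>p'\<close>. With \<open>p\<close> and \<open>p'\<close> in
  one convex patch, connectedness of \<open>M2\<close> gives it for all \<open>q\<close>,
  \<open>q'\<close>; connectedness of \<open>M1\<close> then removes the restriction on
  \<open>p\<close> and \<open>p'\<close>.\<close>

lemma flat_imp_ln_additive:
  assumes conn: "connected_space (mtop M1)" "connected_space (mtop M2)" and flat
    and p: "p \<in> points M1" "p' \<in> points M1" and q: "q \<in> points M2" "q' \<in> points M2"
  shows "ln (f (p, q)) - ln (f (p', q)) = ln (f (p, q')) - ln (f (p', q'))"
proof -
  define R where "R p p' q q' \<longleftrightarrow> ln (f (p, q)) - ln (f (p', q)) = ln (f (p, q')) - ln (f (p', q'))" for p p' q q'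
  have 1: "R p p' q q'"
    if c: "c \<in> atlas M1" and A: "A \<subseteq> fst c" "convex (snd c ` A)" "p \<in> A" "p' \<in> A"
      and q: "q \<in> points M2" "q' \<in> points M2" for c A p p' q q'
  proof (rule connected_space_equiv[OF conn(2), of "R p p'"])
    fix r assume "r \<in> points M2"
    from convex_chart_nbhd[OF M2 this] obtain d B where d: "d \<in> atlas M2" and B: "openin (mtop M2) B" "r \<in> B"
      "B \<subseteq> fst d" "convex (snd d ` B)" by blast
    have "R p p' r s" if s: "s \<in> B" for s
    proof -
      have "lnf c d (snd c p, snd d r) - lnf c d (snd c p', snd d r) = lnf c d (snd c p, snd d s) - lnf c d (snd c p', snd d s)"
        by (rule lnf_rectangle[OF \<open>flat\<close> c d image_mono[OF A(1)] A(2) image_mono[OF B(3)] B(4)])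
          (use A B s in auto)
      moreover have "p \<in> fst c" "p' \<in> fst c" "r \<in> fst d" "s \<in> fst d" using A B s by auto
      ultimately show ?thesis unfolding R_def by (simp add: lnf_at[OF c d])
    qed
    then show "\<exists>U. openin (mtop M2) U \<and> r \<in> U \<and> (\<forall>y\<in>U. R p p' r y)" using B by blast
  qed (use q in \<open>auto simp: R_def\<close>)
  have "\<forall>q\<in>points M2. \<forall>q'\<in>points M2. R p p' q q'"
  proof (rule connected_space_equiv[OF conn(1), of "\<lambda>p p'. \<forall>q\<in>points M2. \<forall>q'\<in>points M2. R p p' q q'"])
    fix r assume "r \<in> points M1"
    from convex_chart_nbhd[OF M1 this] obtain c A where c: "c \<in> atlas M1" and A: "openin (mtop M1) A" "r \<in> A"
      "A \<subseteq> fst c" "convex (snd c ` A)" by blast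
    then show "\<exists>U. openin (mtop M1) U \<and> r \<in> U \<and> (\<forall>y\<in>U. \<forall>q\<in>points M2. \<forall>q'\<in>points M2. R r y q q')"
      using 1[OF c A(3,4,2)] by blast
  next
    fix x y assume *: "\<forall>q\<in>points M2. \<forall>q'\<in>points M2. R x y q q'"
    show "\<forall>q\<in>points M2. \<forall>q'\<in>points M2. R y x q q'"
    proof (intro ballI)
      fix q q' assume "q \<in> points M2" "q' \<in> points M2"
      then have "R x y q q'" using * by blast
      then show "R y x q q'" unfolding R_def by linarith
    qed
  next
    fix x y z assume *: "\<forall>q\<in>points M2. \<forall>q'\<in>points M2. R x y q q'" "\<forall>q\<in>points M2. \<forall>q'\<in>points M2. R y z q q'"
    show "\<forall>q\<in>points M2. \<forall>q'\<in>points M2. R x z q q'"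
    proof (intro ballI)
      fix q q' assume "q \<in> points M2" "q' \<in> points M2"
      then have "R x y q q'" "R y z q q'" using * by blast+
      then show "R x z q q'" unfolding R_def by linarith
    qed
  qed (use p in auto)
  then show ?thesis using q unfolding R_def by blast
qed

definition splits :: bool where
  "splits \<longleftrightarrow> (\<exists>f1 f2. (\<forall>p\<in>points M1. f1 p > 0) \<and> (\<forall>p\<in>points M2. f2 p > (0::real)) \<and>
     (\<forall>p\<in>points M1. \<forall>q\<in>points M2. f (p, q) = f1 p * f2 q))"

lemma flat_imp_splits:
  assumes conn: "connected_space (mtop M1)" "connected_space (mtop M2)" and flat
  shows splits
proof (cases "points M1 = {} \<or> points M2 = {}")
  \<comment> \<open>\<open>connected_space\<close> admits the empty space; there the product formula
    is vacuous and constant factors do.\<close>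
  case True
  then show ?thesis unfolding splits_def by (intro exI[of _ "\<lambda>_. 1"]) auto
next
  case False
  then obtain p0 q0 where 0: "p0 \<in> points M1" "q0 \<in> points M2" by blast
  \<comment> \<open>The exponential of the additive identity, with \<open>p0\<close>,
    \<open>q0\<close> as second corner of the rectangle.\<close>
  have "f (p, q) = f (p, q0) * (f (p0, q) / f (p0, q0))" if p: "p \<in> points M1" and q: "q \<in> points M2" for p q
  proof -
    note pos = f_pos[OF p q] f_pos[OF p 0(2)] f_pos[OF 0(1) q] f_pos[OF 0]
    have "ln (f (p, q) * f (p0, q0)) = ln (f (p, q0) * f (p0, q))"
      using flat_imp_ln_additive[OF assms p 0(1) q 0(2)] pos by (simp add: ln_mult_pos)
    then have "f (p, q) * f (p0, q0) = f (p, q0) * f (p0, q)"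
      using pos by (subst (asm) ln_inj_iff) simp_all
    then show ?thesis using pos by (simp add: field_simps)
  qed
  moreover have "\<forall>p\<in>points M1. f (p, q0) > 0" "\<forall>q\<in>points M2. f (p0, q) / f (p0, q0) > 0"
    using f_pos 0 by (auto intro: divide_pos_pos)
  ultimately show ?thesis
    unfolding splits_def
    by (intro exI[of _ "\<lambda>p. f (p, q0)"] exI[of _ "\<lambda>q. f (p0, q) / f (p0, q0)"] conjI ballI) blast+
qed

lemma smooth_slices:
  assumes c: "c \<in> atlas M1" and d: "d \<in> atlas M2"
  shows "q \<in> fst d \<Longrightarrow> smooth_on (img c) (\<lambda>x. f (chart_inv c x, q))"
    "p \<in> fst c \<Longrightarrow> smooth_on (img d) (\<lambda>y. f (p, chart_inv d y))"
proof -
  assume q: "q \<in> fst d"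
  have "smooth_on (img c) (\<lambda>x. f (chart_inv (pc c d) ((x, 0) + (0, snd d q))))"
    by (rule smooth_on_affine_compose[OF open_imgs(3)[OF c d] _ open_imgs(1)[OF c] _ smooth_f[OF c d], of "\<lambda>x. (x, 0)"])
      (use q in \<open>auto intro: bounded_linear_Pair bounded_linear_ident bounded_linear_zero\<close>)
  then show "smooth_on (img c) (\<lambda>x. f (chart_inv c x, q))"
    using q by (subst smooth_on_cong[OF open_imgs(1)[OF c], of _ "\<lambda>x. f (chart_inv (pc c d) ((x, 0) + (0, snd d q)))"])
      (simp_all add: inv_pc[OF c d] chart_inv_left[OF is_chart2[OF d]])
next
  assume p: "p \<in> fst c"
  have "smooth_on (img d) (\<lambda>y. f (chart_inv (pc c d) ((0, y) + (snd c p, 0))))"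
    by (rule smooth_on_affine_compose[OF open_imgs(3)[OF c d] _ open_imgs(2)[OF d] _ smooth_f[OF c d], of "\<lambda>y. (0, y)"])
      (use p in \<open>auto intro: bounded_linear_Pair bounded_linear_ident bounded_linear_zero\<close>)
  then show "smooth_on (img d) (\<lambda>y. f (p, chart_inv d y))"
    using p by (subst smooth_on_cong[OF open_imgs(2)[OF d], of _ "\<lambda>y. f (chart_inv (pc c d) ((0, y) + (snd c p, 0)))"])
      (simp_all add: inv_pc[OF c d] chart_inv_left[OF is_chart1[OF c]])
qed

lemma smooth_slice1:
  assumes "q \<in> points M2" shows "smooth_fun M1 (\<lambda>p. f (p, q))"
proof -
  obtain d where d: "d \<in> atlas M2" "q \<in> fst d" using manifold_chart_at[OF M2 assms] by blast
  show ?thesis unfolding smooth_fun_def o_def using smooth_slices(1)[OF _ d] by blast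
qed

lemma smooth_slice2:
  assumes "p \<in> points M1" shows "smooth_fun M2 (\<lambda>q. f (p, q))"
proof -
  obtain c where c: "c \<in> atlas M1" "p \<in> fst c" using manifold_chart_at[OF M1 assms] by blast
  show ?thesis unfolding smooth_fun_def o_def using smooth_slices(2)[OF c(1) _ c(2)] by blast
qed

text \<open>The factors \<open>f1\<close> and \<open>f2\<close> need not be differentiable. Instead
  \<open>lnf\<close> is split into its own slice \<open>\<phi>\<close> through \<open>z\<close> and
  the remainder \<open>\<psi>\<close>; both are smooth, and the splitting of \<open>f\<close> is
  used only to see that \<open>\<psi>\<close> does not depend on the first variable.\<close>

lemma splits_imp_flat:
  assumes splits
  shows flat
  unfolding flat_def
proof (intro ballI allI)
  fix c d z and v w :: "'d \<times> 'e"
  assume c: "c \<in> atlas M1" and d: "d \<in> atlas M2" and z: "z \<in> img c \<times> img d"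
  obtain f1 f2 where f1: "\<And>p. p \<in> points M1 \<Longrightarrow> f1 p > 0" and f2: "\<And>p. p \<in> points M2 \<Longrightarrow> f2 p > (0::real)"
    and f12: "\<And>p q. p \<in> points M1 \<Longrightarrow> q \<in> points M2 \<Longrightarrow> f (p, q) = f1 p * f2 q"
    using assms unfolding splits_def by blast
  define S where "S = img c \<times> img d"
  have S: "open S" unfolding S_def by (rule open_imgs(3)[OF c d])
  have zS: "z \<in> S" using z by (simp add: S_def)
  have sum: "lnf c d y = ln (f1 (chart_inv c (fst y))) + ln (f2 (chart_inv d (snd y)))" if "y \<in> S" for y
    using inv_pc_points(1,2)[OF c d that[unfolded S_def]] f1 f2 f12 that
    by (simp add: lnf_def inv_pc[OF c d] S_def ln_mult_pos)
  define \<phi> where "\<phi> y = lnf c d ((fst y, 0) + (0, snd z))" for y :: "'d \<times> 'e"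
  define \<psi> where "\<psi> y = lnf c d y + (- \<phi> y)" for y
  have \<phi>S: "(fst y, 0) + (0, snd z) \<in> S" if "y \<in> S" for y using that zS by (auto simp: S_def)
  have \<phi>s: "smooth_on S \<phi>"
    unfolding \<phi>_def by (rule smooth_on_affine_compose[OF S bounded_linear_fst_snd(1) S \<phi>S])
      (simp_all add: S_def lnf_smooth[OF c d])
  have \<psi>s: "smooth_on S \<psi>"
    unfolding \<psi>_def by (rule smooth_on_add[OF S lnf_smooth[OF c d, folded S_def]
          smooth_on_bounded_linear[OF S bounded_linear_minus[OF bounded_linear_ident] \<phi>s]])
  have \<phi>inv: "shift_invariant S (\<lambda>v. (0, snd v)) \<phi>"
    unfolding shift_invariant_def \<phi>_def by simp
  have \<psi>inv: "shift_invariant S (\<lambda>v. (fst v, 0)) \<psi>"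
    unfolding shift_invariant_def
  proof (intro allI impI)
    fix y x assume y: "y \<in> S" "y + (fst x, 0) \<in> S"
    have "\<psi> u = ln (f2 (chart_inv d (snd u))) - ln (f2 (chart_inv d (snd z)))" if "u \<in> S" for u
      using sum[OF that] sum[OF \<phi>S[OF that]] by (simp add: \<psi>_def \<phi>_def)
    from this[OF y(1)] this[OF y(2)] show "\<psi> (y + (fst x, 0)) = \<psi> y" by simp
  qed
  have lp: "linear (\<lambda>v::'d \<times> 'e. (fst v, 0::'e))" "linear (\<lambda>v::'d \<times> 'e. (0::'d, snd v))"
    by (rule bounded_linear.linear[OF bounded_linear_fst_snd(1)] bounded_linear.linear[OF bounded_linear_fst_snd(2)])+
  have "dd (\<lambda>y. dd (lnf c d) y (0, snd w)) z = dd (\<lambda>y. dd \<psi> y (0, snd w)) z"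
  proof (rule dd_cong_open[OF S zS])
    fix y assume y: "y \<in> S"
    have "lnf c d = (\<lambda>y. \<psi> y + \<phi> y)" by (simp add: \<psi>_def fun_eq_iff)
    then have "dd (lnf c d) y = dd (\<lambda>y. \<psi> y + \<phi> y) y" by simp
    also have "\<dots> = (\<lambda>h. dd \<psi> y h + dd \<phi> y h)"
      by (rule dd_eq[OF has_derivative_add[OF smooth_on_has_derivative[OF \<psi>s y] smooth_on_has_derivative[OF \<phi>s y]]])
    moreover have "dd \<phi> y (0, snd w) = 0"
      by (rule dd_shift_invariant_eq_0[OF S lp(2) \<phi>inv y smooth_on_imp_differentiable[OF \<phi>s y]])
    ultimately show "dd (lnf c d) y (0, snd w) = dd \<psi> y (0, snd w)" by simp
  qed
  moreover have "dd (\<lambda>y. dd \<psi> y (0, snd w)) z (fst v, 0) = 0"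
    by (rule dd_shift_invariant_eq_0[OF S lp(1) shift_invariant_dd[OF S \<psi>inv smooth_on_imp_differentiable[OF \<psi>s]] zS
          smooth_on_imp_differentiable[OF smooth_on_dd[OF \<psi>s] zS]])
  ultimately show "dd (\<lambda>y. dd (lnf c d) y (0, snd w)) z (fst v, 0) = 0" by simp
qed

section \<open>From the splitting of \<open>f\<close> to warped and conformally product metrics, and
  back\<close>

definition warped :: bool where
  "warped \<longleftrightarrow> (\<exists>f1 h2. smooth_fun M1 f1 \<and> (\<forall>p\<in>points M1. f1 p > 0) \<and>
                 riemannian_metric M2 h2 \<and> conformal M2 h2 g2 \<and>
                 tensor_eq M g (warped_product M1 M2 g1 f1 h2))"

definition conformally_product :: bool where
  "conformally_product \<longleftrightarrow> (\<exists>h1 h2. riemannian_metric M1 h1 \<and> riemannian_metric M2 h2 \<and>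
                 conformal M g (product_metric M1 M2 h1 h2))"

lemma tensor_eq_prodI:
  assumes "\<And>c d P v w. c \<in> atlas M1 \<Longrightarrow> d \<in> atlas M2 \<Longrightarrow> P \<in> fst c \<times> fst d \<Longrightarrow> s (pc c d) P v w = t (pc c d) P v w"
  shows "tensor_eq M s t"
  unfolding tensor_eq_def
proof (intro ballI allI)
  fix C P v w assume "C \<in> atlas M" and P: "P \<in> fst C"
  then obtain c d where C: "C = pc c d" "c \<in> atlas M1" "d \<in> atlas M2" unfolding atlas_prod by blast
  then have "P \<in> fst c \<times> fst d" using P by simp
  from assms[OF C(2,3) this] show "s C P v w = t C P v w" unfolding C(1) .
qed

lemma pc_points: "c \<in> atlas M1 \<Longrightarrow> d \<in> atlas M2 \<Longrightarrow> P \<in> fst c \<times> fst d \<Longrightarrow> fst P \<in> points M1 \<and> snd P \<in> points M2"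
  using points1[of c "fst P"] points2[of d "snd P"] by auto

text \<open>The given factors are replaced by slices of \<open>f\<close> through a base point, which
  are smooth; \<open>g2\<close> is rescaled by the slice in the second variable.\<close>

lemma splits_imp_warped:
  assumes splits
  shows warped
proof (cases "points M1 = {} \<or> points M2 = {}")
  case True
  have "tensor_eq M g (warped_product M1 M2 g1 (\<lambda>_. 1) g2)"
    by (rule tensor_eq_prodI) (use pc_points True in blast)
  then show ?thesis
    unfolding warped_def
    by (intro exI[of _ "\<lambda>_. 1"] exI[of _ g2]) (simp add: g2 conformal_refl smooth_fun_def o_def smooth_on_const)
next
  case False
  then obtain p0 q0 where 0: "p0 \<in> points M1" "q0 \<in> points M2" by blast
  obtain f1 f2 where f1: "\<And>p. p \<in> points M1 \<Longrightarrow> f1 p > 0" and f2: "\<And>p. p \<in> points M2 \<Longrightarrow> f2 p > (0::real)"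
    and f12: "\<And>p q. p \<in> points M1 \<Longrightarrow> q \<in> points M2 \<Longrightarrow> f (p, q) = f1 p * f2 q"
    using assms unfolding splits_def by blast
  \<comment> \<open>Equal to \<open>f2 q / f2 q0\<close>; the normalisation makes
    \<open>f (p, q0) * k q\<close> equal to \<open>f (p, q)\<close>.\<close>
  define k where "k q = inverse (f (p0, q0)) * f (p0, q)" for q
  have k: "smooth_fun M2 k"
    unfolding smooth_fun_def
  proof
    fix d assume d: "d \<in> atlas M2"
    have "smooth_on (img d) (\<lambda>y. inverse (f (p0, q0)) * f (p0, chart_inv d y))"
      by (intro smooth_on_mult smooth_on_const open_imgs(2)[OF d])
        (use smooth_slice2[OF 0(1)] d in \<open>auto simp: smooth_fun_def o_def\<close>)
    then show "smooth_on (img d) (k \<circ> chart_inv d)" by (simp add: k_def o_def)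
  qed
  have kpos: "\<forall>q\<in>points M2. k q > 0" using f_pos[OF 0] f_pos[OF 0(1)] by (simp add: k_def)
  define h2 where "h2 = (\<lambda>c p v w. k p * g2 c p v w)"
  have h2: "riemannian_metric M2 h2" unfolding h2_def by (rule riemannian_metric_scale[OF M2 g2 k kpos])
  have "conformal M2 h2 g2" unfolding conformal_def tensor_eq_def h2_def using k kpos by blast
  moreover have "tensor_eq M g (warped_product M1 M2 g1 (\<lambda>p. f (p, q0)) h2)"
  proof (rule tensor_eq_prodI)
    fix c d P v w assume c: "c \<in> atlas M1" and d: "d \<in> atlas M2" and P: "P \<in> fst c \<times> fst d"
    have P': "fst P \<in> points M1" "snd P \<in> points M2" using pc_points[OF c d P] by auto
    have "f P = f1 (fst P) * f2 (snd P)" using f12[OF P'] by simp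
    also have "\<dots> = f (fst P, q0) * k (snd P)"
      using f12[OF P'(1) 0(2)] f12[OF 0] f12[OF 0(1) P'(2)] f1[OF 0(1)] f2[OF 0(2)] by (simp add: k_def field_simps)
    finally show "g (pc c d) P v w = warped_product M1 M2 g1 (\<lambda>p. f (p, q0)) h2 (pc c d) P v w"
      unfolding warped_product_def twisted_product_pc[OF c d P g1 g2] twisted_product_pc[OF c d P g1 h2]
      by (simp add: h2_def)
  qed
  ultimately show ?thesis
    unfolding warped_def using smooth_slice1[OF 0(2)] f_pos[OF _ 0(2)] h2
    by (intro exI[of _ "\<lambda>p. f (p, q0)"] exI[of _ h2]) simp
qed

text \<open>Take \<open>f1\<close> out of \<open>g1 + f1 h2\<close> as the conformal factor; what
  remains is the product of \<open>g1 / f1\<close> and \<open>h2\<close>.\<close>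

lemma warped_imp_conformally_product:
  assumes warped
  shows conformally_product
proof -
  obtain f1 h2 where f1: "smooth_fun M1 f1" "\<forall>p\<in>points M1. f1 p > 0" and h2: "riemannian_metric M2 h2"
    and eq: "tensor_eq M g (warped_product M1 M2 g1 f1 h2)"
    using assms unfolding warped_def by blast
  define h1 where "h1 = (\<lambda>c p v w. inverse (f1 p) * g1 c p v w)"
  have "smooth_fun M1 (\<lambda>p. inverse (f1 p))"
    unfolding smooth_fun_def
  proof
    fix c assume c: "c \<in> atlas M1"
    have "smooth_on (img c) (\<lambda>x. inverse (f1 (chart_inv c x)))"
    proof (rule smooth_on_inverse[OF open_imgs(1)[OF c]])
      fix x assume "x \<in> img c"
      then have "f1 (chart_inv c x) > 0" using f1(2) points1[OF c chart_inv_in] by blast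
      then show "f1 (chart_inv c x) \<noteq> 0" by simp
    qed (use f1(1) c in \<open>auto simp: smooth_fun_def o_def\<close>)
    then show "smooth_on (img c) ((\<lambda>p. inverse (f1 p)) \<circ> chart_inv c)" by (simp add: o_def)
  qed
  then have h1: "riemannian_metric M1 h1"
    unfolding h1_def using f1(2) by (intro riemannian_metric_scale[OF M1 g1]) auto
  have "conformal M g (product_metric M1 M2 h1 h2)"
    unfolding conformal_def
  proof (intro exI[of _ "\<lambda>P. f1 (fst P)"] conjI)
    show "smooth_fun M (\<lambda>P. f1 (fst P))"
      unfolding smooth_fun_def
    proof
      fix C assume "C \<in> atlas M"
      then obtain c d where C: "C = pc c d" "c \<in> atlas M1" "d \<in> atlas M2" unfolding atlas_prod by blast
      have "smooth_on (img c \<times> img d) (\<lambda>z. f1 (chart_inv c (fst z)))"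
        by (rule smooth_on_fst_compose[OF open_imgs(1)[OF C(2)] open_imgs(2)[OF C(3)]])
          (use f1(1) C(2) in \<open>auto simp: smooth_fun_def o_def\<close>)
      then show "smooth_on (img C) ((\<lambda>P. f1 (fst P)) \<circ> chart_inv C)"
        unfolding C(1) img_pc
        by (subst smooth_on_cong[OF open_imgs(3)[OF C(2,3)]]) (simp_all add: inv_pc[OF C(2,3)])
    qed
    show "\<forall>p\<in>points M. f1 (fst p) > 0" using f1(2) by (auto simp: points_prod)
    show "tensor_eq M g (\<lambda>c p v w. f1 (fst p) * product_metric M1 M2 h1 h2 c p v w)"
    proof (rule tensor_eq_prodI)
      fix c d P v w assume c: "c \<in> atlas M1" and d: "d \<in> atlas M2" and P: "P \<in> fst c \<times> fst d"
      have pos: "f1 (fst P) > 0" using pc_points[OF c d P] f1(2) by blast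
      have "P \<in> fst (pc c d)" using P by simp
      then have "g (pc c d) P v w = warped_product M1 M2 g1 f1 h2 (pc c d) P v w"
        using eq pc_in[OF c d] unfolding tensor_eq_def by blast
      then show "g (pc c d) P v w = f1 (fst P) * product_metric M1 M2 h1 h2 (pc c d) P v w"
        unfolding warped_product_def product_metric_def twisted_product_pc[OF c d P g1 h2] twisted_product_pc[OF c d P h1 h2]
        using pos by (simp add: h1_def field_simps)
    qed
  qed
  then show ?thesis unfolding conformally_product_def using h1 h2 by blast
qed

text \<open>Evaluated on vectors tangent to one factor, the conformal relation reads
  \<open>g1 = \<Omega> h1\<close> and \<open>f g2 = \<Omega> h2\<close>. The quotient eliminates
  \<open>\<Omega>\<close>, and the ratios \<open>g1 / h1\<close> and \<open>h2 / g2\<close> each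
  depend on one variable only.\<close>

lemma conformally_product_imp_splits:
  assumes conformally_product
  shows splits
proof -
  obtain h1 h2 where h1: "riemannian_metric M1 h1" and h2: "riemannian_metric M2 h2"
    and conf: "conformal M g (product_metric M1 M2 h1 h2)"
    using assms unfolding conformally_product_def by blast
  obtain \<Omega> where \<Omega>: "\<And>P. P \<in> points M \<Longrightarrow> \<Omega> P > 0"
    and eq: "tensor_eq M g (\<lambda>c p v w. \<Omega> p * product_metric M1 M2 h1 h2 c p v w)"
    using conf unfolding conformal_def by blast
  \<comment> \<open>The ratios are needed only pointwise, so one chart per point and one fixed
    coordinate vector per factor are enough; \<open>f1\<close> and \<open>f2\<close> then depend on
    one point each.\<close>
  define C where "C p = (SOME c. c \<in> atlas M1 \<and> p \<in> fst c)" for p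
  define D where "D q = (SOME d. d \<in> atlas M2 \<and> q \<in> fst d)" for q
  have C: "C p \<in> atlas M1 \<and> p \<in> fst (C p)" if "p \<in> points M1" for p
    unfolding C_def by (rule someI_ex) (use manifold_chart_at[OF M1 that] in blast)
  have D: "D q \<in> atlas M2 \<and> q \<in> fst (D q)" if "q \<in> points M2" for q
    unfolding D_def by (rule someI_ex) (use manifold_chart_at[OF M2 that] in blast)
  obtain v :: 'd where v: "v \<noteq> 0" using nonempty_Basis nonzero_Basis by blast
  obtain w :: 'e where w: "w \<noteq> 0" using nonempty_Basis nonzero_Basis by blast
  define f1 where "f1 p = g1 (C p) p v v / h1 (C p) p v v" for p
  define f2 where "f2 q = h2 (D q) q w w / g2 (D q) q w w" for q
  have pos1: "g1 (C p) p v v > 0" "h1 (C p) p v v > 0" if "p \<in> points M1" for p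
    using riemannian_metric_inner_product[OF g1, of "C p" p] riemannian_metric_inner_product[OF h1, of "C p" p] C[OF that] v
    by (simp_all add: inner_product_def)
  have pos2: "g2 (D q) q w w > 0" "h2 (D q) q w w > 0" if "q \<in> points M2" for q
    using riemannian_metric_inner_product[OF g2, of "D q" q] riemannian_metric_inner_product[OF h2, of "D q" q] D[OF that] w
    by (simp_all add: inner_product_def)
  have "f (p, q) = f1 p * f2 q" if p: "p \<in> points M1" and q: "q \<in> points M2" for p q
  proof -
    have c: "C p \<in> atlas M1" "p \<in> fst (C p)" and d: "D q \<in> atlas M2" "q \<in> fst (D q)" using C[OF p] D[OF q] by auto
    have P: "(p, q) \<in> fst (C p) \<times> fst (D q)" using c d by simp
    have P': "(p, q) \<in> fst (pc (C p) (D q))" using c d by simp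
    have z: "bilinear (g1 (C p) p)" "bilinear (g2 (D q) q)" "bilinear (h1 (C p) p)" "bilinear (h2 (D q) q)"
      using riemannian_metric_inner_product[OF g1 c] riemannian_metric_inner_product[OF g2 d]
        riemannian_metric_inner_product[OF h1 c] riemannian_metric_inner_product[OF h2 d] by (simp_all add: inner_product_def)
    have "g (pc (C p) (D q)) (p, q) a b = \<Omega> (p, q) * product_metric M1 M2 h1 h2 (pc (C p) (D q)) (p, q) a b" for a b
      using eq pc_in[OF c(1) d(1)] P' unfolding tensor_eq_def by blast
    then have e: "g1 (C p) p (fst a) (fst b) + f (p, q) * g2 (D q) q (snd a) (snd b)
      = \<Omega> (p, q) * (h1 (C p) p (fst a) (fst b) + h2 (D q) q (snd a) (snd b))" for a b
      unfolding product_metric_def twisted_product_pc[OF c(1) d(1) P g1 g2] twisted_product_pc[OF c(1) d(1) P h1 h2] by simp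
    have "g1 (C p) p v v = \<Omega> (p, q) * h1 (C p) p v v"
      using e[of "(v, 0)" "(v, 0)"] by (simp add: bilinear_lzero[OF z(2)] bilinear_lzero[OF z(4)])
    moreover have "f (p, q) * g2 (D q) q w w = \<Omega> (p, q) * h2 (D q) q w w"
      using e[of "(0, w)" "(0, w)"] by (simp add: bilinear_lzero[OF z(1)] bilinear_lzero[OF z(3)])
    ultimately show ?thesis
      using pos1[OF p] pos2[OF q] by (simp add: f1_def f2_def field_simps)
  qed
  moreover have "\<forall>p\<in>points M1. f1 p > 0" "\<forall>q\<in>points M2. f2 q > 0"
    using pos1 pos2 by (simp_all add: f1_def f2_def)
  ultimately show ?thesis unfolding splits_def by blast
qed

end

theorem theorem5p19:
  fixes M\<^sub>1 :: "('a, 'd::euclidean_space) manifold"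
    and M\<^sub>2 :: "('b, 'e::euclidean_space) manifold"
    and g\<^sub>1 :: "('a, 'd) tensor2"
    and g\<^sub>2 :: "('b, 'e) tensor2"
    and f :: "'a \<times> 'b \<Rightarrow> real"
    and M :: "('a \<times> 'b, 'd \<times> 'e) manifold"
    and g :: "('a \<times> 'b, 'd \<times> 'e) tensor2"
  assumes "smooth_manifold M\<^sub>1" and "connected_space (mtop M\<^sub>1)" and "DIM('d) \<ge> 2"
    and "riemannian_metric M\<^sub>1 g\<^sub>1"
    and "smooth_manifold M\<^sub>2" and "connected_space (mtop M\<^sub>2)" and "DIM('e) \<ge> 2"
    and "riemannian_metric M\<^sub>2 g\<^sub>2"
    and "M = prod_manifold M\<^sub>1 M\<^sub>2"
    and "smooth_fun M f" and "\<forall>p\<in>points M. f p > 0"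
    and "g = twisted_product M\<^sub>1 M\<^sub>2 g\<^sub>1 f g\<^sub>2"
  defines "i \<equiv> \<forall>p\<^sub>2\<in>points M\<^sub>2. distinguished M g M\<^sub>1 (\<lambda>p. (p, p\<^sub>2))"
    and "ii \<equiv> \<forall>p\<^sub>1\<in>points M\<^sub>1. distinguished M g M\<^sub>2 (\<lambda>p. (p\<^sub>1, p))"
    and "iii \<equiv> \<exists>f\<^sub>1 f\<^sub>2. (\<forall>p\<in>points M\<^sub>1. f\<^sub>1 p > 0) \<and> (\<forall>p\<in>points M\<^sub>2. f\<^sub>2 p > 0) \<and>
                 (\<forall>p\<in>points M\<^sub>1. \<forall>q\<in>points M\<^sub>2. f (p, q) = f\<^sub>1 p * f\<^sub>2 q)"
    and "iv \<equiv> \<exists>f\<^sub>1 h\<^sub>2. smooth_fun M\<^sub>1 f\<^sub>1 \<and> (\<forall>p\<in>points M\<^sub>1. f\<^sub>1 p > 0) \<and>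
                 riemannian_metric M\<^sub>2 h\<^sub>2 \<and> conformal M\<^sub>2 h\<^sub>2 g\<^sub>2 \<and>
                 tensor_eq M g (warped_product M\<^sub>1 M\<^sub>2 g\<^sub>1 f\<^sub>1 h\<^sub>2)"
    and "v \<equiv> \<exists>h\<^sub>1 h\<^sub>2. riemannian_metric M\<^sub>1 h\<^sub>1 \<and> riemannian_metric M\<^sub>2 h\<^sub>2 \<and>
                 conformal M g (product_metric M\<^sub>1 M\<^sub>2 h\<^sub>1 h\<^sub>2)"
  shows "(\<forall>p\<^sub>2\<in>points M\<^sub>2. umbilic M g M\<^sub>1 (\<lambda>p. (p, p\<^sub>2))) \<and>
         (\<forall>p\<^sub>1\<in>points M\<^sub>1. umbilic M g M\<^sub>2 (\<lambda>p. (p\<^sub>1, p))) \<and>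
         (i \<longleftrightarrow> ii) \<and> (ii \<longleftrightarrow> iii) \<and> (iii \<longleftrightarrow> iv) \<and> (iv \<longleftrightarrow> v)"
proof -
  interpret twisted_setting M\<^sub>1 M\<^sub>2 g\<^sub>1 g\<^sub>2 f
    by (rule twisted_setting.intro) (use assms(1,4,5,8-11) in \<open>auto simp: mtop_prod\<close>)
  note M_eq = \<open>M = prod_manifold M\<^sub>1 M\<^sub>2\<close> and g_eq = \<open>g = twisted_product M\<^sub>1 M\<^sub>2 g\<^sub>1 f g\<^sub>2\<close>
  have "i \<longleftrightarrow> flat" unfolding i_def M_eq g_eq by (rule distinguished1_iff[OF assms(3,7)])
  moreover have "ii \<longleftrightarrow> flat" unfolding ii_def M_eq g_eq by (rule distinguished2_iff[OF assms(3,7)])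
  moreover have "iii \<longleftrightarrow> splits" unfolding iii_def splits_def ..
  moreover have "iv \<longleftrightarrow> warped" unfolding iv_def warped_def M_eq g_eq ..
  moreover have "v \<longleftrightarrow> conformally_product" unfolding v_def conformally_product_def M_eq g_eq ..
  \<comment> \<open>These close two cycles: between \<open>flat\<close> and \<open>splits\<close>,
    where connectedness enters, and through \<open>splits\<close>, \<open>warped\<close> and
    \<open>conformally_product\<close>.\<close>
  moreover note flat_imp_splits[OF assms(2,6)] splits_imp_flat splits_imp_warped
    warped_imp_conformally_product conformally_product_imp_splits
  moreover have "\<forall>p\<^sub>2\<in>points M\<^sub>2. umbilic M g M\<^sub>1 (\<lambda>p. (p, p\<^sub>2))" "\<forall>p\<^sub>1\<in>points M\<^sub>1. umbilic M g M\<^sub>2 (\<lambda>p. (p\<^sub>1, p))"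
    unfolding M_eq g_eq using umbilic1[OF riemannian_g conformal_refl] umbilic2[OF riemannian_g conformal_refl] by blast+
  ultimately show ?thesis by blast
qed

end
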